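(* Let $n \ge 1$ be an integer, $0 < \rho < 1$ and $0 < p_1, p_2, p \le \infty$. Put $$m_\rho(p_1,p_2) = -(1-\rho)\, n \max\left\{ \frac12,\ \frac1{p_1},\ \frac1{p_2},\ 1-\frac1{p_1}-\frac1{p_2},\ \frac1{p_1}+\frac1{p_2}-\frac12 \right\}.$$ Suppose that for every symbol $\sigma \in BS^{m_\rho(p_1,p_2)}_{\rho,\rho}$ the bilinear pseudo-differential operator $T_\sigma$ is bounded from $H^{p_1}(\mathbb{R}^n) \times H^{p_2}(\mathbb{R}^n)$ to $L^p(\mathbb{R}^n)$ if $p < \infty$, or from $H^{p_1}(\mathbb{R}^n) \times H^{p_2}(\mathbb{R}^n)$ to $BMO(\mathbb{R}^n)$ if $p = \infty$. Then $$\frac1p = \frac1{p_1} + \frac1{p_2}.$$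
   Context: Convention: $1/\infty = 0$. $\mathcal{S}(\mathbb{R}^n)$ is the Schwartz space, $\mathcal{S}'(\mathbb{R}^n)$ the space of tempered distributions, and $\widehat f(\xi) = \int_{\mathbb{R}^n} e^{-ix\cdot\xi} f(x)\,dx$. Symbol class: for $m \in \mathbb{R}$ and $0 \le \rho \le 1$, $BS^m_{\rho,\rho}$ is the set of all $\sigma = \sigma(x,\xi_1,\xi_2) \in C^\infty(\mathbb{R}^n\times\mathbb{R}^n\times\mathbb{R}^n)$ (complex-valued) such that for all multi-indices $\alpha,\beta_1,\beta_2 \in \{0,1,2,\dots\}^n$ there is a constant $C_{\alpha,\beta_1,\beta_2}$ with $$|\partial_x^\alpha \partial_{\xi_1}^{\beta_1}\partial_{\xi_2}^{\beta_2}\sigma(x,\xi_1,\xi_2)| \le C_{\alpha,\beta_1,\beta_2}(1+|\xi_1|+|\xi_2|)^{m+\rho|\alpha|-\rho(|\beta_1|+|\beta_2|)}$$ for all $x,\xi_1,\xi_2 \in \mathbb{R}^n$. Operator: for $f_1,f_2 \in \mathcal{S}(\mathbb{R}^n)$, $$T_\sigma(f_1,f_2)(x) = \frac{1}{(2\pi)^{2n}}\int_{\mathbb{R}^n\times\mathbb{R}^n} e^{ix\cdot(\xi_1+\xi_2)}\sigma(x,\xi_1,\xi_2)\widehat{f_1}(\xi_1)\widehat{f_2}(\xi_2)\,d\xi_1 d\xi_2.$$ Boundedness: for function spaces $X_1,X_2,Y$ with (quasi-)norms, $T_\sigma$ is said to be bounded from $X_1\times X_2$ to $Y$ if there is a constant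 $C>0$ with $\|T_\sigma(f_1,f_2)\|_Y \le C\|f_1\|_{X_1}\|f_2\|_{X_2}$ for all $f_1 \in \mathcal{S}(\mathbb{R}^n)\cap X_1$ and $f_2 \in \mathcal{S}(\mathbb{R}^n)\cap X_2$. Hardy spaces: fix $\phi \in \mathcal{S}(\mathbb{R}^n)$ with $\int\phi = 1$ and put $\phi_t(x) = t^{-n}\phi(t^{-1}x)$. For $0<p\le\infty$, $H^p(\mathbb{R}^n)$ is the set of $f \in \mathcal{S}'(\mathbb{R}^n)$ with $\|f\|_{H^p} = \|\sup_{t>0}|\phi_t * f|\,\|_{L^p} < \infty$ (independent of the choice of $\phi$ up to equivalent quasi-norms; $H^p = L^p$ for $1<p\le\infty$). $BMO(\mathbb{R}^n)$ is the space of locally integrable $f$ with $\|f\|_{BMO} = \sup_Q |Q|^{-1}\int_Q |f(x)-f_Q|\,dx < \infty$, the supremum being over all cubes $Q\subset\mathbb{R}^n$ and $f_Q = |Q|^{-1}\int_Q f$. *)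

theory Defs
  imports "HOL-Analysis.Analysis" "HOL-Probability.Essential_Supremum"
begin

section \<open>Smooth functions and multi-index derivatives\<close>

definition partial_deriv :: "'a::euclidean_space \<Rightarrow> ('a \<Rightarrow> complex) \<Rightarrow> 'a \<Rightarrow> complex" where
  "partial_deriv b f x = vector_derivative (\<lambda>t. f (x + t *\<^sub>R b)) (at 0)"

text \<open>A function is \<open>C\<^sup>\<infinity>\<close> iff all its iterated partial derivatives, of every order and including
  the function itself, exist and are (Frechet) differentiable everywhere; continuity of all of them
  is then automatic.\<close>

definition smooth :: "('a::euclidean_space \<Rightarrow> complex) \<Rightarrow> bool" where
  "smooth f \<longleftrightarrow>
     (\<forall>bs. set bs \<subseteq> Basis \<longrightarrow> (\<forall>x. foldr partial_deriv bs f differentiable (at x)))"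

text \<open>The derivative \<open>\<partial>\<^sup>\<alpha> f\<close> for a multi-index \<open>\<alpha>\<close>.  The index type \<open>'n\<close> carries no order, so the
  coordinates are processed in some fixed enumeration; on smooth functions the partial derivatives
  commute and the choice is immaterial.\<close>

definition coords :: "'n::finite list" where
  "coords = (SOME is. distinct is \<and> set is = UNIV)"

definition multi_deriv :: "nat ^ 'n \<Rightarrow> (real ^ 'n \<Rightarrow> complex) \<Rightarrow> real ^ 'n \<Rightarrow> complex" where
  "multi_deriv \<alpha> f = foldr (\<lambda>i. partial_deriv (axis i 1) ^^ (\<alpha> $ i)) coords f"

definition multi_abs :: "nat ^ 'n \<Rightarrow> nat" where
  "multi_abs \<alpha> = (\<Sum>i\<in>UNIV. \<alpha> $ i)"

definition multi_pow :: "real ^ 'n \<Rightarrow> nat ^ 'n \<Rightarrow> real" where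
  "multi_pow x \<alpha> = (\<Prod>i\<in>UNIV. (x $ i) ^ (\<alpha> $ i))"


section \<open>Schwartz functions and tempered distributions\<close>

definition schwartz :: "(real ^ 'n \<Rightarrow> complex) set" where
  "schwartz = {f. smooth f \<and>
     (\<forall>\<alpha> \<beta>. bounded (range (\<lambda>x. multi_pow x \<alpha> *\<^sub>R multi_deriv \<beta> f x)))}"

definition fourier :: "(real ^ 'n \<Rightarrow> complex) \<Rightarrow> real ^ 'n \<Rightarrow> complex" where
  "fourier f \<xi> = (LINT x|lborel. exp (- \<i> * of_real (x \<bullet> \<xi>)) * f x)"

text \<open>Functionals are total functions in HOL; only their values on Schwartz functions matter.
  Since the Schwartz space is metrizable, continuity is sequential continuity at \<open>0\<close>.\<close>

definition tempered :: "((real ^ 'n \<Rightarrow> complex) \<Rightarrow> complex) set" where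
  "tempered = {u.
     (\<forall>\<phi>\<in>schwartz. \<forall>\<psi>\<in>schwartz. \<forall>a b.
        u (\<lambda>x. a * \<phi> x + b * \<psi> x) = a * u \<phi> + b * u \<psi>) \<and>
     (\<forall>\<phi>. (\<forall>k::nat. \<phi> k \<in> schwartz) \<longrightarrow>
        (\<forall>\<alpha> \<beta>. uniform_limit UNIV (\<lambda>k x. multi_pow x \<alpha> *\<^sub>R multi_deriv \<beta> (\<phi> k) x)
                  (\<lambda>x. 0) sequentially) \<longrightarrow>
        (\<lambda>k. u (\<phi> k)) \<longlonglongrightarrow> 0)}"

definition distr_of :: "(real ^ 'n \<Rightarrow> complex) \<Rightarrow> (real ^ 'n \<Rightarrow> complex) \<Rightarrow> complex" where
  "distr_of f \<psi> = (LINT y|lborel. f y * \<psi> y)"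

definition conv :: "(real ^ 'n \<Rightarrow> complex) \<Rightarrow> ((real ^ 'n \<Rightarrow> complex) \<Rightarrow> complex)
    \<Rightarrow> real ^ 'n \<Rightarrow> complex" where
  "conv \<phi> u x = u (\<lambda>y. \<phi> (x - y))"

definition dilate :: "real \<Rightarrow> (real ^ 'n \<Rightarrow> complex) \<Rightarrow> real ^ 'n \<Rightarrow> complex" where
  "dilate t \<phi> x = \<phi> (x /\<^sub>R t) /\<^sub>R t ^ CARD('n)"


section \<open>Function spaces\<close>

text \<open>All quasi-norms take values in \<open>[0, \<infinity>]\<close>; a function belongs to the space iff the value is
  finite.  Exponents \<open>p\<close> have type \<^typ>\<open>ennreal\<close>, where \<open>1 / \<infinity> = 0\<close>.\<close>

definition epowr :: "ennreal \<Rightarrow> real \<Rightarrow> ennreal" where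
  "epowr x r = (if x = \<infinity> then \<infinity> else ennreal (enn2real x powr r))"

definition Lp_norm :: "ennreal \<Rightarrow> ('a::euclidean_space \<Rightarrow> ennreal) \<Rightarrow> ennreal" where
  "Lp_norm p g =
     (if g \<notin> borel_measurable lborel then \<infinity>
      else if p = \<infinity> then esssup lborel g
      else epowr (\<integral>\<^sup>+x. epowr (g x) (enn2real p) \<partial>lborel) (1 / enn2real p))"

definition hardy_norm :: "(real ^ 'n \<Rightarrow> complex) \<Rightarrow> ennreal
    \<Rightarrow> ((real ^ 'n \<Rightarrow> complex) \<Rightarrow> complex) \<Rightarrow> ennreal" where
  "hardy_norm \<phi> p u =
     Lp_norm p (\<lambda>x. SUP t\<in>{0<..}. ennreal (norm (conv (dilate t \<phi>) u x)))"

definition hardy :: "(real ^ 'n \<Rightarrow> complex) \<Rightarrow> ennreal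
    \<Rightarrow> ((real ^ 'n \<Rightarrow> complex) \<Rightarrow> complex) set" where
  "hardy \<phi> p = {u \<in> tempered. hardy_norm \<phi> p u < \<infinity>}"

definition locally_integrable :: "(real ^ 'n \<Rightarrow> complex) \<Rightarrow> bool" where
  "locally_integrable f \<longleftrightarrow> (\<forall>K. compact K \<longrightarrow> set_integrable lborel K f)"

definition cubes :: "(real ^ 'n) set set" where
  "cubes = {cbox a (\<chi> i. a $ i + r) | a r. r > 0}"

definition average :: "(real ^ 'n) set \<Rightarrow> (real ^ 'n \<Rightarrow> complex) \<Rightarrow> complex" where
  "average Q f = (LINT x:Q|lborel. f x) /\<^sub>R measure lborel Q"

definition bmo_norm :: "(real ^ 'n \<Rightarrow> complex) \<Rightarrow> ennreal" where
  "bmo_norm f =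
     (if locally_integrable f
      then SUP Q\<in>cubes. (\<integral>\<^sup>+x\<in>Q. ennreal (norm (f x - average Q f)) \<partial>lborel) / emeasure lborel Q
      else \<infinity>)"


section \<open>Bilinear pseudo-differential operators\<close>

definition BS :: "real \<Rightarrow> real \<Rightarrow> (real ^ 'n \<Rightarrow> real ^ 'n \<Rightarrow> real ^ 'n \<Rightarrow> complex) set" where
  "BS m \<rho> = {\<sigma>.
     smooth (\<lambda>(x, \<xi>1, \<xi>2). \<sigma> x \<xi>1 \<xi>2) \<and>
     (\<forall>\<alpha> \<beta>1 \<beta>2. \<exists>C. \<forall>x \<xi>1 \<xi>2.
        norm (multi_deriv \<alpha> (\<lambda>x. multi_deriv \<beta>1 (\<lambda>\<xi>1. multi_deriv \<beta>2 (\<lambda>\<xi>2. \<sigma> x \<xi>1 \<xi>2) \<xi>2) \<xi>1) x)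
        \<le> C * (1 + norm \<xi>1 + norm \<xi>2) powr
               (m + \<rho> * real (multi_abs \<alpha>) - \<rho> * real (multi_abs \<beta>1 + multi_abs \<beta>2)))}"

definition T_op :: "(real ^ 'n \<Rightarrow> real ^ 'n \<Rightarrow> real ^ 'n \<Rightarrow> complex)
    \<Rightarrow> (real ^ 'n \<Rightarrow> complex) \<Rightarrow> (real ^ 'n \<Rightarrow> complex) \<Rightarrow> real ^ 'n \<Rightarrow> complex" where
  "T_op \<sigma> f1 f2 x = 1 / (2 * of_real pi) ^ (2 * CARD('n)) *
     (LINT (\<xi>1, \<xi>2)|(lborel \<Otimes>\<^sub>M lborel).
        exp (\<i> * of_real (x \<bullet> (\<xi>1 + \<xi>2))) * \<sigma> x \<xi>1 \<xi>2 * fourier f1 \<xi>1 * fourier f2 \<xi>2)"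

text \<open>Boundedness \<open>X1 \<times> X2 \<rightarrow> Y\<close> on Schwartz functions lying in \<open>X1\<close>, \<open>X2\<close>, where \<open>X1\<close>, \<open>X2\<close> are
  spaces of tempered distributions with quasi-norms \<open>N1\<close>, \<open>N2\<close>, and \<open>Y\<close> is given by its
  extended-valued quasi-norm \<open>N\<close>.\<close>

definition bounded_op ::
  "((real ^ 'n \<Rightarrow> complex) \<Rightarrow> (real ^ 'n \<Rightarrow> complex) \<Rightarrow> real ^ 'n \<Rightarrow> complex)
   \<Rightarrow> ((real ^ 'n \<Rightarrow> complex) \<Rightarrow> complex) set \<Rightarrow> (((real ^ 'n \<Rightarrow> complex) \<Rightarrow> complex) \<Rightarrow> ennreal)
   \<Rightarrow> ((real ^ 'n \<Rightarrow> complex) \<Rightarrow> complex) set \<Rightarrow> (((real ^ 'n \<Rightarrow> complex) \<Rightarrow> complex) \<Rightarrow> ennreal)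
   \<Rightarrow> ((real ^ 'n \<Rightarrow> complex) \<Rightarrow> ennreal) \<Rightarrow> bool" where
  "bounded_op T X1 N1 X2 N2 N \<longleftrightarrow>
     (\<exists>C::real. C > 0 \<and>
        (\<forall>f1\<in>schwartz. \<forall>f2\<in>schwartz. distr_of f1 \<in> X1 \<longrightarrow> distr_of f2 \<in> X2 \<longrightarrow>
           N (T f1 f2) \<le> ennreal C * N1 (distr_of f1) * N2 (distr_of f2)))"

definition m_crit :: "nat \<Rightarrow> real \<Rightarrow> ennreal \<Rightarrow> ennreal \<Rightarrow> real" where
  "m_crit n \<rho> p1 p2 =
     (let a = enn2real (1 / p1); b = enn2real (1 / p2)
      in - (1 - \<rho>) * real n * Max {1/2, a, b, 1 - a - b, a + b - 1/2})"

end

theory Submission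
  imports Defs "HOL-Probability.Probability"
begin

text \<open>
  All functions involved are tensor products of functions of one real variable, on which everything
  reduces to one-dimensional estimates.

  A single bump at low frequencies is a symbol of every order; testing it on dilates of a fixed
  pair of functions gives \<open>1/p \<le> 1/p\<^sub>1 + 1/p\<^sub>2\<close>.

  For the converse, put \<open>R = 8\<^bsup>k/(1-\<rho>)\<^esup>\<close> and \<open>s = R\<^sup>\<rho>\<close>, so that \<open>R / s = 8\<^sup>k\<close>.  At frequencies
  of size \<open>R\<close> the symbol is a sum over the lattice \<open>s \<int>\<^bsup>2n\<^esup>\<close> of bumps of width \<open>s\<close>, with size
  \<open>R\<^sup>m\<close> and signs.  The inputs are spread over the lattice with Rudin--Shapiro signs if
  \<open>p\<^sub>i \<ge> 2\<close> (flat inputs) and with equal signs if \<open>p\<^sub>i < 2\<close> (concentrated inputs); the signs of the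
  symbol undo these and turn the output into a Dirichlet kernel if \<open>p \<ge> 2\<close> and into a
  Rudin--Shapiro polynomial if \<open>p < 2\<close>.  If \<open>1/p < 1/p\<^sub>1 + 1/p\<^sub>2\<close>, then for the critical \<open>m\<close> the
  ratio of the norms exceeds a positive power of \<open>8\<^sup>k\<close>, since \<open>s\<^bsup>n(1/p\<^sub>1 + 1/p\<^sub>2 - 1/p)\<^esup>\<close> is unbounded.
\<close>

section \<open>Smooth functions of one real variable\<close>

text \<open>Per coordinate write X = 8^k and a, b, c for 1/p1, 1/p2, 1/p. A flat input has norm
  X^(1/2) s^(-a), a concentrated one X R^(-a) = X^(1-a) s^(-a). The output has size X^2 on a cube of
  side 1/R (Dirichlet) or X^(3/2) on one of side 1/s (Rudin--Shapiro), since each output frequency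
  arises X times; its norm is X^max(2-c, 3/2) s^(-c). The order contributes X^(-M), M being the
  maximum in the critical order. Now M + min(1/2, 1-a) + min(1/2, 1-b) is at most max(3/2, 2-a-b),
  so for c < a+b the powers of X lose nothing and s^(a+b-c) is left over, a positive power of X
  because \<rho> > 0. Two obstacles shape the construction. The constant of boundedness depends on
  the symbol, so one symbol must carry all scales k; powers of 8 keep the frequency shells apart and
  make 8^k and 2 * 8^k lengths of Rudin--Shapiro polynomials. And for small exponents size alone
  does not control a Hardy norm: cancellation is needed, and it comes from spectra that avoid 0 and
  hence allow repeated antiderivatives.\<close>

primrec diff_times :: "nat \<Rightarrow> (real \<Rightarrow> complex) \<Rightarrow> bool" where
  "diff_times 0 f = True"
| "diff_times (Suc m) f =
     (\<exists>f'. (\<forall>t. (f has_vector_derivative f' t) (at t)) \<and> diff_times m f')"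

text \<open>In \<open>diff_times\<close> the derivative is existentially quantified, so closure
  properties follow by induction on the order with explicit derivatives, and no higher derivative
  ever has to be computed.\<close>

definition smooth1 :: "(real \<Rightarrow> complex) \<Rightarrow> bool" where
  "smooth1 f \<longleftrightarrow> (\<forall>m. diff_times m f)"

definition vderiv :: "(real \<Rightarrow> complex) \<Rightarrow> real \<Rightarrow> complex" where
  "vderiv f t = vector_derivative f (at t)"

lemma diff_times_SucI:
  "(\<And>t. (f has_vector_derivative f' t) (at t)) \<Longrightarrow> diff_times m f' \<Longrightarrow> diff_times (Suc m) f"
  by auto

lemma diff_times_mono: "diff_times (Suc m) f \<Longrightarrow> diff_times m f"
proof (induction m arbitrary: f)
  case (Suc m)
  then obtain f' where f': "\<forall>t. (f has_vector_derivative f' t) (at t)" "diff_times (Suc m) f'"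
    by (auto simp only: diff_times.simps)
  with Suc.IH[OF f'(2)] show ?case by auto
qed simp

lemma diff_times_const: "diff_times m (\<lambda>_. c)"
proof (induction m arbitrary: c)
  case (Suc m)
  have "((\<lambda>_::real. c) has_vector_derivative 0) (at t)" for t by simp
  from diff_times_SucI[OF this Suc[of 0]] show ?case .
qed simp

lemma diff_times_add:
  "diff_times m f \<Longrightarrow> diff_times m g \<Longrightarrow> diff_times m (\<lambda>t. f t + g t)"
proof (induction m arbitrary: f g)
  case (Suc m)
  then obtain f' g' where
    *: "\<And>t. (f has_vector_derivative f' t) (at t)" "diff_times m f'"
       "\<And>t. (g has_vector_derivative g' t) (at t)" "diff_times m g'" by auto
  show ?case
    by (rule diff_times_SucI[OF has_vector_derivative_add[OF *(1) *(3)] Suc.IH[OF *(2,4)]])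
qed simp

lemma diff_times_mult:
  "diff_times m f \<Longrightarrow> diff_times m g \<Longrightarrow> diff_times m (\<lambda>t. f t * g t)"
proof (induction m arbitrary: f g)
  case (Suc m)
  then obtain f' g' where
    *: "\<And>t. (f has_vector_derivative f' t) (at t)" "diff_times m f'"
       "\<And>t. (g has_vector_derivative g' t) (at t)" "diff_times m g'" by auto
  have "diff_times m f" "diff_times m g"
    using Suc.prems by (auto intro: diff_times_mono simp del: diff_times.simps)
  then have "diff_times m (\<lambda>t. f t * g' t + f' t * g t)"
    using * by (intro diff_times_add Suc.IH)
  then show ?case
    by (rule diff_times_SucI[OF has_vector_derivative_mult[OF *(1) *(3)]])
qed simp

lemma diff_times_affine:
  "diff_times m f \<Longrightarrow> diff_times m (\<lambda>t. f (c * t + d))"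
proof (induction m arbitrary: f)
  case (Suc m)
  then obtain f' where
    *: "\<And>t. (f has_vector_derivative f' t) (at t)" "diff_times m f'" by auto
  have "((\<lambda>t. f (c * t + d)) has_vector_derivative complex_of_real c * f' (c * t + d)) (at t)" for t
  proof -
    have "((\<lambda>t. c * t + d) has_vector_derivative c) (at t)"
      by (auto intro!: derivative_eq_intros)
    from vector_diff_chain_at[OF this *(1)] show ?thesis
      by (simp add: o_def scaleR_conv_of_real)
  qed
  from diff_times_SucI[OF this diff_times_mult[OF diff_times_const Suc.IH[OF *(2)]]]
  show ?case .
qed simp

lemma smooth1_const: "smooth1 (\<lambda>_. c)"
  by (simp add: smooth1_def diff_times_const)

lemma smooth1_add: "smooth1 f \<Longrightarrow> smooth1 g \<Longrightarrow> smooth1 (\<lambda>t. f t + g t)"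
  by (simp add: smooth1_def diff_times_add)

lemma smooth1_mult: "smooth1 f \<Longrightarrow> smooth1 g \<Longrightarrow> smooth1 (\<lambda>t. f t * g t)"
  by (simp add: smooth1_def diff_times_mult)

lemma smooth1_affine: "smooth1 f \<Longrightarrow> smooth1 (\<lambda>t. f (c * t + d))"
  by (simp add: smooth1_def diff_times_affine)

lemma smooth1_sum: "(\<And>i. i \<in> I \<Longrightarrow> smooth1 (f i)) \<Longrightarrow> smooth1 (\<lambda>t. \<Sum>i\<in>I. f i t)"
  by (induction I rule: infinite_finite_induct) (auto simp: smooth1_const intro!: smooth1_add)

lemma smooth1_antideriv:
  assumes "\<And>t. (f has_vector_derivative f' t) (at t)" "smooth1 f'"
  shows "smooth1 f"
  unfolding smooth1_def
proof
  fix m show "diff_times m f"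
    using assms(1) diff_times_SucI[of f f' "m"] assms(2)
    by (auto simp: smooth1_def simp del: diff_times.simps intro: diff_times_mono)
qed

lemma smooth1_vderiv:
  assumes "smooth1 f"
  shows "(f has_vector_derivative vderiv f t) (at t)" "smooth1 (vderiv f)"
proof -
  have *: "vderiv f = f'" if "\<And>t. (f has_vector_derivative f' t) (at t)" for f'
    using that by (auto simp: vderiv_def fun_eq_iff intro: vector_derivative_at)
  have "diff_times (Suc 0) f" using assms by (simp only: smooth1_def)
  then show "(f has_vector_derivative vderiv f t) (at t)"
    using * by auto
  show "smooth1 (vderiv f)"
    unfolding smooth1_def
  proof
    fix m
    have "diff_times (Suc m) f" using assms by (simp only: smooth1_def)
    then show "diff_times m (vderiv f)" using * by auto
  qed
qed

lemma smooth1_continuous_on: "smooth1 f \<Longrightarrow> continuous_on S f"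
  by (meson continuous_at_imp_continuous_on has_vector_derivative_continuous smooth1_vderiv(1))

lemma smooth1_funpow: "smooth1 f \<Longrightarrow> smooth1 ((vderiv ^^ m) f)"
  by (induction m) (auto intro: smooth1_vderiv)

lemma smooth1_id: "smooth1 of_real"
  by (rule smooth1_antideriv[OF _ smooth1_const[of 1]])
     (auto intro!: derivative_eq_intros simp: has_vector_derivative_def scaleR_conv_of_real)

lemma smooth1_power: "smooth1 f \<Longrightarrow> smooth1 (\<lambda>t. f t ^ m)"
  by (induction m) (auto intro: smooth1_const smooth1_mult)

section \<open>Bump functions\<close>

text \<open>The power \<open>k\<close> makes the family closed under differentiation up to linear
  combinations, so all orders of smoothness follow from one formula.\<close>

definition flat_exp :: "nat \<Rightarrow> real \<Rightarrow> real" where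
  "flat_exp k x = (if x > 0 then exp (- 1 / x) / x ^ k else 0)"

lemma flat_exp_deriv:
  "(flat_exp k has_real_derivative (flat_exp (k + 2) x - k * flat_exp (k + 1) x)) (at x)"
proof -
  consider "x > 0" | "x < 0" | "x = 0" by linarith
  then show ?thesis
  proof cases
    case 1
    have ev: "\<forall>\<^sub>F y in nhds x. flat_exp k y = exp (- 1 / y) / y ^ k"
      using eventually_nhds_in_open[of "{0<..}" x] 1
      by (auto simp: flat_exp_def elim!: eventually_mono)
    have "((\<lambda>y. exp (- 1 / y) / y ^ k) has_real_derivative
        (flat_exp (k + 2) x - k * flat_exp (k + 1) x)) (at x)"
      using 1
      apply (auto intro!: derivative_eq_intros simp: flat_exp_def)
      apply (cases k)
       apply (auto simp: field_simps power2_eq_square)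
      done
    then show ?thesis
      using DERIV_cong_ev[OF refl ev refl] by simp
  next
    case 2
    have ev: "\<forall>\<^sub>F y in nhds x. flat_exp k y = 0"
      using eventually_nhds_in_open[of "{..<0}" x] 2
      by (auto simp: flat_exp_def elim!: eventually_mono)
    then show ?thesis
      using DERIV_cong_ev[OF refl ev refl, of 0] 2 flat_exp_def[of "k + 2" x] flat_exp_def[of "k + 1" x]
      by simp
  next
    case 3
    \<comment> \<open>The difference quotient of \<open>flat_exp k\<close> at 0 is
      \<open>flat_exp (k + 1)\<close>; the substitution y = 1/h turns its limit from the right into
      that of y^(k+1) / exp y.\<close>
    have lim: "((\<lambda>y::real. y ^ (k + 1) / exp y) \<longlongrightarrow> 0) at_top"
      by (rule tendsto_power_div_exp_0)
    have "((\<lambda>h. flat_exp (k + 1) h) \<longlongrightarrow> 0) (at_right 0)"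
    proof -
      have "((\<lambda>h::real. (inverse h) ^ (k + 1) / exp (inverse h)) \<longlongrightarrow> 0) (at_right 0)"
        by (rule filterlim_compose[OF lim filterlim_inverse_at_top_right])
      moreover have "\<forall>\<^sub>F h in at_right 0. (inverse h) ^ (k + 1) / exp (inverse h) = flat_exp (k + 1) (h::real)"
        by (auto simp: eventually_at_right_less flat_exp_def exp_minus field_simps
            intro!: eventually_mono[OF eventually_at_right_less[of 0]])
      ultimately show ?thesis by (rule Lim_transform_eventually)
    qed
    moreover have "((\<lambda>h. flat_exp (k + 1) h) \<longlongrightarrow> 0) (at_left 0)"
      by (rule tendsto_eventually)
         (auto simp: flat_exp_def intro!: eventually_mono[OF eventually_at_left_real[of "-1" 0]])
    ultimately have "((\<lambda>h. flat_exp (k + 1) h) \<longlongrightarrow> 0) (at 0)"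
      by (simp add: filterlim_at_split)
    then have "((\<lambda>h. (flat_exp k (0 + h) - flat_exp k 0) / h) \<longlongrightarrow> 0) (at 0)"
      by (rule Lim_transform_eventually)
         (auto simp: flat_exp_def field_simps intro!: eventually_at_topological[THEN iffD2])
    then show ?thesis using 3 by (simp add: DERIV_def flat_exp_def)
  qed
qed

lemma smooth1_flat_exp: "smooth1 (\<lambda>u. of_real (flat_exp k u))"
  unfolding smooth1_def
proof
  fix m show "diff_times m (\<lambda>u. of_real (flat_exp k u))"
  proof (induction m arbitrary: k)
    case (Suc m)
    have "((\<lambda>u. complex_of_real (flat_exp k u)) has_vector_derivative
        complex_of_real (flat_exp (k + 2) t) + (- of_nat k) * complex_of_real (flat_exp (k + 1) t)) (at t)" for t
      using has_vector_derivative_of_real[OF flat_exp_deriv[of k t]]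
      by simp
    from diff_times_SucI[OF this diff_times_add[OF Suc diff_times_mult[OF diff_times_const Suc]]]
    show ?case .
  qed simp
qed

lemma smooth_step:
  obtains H :: "real \<Rightarrow> real" where "smooth1 (\<lambda>u. of_real (H u))"
    "\<And>u. 0 \<le> H u" "\<And>u. H u \<le> 1" "\<And>u. u \<le> 0 \<Longrightarrow> H u = 0" "\<And>u. 1 \<le> u \<Longrightarrow> H u = 1"
proof -
  \<comment> \<open>A bump supported in [0, 1]; its normalised antiderivative will be the
    step.\<close>
  define h where "h u = flat_exp 0 u * flat_exp 0 (1 - u)" for u
  have h_nonneg: "h u \<ge> 0" for u by (simp add: h_def flat_exp_def)
  have "smooth1 (\<lambda>u. of_real (flat_exp 0 ((-1) * u + 1)))"
    by (rule smooth1_affine[OF smooth1_flat_exp])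
  then have sh: "smooth1 (\<lambda>u. of_real (h u))"
    using smooth1_mult[OF smooth1_flat_exp[of 0]] by (auto simp: h_def)
  have ch: "continuous_on S h" for S
    using smooth1_continuous_on[OF sh, of S] continuous_on_Re[of S "\<lambda>u. complex_of_real (h u)"] by simp
  define G where "G u = integral {0..u} h" for u
  define c where "c = G 1"
  have int: "h integrable_on {a..b}" for a b using ch by (rule integrable_continuous_interval)
  have G0: "G u = 0" if "u \<le> 0" for u
    using that by (cases "u = 0") (auto simp: G_def)
  have h0: "h u = 0" if "u \<le> 0 \<or> u \<ge> 1" for u using that by (auto simp: h_def flat_exp_def)
  have G1: "G u = c" if "1 \<le> u" for u
  proof -
    have "G u = integral {0..1} h + integral {1..u} h"
      unfolding G_def using that int
      by (subst Henstock_Kurzweil_Integration.integral_combine) auto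
    also have "integral {1..u} h = integral {1..u} (\<lambda>_. 0)"
      by (rule integral_cong) (auto simp: h0)
    finally show ?thesis by (simp add: c_def G_def)
  qed
  \<comment> \<open>For negative u the interval {0..u} is empty and \<open>G u\<close> is 0, which
    agrees with \<open>h\<close> vanishing there. Starting the integral at -|t|-1 instead puts t in
    the interior of the interval and treats all signs at once.\<close>
  have dG: "(G has_real_derivative h t) (at t)" for t
  proof -
    have "((\<lambda>u. integral {-\<bar>t\<bar>-1..u} h) has_vector_derivative h t) (at t within {-\<bar>t\<bar>-1..\<bar>t\<bar>+1})"
      by (rule integral_has_vector_derivative[OF ch]) auto
    then have "((\<lambda>u. integral {-\<bar>t\<bar>-1..u} h) has_vector_derivative h t) (at t)"
      by (subst (asm) at_within_interior) (auto simp: abs_if)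
    moreover have "integral {-\<bar>t\<bar>-1..u} h = G u" if "u > -\<bar>t\<bar>-1" for u
    proof (cases "u \<ge> 0")
      case True
      have "integral {-\<bar>t\<bar>-1..u} h = integral {-\<bar>t\<bar>-1..0} h + integral {0..u} h"
        using True int by (subst Henstock_Kurzweil_Integration.integral_combine) auto
      also have "integral {-\<bar>t\<bar>-1..0} h = integral {-\<bar>t\<bar>-1..0} (\<lambda>_. 0)"
        by (rule integral_cong) (auto simp: h0)
      finally show ?thesis by (simp add: G_def)
    next
      case False
      have "integral {-\<bar>t\<bar>-1..u} h = integral {-\<bar>t\<bar>-1..u} (\<lambda>_. 0)"
        by (rule integral_cong) (use False in \<open>auto simp: h0\<close>)
      then show ?thesis using False G0 by simp
    qed
    then have "\<forall>\<^sub>F u in nhds t. integral {-\<bar>t\<bar>-1..u} h = G u"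
      by (intro eventually_mono[OF eventually_nhds_in_open[of "{-\<bar>t\<bar>-1<..}" t]]) auto
    ultimately show ?thesis
      unfolding has_real_derivative_iff_has_vector_derivative[symmetric]
      using DERIV_cong_ev[of t t "\<lambda>u. integral {-\<bar>t\<bar>-1..u} h" G "h t" "h t"] by simp
  qed
  have sG: "smooth1 (\<lambda>u. of_real (G u))"
    by (rule smooth1_antideriv[OF _ sh])
       (rule has_vector_derivative_of_real[OF dG])
  have mono: "G u \<le> G v" if "u \<le> v" for u v
    by (rule DERIV_nonneg_imp_nondecreasing[OF that]) (use dG h_nonneg in blast)
  have cpos: "c > 0"
  proof -
    \<comment> \<open>If the total mass were 0, the monotone \<open>G\<close> would be constant on
      (0, 1), contradicting h (1/2) > 0.\<close>
    have "c \<noteq> 0"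
    proof
      assume "c = 0"
      have eq: "G u = 0" if "u \<in> {0<..<1}" for u
        using mono[of 0 u] mono[of u 1] that \<open>c = 0\<close> G0[of 0] by (auto simp: c_def)
      have "(G has_real_derivative 0) (at (1/2))"
        using DERIV_cong_ev[of "1/2" "1/2" G "\<lambda>_. 0" 0 0]
          eventually_mono[OF eventually_nhds_in_open[of "{0<..<1}" "1/2::real"] eq]
        by simp
      then have "h (1/2) = 0" using dG DERIV_unique by blast
      then show False by (simp add: h_def flat_exp_def)
    qed
    then show ?thesis using mono[of 0 1] G0[of 0] by (simp add: c_def)
  qed
  show ?thesis
  proof
    show "smooth1 (\<lambda>u. of_real (G u / c))"
      using smooth1_mult[OF sG smooth1_const[of "of_real (1/c)"]] by simp
    fix u
    show "0 \<le> G u / c" using cpos G0 mono[of 0 u] by (cases "u \<le> 0") (auto simp: G0)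
    show "G u / c \<le> 1" using cpos mono[of u 1] G1[of u] by (cases "u \<le> 1") (auto simp: c_def)
    show "G u / c = 0" if "u \<le> 0" using that G0 by simp
    show "G u / c = 1" if "1 \<le> u" using that G1 cpos by simp
  qed
qed

lemma plateau_exists:
  fixes a b c d :: real
  assumes "a < b" "c < d"
  obtains r :: "real \<Rightarrow> real" where "smooth1 (\<lambda>u. of_real (r u))"
    "\<And>u. 0 \<le> r u" "\<And>u. r u \<le> 1" "\<And>u. b \<le> u \<Longrightarrow> u \<le> c \<Longrightarrow> r u = 1"
    "\<And>u. u \<le> a \<or> d \<le> u \<Longrightarrow> r u = 0"
proof -
  obtain H :: "real \<Rightarrow> real" where H: "smooth1 (\<lambda>u. of_real (H u))"
    "\<And>u. 0 \<le> H u" "\<And>u. H u \<le> 1" "\<And>u. u \<le> 0 \<Longrightarrow> H u = 0" "\<And>u. 1 \<le> u \<Longrightarrow> H u = 1"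
    by (rule smooth_step; blast)
  \<comment> \<open>A rising step across [a, b] times a falling step across [c, d].\<close>
  define r where "r u = H (1/(b-a) * u + (- a/(b-a))) * H (-1/(d-c) * u + d/(d-c))" for u
  have eqs: "1/(b-a) * u + (- a/(b-a)) = (u-a)/(b-a)" "-1/(d-c) * u + d/(d-c) = (d-u)/(d-c)" for u
    by (simp_all add: field_simps diff_divide_distrib)
  show ?thesis
  proof
    show "smooth1 (\<lambda>u. of_real (r u))"
      unfolding r_def of_real_mult by (intro smooth1_mult smooth1_affine[OF H(1)])
    fix u
    show "0 \<le> r u" by (simp add: r_def H)
    show "r u \<le> 1" by (simp add: r_def H mult_le_one)
    show "r u = 1" if "b \<le> u" "u \<le> c"
      unfolding r_def eqs using that assms by (simp add: H(5))
    show "r u = 0" if "u \<le> a \<or> d \<le> u"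
      unfolding r_def eqs using that assms H(4)[of "(u-a)/(b-a)"] H(4)[of "(d-u)/(d-c)"]
      by (auto simp: divide_le_0_iff)
  qed
qed

definition test_fun :: "(real \<Rightarrow> complex) \<Rightarrow> bool" where
  "test_fun v \<longleftrightarrow> smooth1 v \<and> (\<exists>M. \<forall>u. M \<le> \<bar>u\<bar> \<longrightarrow> v u = 0)"

lemma test_fun_support:
  assumes "test_fun v"
  obtains M where "M > 0" "\<And>u. M \<le> \<bar>u\<bar> \<Longrightarrow> v u = 0"
proof -
  obtain M where "\<forall>u. M \<le> \<bar>u\<bar> \<longrightarrow> v u = 0" using assms by (auto simp: test_fun_def)
  then show ?thesis by (intro that[of "max M 1"]) auto
qed

lemma test_fun_mult: "smooth1 f \<Longrightarrow> test_fun v \<Longrightarrow> test_fun (\<lambda>u. f u * v u)"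
  by (auto simp: test_fun_def intro: smooth1_mult)

lemma test_fun_sum:
  assumes "finite I" "\<And>i. i \<in> I \<Longrightarrow> test_fun (f i)"
  shows "test_fun (\<lambda>u. \<Sum>i\<in>I. f i u)"
  using assms
proof (induction I rule: finite_induct)
  case empty
  then show ?case by (auto simp: test_fun_def smooth1_const)
next
  case (insert i I)
  obtain M1 where M1: "\<And>u. M1 \<le> \<bar>u\<bar> \<Longrightarrow> f i u = 0"
    using insert test_fun_support[of "f i"] by blast
  obtain M2 where M2: "\<And>u. M2 \<le> \<bar>u\<bar> \<Longrightarrow> (\<Sum>i\<in>I. f i u) = 0"
    using insert test_fun_support[of "\<lambda>u. \<Sum>i\<in>I. f i u"] by blast
  have "smooth1 (\<lambda>u. \<Sum>i\<in>insert i I. f i u)"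
    using insert by (intro smooth1_sum) (auto simp: test_fun_def)
  then show ?case
    using M1 M2 insert by (auto simp: test_fun_def intro!: exI[of _ "max M1 M2"])
qed

lemma test_fun_affine:
  assumes "test_fun v" "c > 0"
  shows "test_fun (\<lambda>u. v (c * u + d))"
proof -
  obtain M where M: "M > 0" "\<And>u. M \<le> \<bar>u\<bar> \<Longrightarrow> v u = 0" using assms by (auto elim: test_fun_support)
  have "v (c * u + d) = 0" if "(M + \<bar>d\<bar>) / c \<le> \<bar>u\<bar>" for u
  proof (rule M(2))
    have "M + \<bar>d\<bar> \<le> \<bar>c * u\<bar>" using that assms(2) by (simp add: field_simps abs_mult)
    then show "M \<le> \<bar>c * u + d\<bar>" by linarith
  qed
  then show ?thesis using assms by (auto simp: test_fun_def smooth1_affine)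
qed

lemma test_fun_vderiv:
  assumes "test_fun v"
  shows "test_fun (vderiv v)"
proof -
  obtain M where M: "M > 0" "\<And>u. M \<le> \<bar>u\<bar> \<Longrightarrow> v u = 0" using assms by (auto elim: test_fun_support)
  have "vderiv v u = 0" if "M + 1 \<le> \<bar>u\<bar>" for u
  proof -
    have op: "open {y. M < \<bar>y::real\<bar>}" by (intro open_Collect_less continuous_intros)
    have "(v has_vector_derivative 0) (at u)"
      by (rule has_vector_derivative_transform_within_open[OF _ op, of "\<lambda>_. 0"]) (use M that in auto)
    then show ?thesis by (simp add: vderiv_def vector_derivative_at)
  qed
  then show ?thesis using assms by (auto simp: test_fun_def intro: smooth1_vderiv)
qed

lemma test_fun_funpow: "test_fun v \<Longrightarrow> test_fun ((vderiv ^^ m) v)"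
  by (induction m) (auto intro: test_fun_vderiv)

lemma funpow_vderiv_eq_0:
  assumes "open S" "\<And>u. u \<in> S \<Longrightarrow> v u = 0" "u \<in> S"
  shows "(vderiv ^^ m) v u = 0"
  using assms(3)
proof (induction m arbitrary: u)
  case (Suc m)
  have "((vderiv ^^ m) v has_vector_derivative 0) (at u)"
    by (rule has_vector_derivative_transform_within_open[OF _ assms(1), of "\<lambda>_. 0"]) (use Suc in auto)
  then show ?case by (simp add: vderiv_def[of _ u] vector_derivative_at)
qed (use assms in auto)

lemma integral_compact_support:
  fixes f :: "real \<Rightarrow> complex"
  assumes "continuous_on UNIV f" "\<And>u. M \<le> \<bar>u\<bar> \<Longrightarrow> f u = 0"
  shows "integrable lborel f" "(LINT u|lborel. f u) = integral {-M..M} f"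
proof -
  have eq: "(\<lambda>x. indicator {-M..M} x *\<^sub>R f x) = f"
    using assms(2) by (auto simp: fun_eq_iff indicator_def abs_if)
  have "integrable lborel (\<lambda>x. indicator {-M..M} x *\<^sub>R f x)"
    by (rule borel_integrable_compact) (auto intro: continuous_on_subset[OF assms(1)])
  then show "integrable lborel f" and "(LINT u|lborel. f u) = integral {-M..M} f"
    using set_borel_integral_eq_integral(2)[of "{-M..M}" f]
    by (simp_all add: eq set_integrable_def set_lebesgue_integral_def)
qed

lemma test_fun_continuous: "test_fun v \<Longrightarrow> continuous_on S v"
  by (auto simp: test_fun_def intro: smooth1_continuous_on)

lemma test_fun_integrable: "test_fun v \<Longrightarrow> integrable lborel v"
  by (metis integral_compact_support(1) test_fun_continuous test_fun_support)

lemma continuous_on_cis [continuous_intros]: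
  "continuous_on S f \<Longrightarrow> continuous_on S (\<lambda>x. cis (f x))"
  unfolding cis_conv_exp by (intro continuous_intros)

lemma borel_measurable_cis [measurable (raw)]:
  "f \<in> borel_measurable M \<Longrightarrow> (\<lambda>x. cis (f x)) \<in> borel_measurable M"
  by (rule borel_measurable_continuous_on[of cis]) (auto intro!: continuous_intros)

section \<open>The inverse Fourier transform of test functions\<close>

text \<open>Without the factor \<open>1/(2\<pi>)\<close>.\<close>

definition ift :: "(real \<Rightarrow> complex) \<Rightarrow> real \<Rightarrow> complex" where
  "ift v x = (LINT u|lborel. cis (x * u) * v u)"

lemma integrable_cis_mult:
  fixes h :: "'a::euclidean_space \<Rightarrow> real" and f :: "'a \<Rightarrow> complex"
  assumes "integrable lborel f" "h \<in> borel_measurable borel"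
  shows "integrable lborel (\<lambda>u. cis (h u) * f u)"
  by (rule Bochner_Integration.integrable_bound[OF assms(1)])
     (use assms in \<open>auto simp: norm_mult intro!: borel_measurable_times borel_measurable_cis\<close>)

lemma ift_eq_integral:
  assumes "continuous_on UNIV v" "\<And>u. M \<le> \<bar>u\<bar> \<Longrightarrow> v u = 0"
  shows "ift v x = integral {-M..M} (\<lambda>u. cis (x * u) * v u)"
  unfolding ift_def
  by (rule integral_compact_support) (use assms in \<open>auto intro!: continuous_intros\<close>)

lemma norm_ift_le: "integrable lborel v \<Longrightarrow> norm (ift v x) \<le> (LINT u|lborel. norm (v u))"
  unfolding ift_def by (rule order.trans[OF integral_norm_bound]) (simp add: norm_mult)

text \<open>Compact support reduces the transform to an integral over a fixed interval, where
  differentiation under the integral sign is available.\<close>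

lemma ift_deriv:
  assumes "test_fun v"
  shows "(ift v has_vector_derivative ift (\<lambda>u. \<i> * of_real u * v u) x) (at x)"
proof -
  obtain M where M: "M > 0" "\<And>u. M \<le> \<bar>u\<bar> \<Longrightarrow> v u = 0" using assms by (auto elim: test_fun_support)
  have c: "continuous_on UNIV v" by (rule test_fun_continuous[OF assms])
  have c': "continuous_on UNIV (\<lambda>u. \<i> * of_real u * v u)"
    by (intro continuous_intros c)
  have "((\<lambda>x. integral (cbox (-M) M) (\<lambda>u. cis (x * u) * v u)) has_vector_derivative
      integral (cbox (-M) M) (\<lambda>u. cis (x * u) * (\<i> * of_real u * v u))) (at x within UNIV)"
  proof (rule leibniz_rule_vector_derivative[where f = "\<lambda>x u. cis (x * u) * v u"
        and fx = "\<lambda>x u. cis (x * u) * (\<i> * of_real u * v u)"])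
    fix x t :: real
    show "((\<lambda>x. cis (x * t) * v t) has_vector_derivative cis (x * t) * (\<i> * of_real t * v t)) (at x within UNIV)"
      unfolding has_vector_derivative_def
      by (auto intro!: derivative_eq_intros simp: scaleR_conv_of_real algebra_simps)
    show "(\<lambda>u. cis (x * u) * v u) integrable_on cbox (- M) M"
      unfolding box_real by (intro integrable_continuous_interval continuous_intros continuous_on_subset[OF c]) auto
  next
    have v: "continuous_on A (\<lambda>p. v (snd p))" for A :: "(real \<times> real) set"
      by (rule continuous_on_compose2[OF c]) (auto intro: continuous_intros)
    show "continuous_on (UNIV \<times> cbox (- M) M) (\<lambda>(x, u). cis (x * u) * (\<i> * of_real u * v u))"
      unfolding split_beta by (intro continuous_intros v)
  qed auto
  note * = this
  show ?thesis
  proof -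
    have "ift v = (\<lambda>x. integral (cbox (-M) M) (\<lambda>u. cis (x * u) * v u))"
      by (rule ext) (simp add: ift_eq_integral[OF c M(2)])
    then show ?thesis
      using * ift_eq_integral[OF c', of M] M by simp
  qed
qed

lemma test_fun_iu: "test_fun v \<Longrightarrow> test_fun (\<lambda>u. \<i> * of_real u * v u)"
  by (intro test_fun_mult smooth1_mult smooth1_const smooth1_id)

lemma smooth1_ift:
  assumes "test_fun v" shows "smooth1 (ift v)"
  unfolding smooth1_def
proof
  fix m from assms show "diff_times m (ift v)"
  proof (induction m arbitrary: v)
    case (Suc m)
    show ?case by (rule diff_times_SucI[OF ift_deriv Suc.IH[OF test_fun_iu]]) fact+
  qed simp
qed

lemma vderiv_ift: "test_fun v \<Longrightarrow> vderiv (ift v) = ift (\<lambda>u. \<i> * of_real u * v u)"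
  by (auto simp: vderiv_def fun_eq_iff intro: vector_derivative_at ift_deriv)

lemma funpow_vderiv_ift: "test_fun v \<Longrightarrow> (vderiv ^^ m) (ift v) = ift (\<lambda>u. (\<i> * of_real u) ^ m * v u)"
proof (induction m arbitrary: v)
  case (Suc m)
  have "test_fun (\<lambda>u. (\<i> * of_real u) ^ m * v u)"
    by (intro test_fun_mult smooth1_power smooth1_mult smooth1_const smooth1_id Suc.prems)
  then show ?case using Suc by (simp add: vderiv_ift mult_ac)
qed simp

lemma test_fun_ipow: "test_fun v \<Longrightarrow> test_fun (\<lambda>u. (\<i> * of_real u) ^ m * v u)"
  by (intro test_fun_mult smooth1_power smooth1_mult smooth1_const smooth1_id)

text \<open>Integration by parts on an interval that exceeds the supports of \<open>v\<close> and
  its derivative, so that the boundary terms vanish.\<close>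

lemma ift_vderiv:
  assumes "test_fun v"
  shows "ift (vderiv v) x = - \<i> * of_real x * ift v x"
proof -
  obtain M1 where M1: "M1 > 0" "\<And>u. M1 \<le> \<bar>u\<bar> \<Longrightarrow> v u = 0" using assms by (auto elim: test_fun_support)
  obtain M2 where M2: "M2 > 0" "\<And>u. M2 \<le> \<bar>u\<bar> \<Longrightarrow> vderiv v u = 0"
    using test_fun_vderiv[OF assms] by (auto elim: test_fun_support)
  define M where "M = max M1 M2"
  have M: "M > 0" "\<And>u. M \<le> \<bar>u\<bar> \<Longrightarrow> v u = 0" "\<And>u. M \<le> \<bar>u\<bar> \<Longrightarrow> vderiv v u = 0"
    using M1 M2 by (auto simp: M_def)
  have c: "continuous_on S v" "continuous_on S (vderiv v)" for S
    using assms test_fun_vderiv test_fun_continuous by auto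
  have sm: "smooth1 v" using assms by (simp add: test_fun_def)
  have "((\<lambda>u. cis (x * u) * vderiv v u + \<i> * of_real x * (cis (x * u) * v u)) has_integral
      (cis (x * M) * v M - cis (x * (-M)) * v (-M))) {-M..M}"
  proof (rule fundamental_theorem_of_calculus)
    fix u
    have "((\<lambda>u. cis (x * u)) has_vector_derivative (\<i> * of_real x * cis (x * u))) (at u within {-M..M})"
      unfolding has_vector_derivative_def
      by (auto intro!: derivative_eq_intros simp: scaleR_conv_of_real algebra_simps)
    from has_vector_derivative_mult[OF this has_vector_derivative_at_within[OF smooth1_vderiv(1)[OF sm]]]
    show "((\<lambda>u. cis (x * u) * v u) has_vector_derivative
        cis (x * u) * vderiv v u + \<i> * of_real x * (cis (x * u) * v u)) (at u within {-M..M})"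
      by (simp add: algebra_simps)
  qed (use M in auto)
  then have "integral {-M..M} (\<lambda>u. cis (x * u) * vderiv v u + \<i> * of_real x * (cis (x * u) * v u)) = 0"
    using M by (simp add: integral_unique)
  also have "integral {-M..M} (\<lambda>u. cis (x * u) * vderiv v u + \<i> * of_real x * (cis (x * u) * v u)) =
     integral {-M..M} (\<lambda>u. cis (x * u) * vderiv v u) + integral {-M..M} (\<lambda>u. \<i> * of_real x * (cis (x * u) * v u))"
    by (intro integral_add integrable_continuous_interval continuous_intros c)
  also have "\<dots> = ift (vderiv v) x + \<i> * of_real x * ift v x"
    using ift_eq_integral[OF c(2) M(3)] ift_eq_integral[OF c(1) M(2)] by simp
  finally show ?thesis by (simp add: add_eq_0_iff)
qed

text \<open>Each factor |x| is traded for one derivative of \<open>v\<close>, and the transform of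
  an integrable function is bounded.\<close>

lemma ift_power_bound:
  assumes "test_fun v"
  shows "\<exists>C. \<forall>x. \<bar>x\<bar> ^ K * norm (ift v x) \<le> C"
proof -
  have "\<bar>x\<bar> ^ K * norm (ift v x) = norm (ift ((vderiv ^^ K) v) x)" for x
  proof (induction K)
    case (Suc K)
    have "norm (ift ((vderiv ^^ Suc K) v) x) = \<bar>x\<bar> * norm (ift ((vderiv ^^ K) v) x)"
      using ift_vderiv[OF test_fun_funpow[OF assms, of K]] by (simp add: norm_mult)
    then show ?case using Suc by (simp add: mult_ac)
  qed simp
  then show ?thesis
    using norm_ift_le[OF test_fun_integrable[OF test_fun_funpow[OF assms]]] by auto
qed

lemma ift_decay:
  assumes "test_fun v"
  shows "\<exists>C\<ge>0. \<forall>x. norm (ift v x) \<le> C / (1 + \<bar>x\<bar>) ^ K"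
proof -
  obtain C1 where C1: "\<And>x. \<bar>x\<bar> ^ K * norm (ift v x) \<le> C1" using ift_power_bound[OF assms] by blast
  obtain C0 where C0: "\<And>x. norm (ift v x) \<le> C0"
    using norm_ift_le[OF test_fun_integrable[OF assms]] by blast
  have "(1 + \<bar>x\<bar>) ^ K * norm (ift v x) \<le> 2 ^ K * (C0 + C1)" for x
  proof -
    have "(1 + \<bar>x\<bar>) ^ K \<le> (2 * max 1 \<bar>x\<bar>) ^ K" by (intro power_mono) auto
    also have "\<dots> = 2 ^ K * max 1 \<bar>x\<bar> ^ K" by (simp add: power_mult_distrib)
    also have "max 1 \<bar>x\<bar> ^ K \<le> 1 + \<bar>x\<bar> ^ K" by (auto simp: max_def)
    finally have "(1 + \<bar>x\<bar>) ^ K * norm (ift v x) \<le> 2 ^ K * (1 + \<bar>x\<bar> ^ K) * norm (ift v x)"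
      by (auto intro: mult_right_mono)
    also have "\<dots> = 2 ^ K * (norm (ift v x) + \<bar>x\<bar> ^ K * norm (ift v x))" by (simp add: algebra_simps)
    also have "\<dots> \<le> 2 ^ K * (C0 + C1)" using C0 C1 by (intro mult_left_mono add_mono) auto
    finally show ?thesis .
  qed
  note * = this
  show ?thesis
  proof (intro exI conjI allI)
    show "0 \<le> 2 ^ K * (C0 + C1)" using *[of 0] by (rule order.trans[rotated]) auto
    fix x :: real
    have "(1 + \<bar>x\<bar>) ^ K > 0" by (intro zero_less_power add_pos_nonneg) auto
    then show "norm (ift v x) \<le> 2 ^ K * (C0 + C1) / (1 + \<bar>x\<bar>) ^ K"
      using *[of x] by (simp add: field_simps)
  qed
qed

lemma integrable_inverse_square:
  "integrable lborel (\<lambda>x::real. 1 / (1 + \<bar>x\<bar>) ^ 2)"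
proof (rule Bochner_Integration.integrable_bound)
  show "integrable lborel (\<lambda>x::real. inverse (1 + x^2))"
    using integrable_inverse_1_plus_square by (simp add: set_integrable_def einterval_iff[abs_def])
  have "1 + x\<^sup>2 \<le> (1 + \<bar>x\<bar>)\<^sup>2" for x :: real
    by (simp add: power2_eq_square algebra_simps)
  then show "AE x::real in lborel. norm (1 / (1 + \<bar>x\<bar>) ^ 2) \<le> norm (inverse (1 + x^2))"
    by (intro AE_I2) (simp add: divide_inverse le_imp_inverse_le add_pos_nonneg)
qed simp

lemma integrable_ift:
  assumes "test_fun v"
  shows "integrable lborel (ift v)"
proof -
  obtain C where C: "\<And>x. norm (ift v x) \<le> C / (1 + \<bar>x\<bar>) ^ 2" "C \<ge> 0"
    using ift_decay[OF assms, of 2] by blast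
  show ?thesis
  proof (rule Bochner_Integration.integrable_bound)
    show "integrable lborel (\<lambda>x::real. C * (1 / (1 + \<bar>x\<bar>) ^ 2))"
      by (intro integrable_mult_right integrable_inverse_square)
    show "ift v \<in> borel_measurable lborel"
      using smooth1_continuous_on[OF smooth1_ift[OF assms]] borel_measurable_continuous_onI by auto
    show "AE x in lborel. norm (ift v x) \<le> norm (C * (1 / (1 + \<bar>x\<bar>) ^ 2))"
      using C by (intro AE_I2) (simp add: abs_mult)
  qed
qed

lemma pair_integrable_mult:
  fixes f :: "'a::euclidean_space \<Rightarrow> complex" and g :: "'b::euclidean_space \<Rightarrow> complex"
  assumes f: "integrable lborel f" and g: "integrable lborel g"
  shows "integrable (lborel \<Otimes>\<^sub>M lborel) (\<lambda>(x, y). f x * g y)"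
    and "(LINT (x, y)|(lborel \<Otimes>\<^sub>M lborel). f x * g y) = (LINT x|lborel. f x) * (LINT y|lborel. g y)"
proof -
  have [measurable]: "f \<in> borel_measurable borel" "g \<in> borel_measurable borel"
    using f g by (simp_all add: borel_measurable_integrable)
  show *: "integrable (lborel \<Otimes>\<^sub>M lborel) (\<lambda>(x, y). f x * g y)"
  proof (rule lborel_pair.Fubini_integrable)
    show "integrable lborel (\<lambda>x. \<integral>y. norm (case (x, y) of (x, y) \<Rightarrow> f x * g y) \<partial>lborel)"
      using f by (simp add: norm_mult)
    show "AE x in lborel. integrable lborel (\<lambda>y. case (x, y) of (x, y) \<Rightarrow> f x * g y)"
      using g by (intro AE_I2) simp
  qed measurable
  show "(LINT (x, y)|(lborel \<Otimes>\<^sub>M lborel). f x * g y) = (LINT x|lborel. f x) * (LINT y|lborel. g y)"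
    using lborel_pair.integral_fst'[OF *] by simp
qed

text \<open>This is the characteristic function of the standard normal law without its normalising
  factor.\<close>

lemma gaussian_fourier:
  fixes t :: real
  shows "(LINT x|lborel. cis (t * x) * of_real (exp (- x\<^sup>2 / 2))) = of_real (sqrt (2 * pi) * exp (- t\<^sup>2 / 2))"
proof -
  have "(LINT x|lborel. std_normal_density x *\<^sub>R cis (t * x)) = of_real (exp (- t\<^sup>2 / 2))"
    using fun_cong[OF char_std_normal_distribution, of t]
    unfolding char_def by (subst (asm) integral_density) (auto simp: cis_conv_exp mult.commute)
  moreover have "std_normal_density x *\<^sub>R cis (t * x) =
      (cis (t * x) * of_real (exp (- x\<^sup>2 / 2))) / of_real (sqrt (2 * pi))" for x
    by (simp add: std_normal_density_def scaleR_conv_of_real)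
  ultimately have "(LINT x|lborel. cis (t * x) * of_real (exp (- x\<^sup>2 / 2))) / of_real (sqrt (2 * pi))
      = complex_of_real (exp (- t\<^sup>2 / 2))"
    by (simp only: integral_divide_zero)
  moreover have "complex_of_real (sqrt (2 * pi)) \<noteq> 0" by simp
  ultimately have "(LINT x|lborel. cis (t * x) * of_real (exp (- x\<^sup>2 / 2)))
      = of_real (exp (- t\<^sup>2 / 2)) * complex_of_real (sqrt (2 * pi))"
    using nonzero_divide_eq_eq by blast
  then show ?thesis by (simp add: mult.commute)
qed

lemma integrable_gaussian: "integrable lborel (\<lambda>x::real. exp (- x\<^sup>2 / 2))"
  using integrable_mult_right[OF integrable_std_normal_moment[of 0], of "sqrt (2 * pi)"]
  by (simp add: std_normal_density_def)

lemma integral_gaussian: "(LINT x|lborel. exp (- x\<^sup>2 / 2)) = sqrt (2 * pi)"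
  using integral_std_normal_moment_even[of 0] by (simp add: std_normal_density_def)

text \<open>Gaussian summation: damp the integral by \<open>g n\<close>, which tends to 1, and
  compute the damped integral \<open>L n\<close> in two ways. Dominated convergence gives the
  left-hand side; Fubini and the Gaussian transform give an average of \<open>v\<close> around u
  that tends to 2 pi \<open>v u\<close>.\<close>

lemma fourier_inversion:
  fixes v :: "real \<Rightarrow> complex"
  assumes v: "test_fun v"
  shows "(LINT x|lborel. cis (- (x * u)) * ift v x) = 2 * pi * v u"
proof -
  define e where "e n = inverse (real (Suc n))" for n
  have e_pos: "e n > 0" for n by (simp add: e_def)
  have e_lim: "e \<longlonglongrightarrow> 0" unfolding e_def by (rule LIMSEQ_inverse_real_of_nat)
  define g where "g n x = exp (- (e n * x)\<^sup>2 / 2)" for n x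
  define L where "L n = (LINT x|lborel. cis (- (x * u)) * ift v x * of_real (g n x))" for n
  have vi: "integrable lborel v" by (rule test_fun_integrable[OF v])
  have vm [measurable]: "v \<in> borel_measurable borel" using vi by (simp add: borel_measurable_integrable)
  have vc: "isCont v y" for y
    using test_fun_continuous[OF v, of UNIV] by (simp add: continuous_on_eq_continuous_at)
  have im [measurable]: "ift v \<in> borel_measurable borel"
    using integrable_ift[OF v] by (simp add: borel_measurable_integrable)
  have gm [measurable]: "g n \<in> borel_measurable borel" for n unfolding g_def by measurable
  have gi: "integrable lborel (g n)" for n
    unfolding g_def using lborel_integrable_real_affine[OF integrable_gaussian, of "e n" 0] e_pos[of n] by simp
  have "L \<longlonglongrightarrow> (LINT x|lborel. cis (- (x * u)) * ift v x)"
    unfolding L_def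
  proof (rule integral_dominated_convergence)
    show "integrable lborel (\<lambda>x. norm (ift v x))" using integrable_ift[OF v] by simp
    show "AE x in lborel. (\<lambda>n. cis (- (x * u)) * ift v x * of_real (g n x)) \<longlonglongrightarrow> cis (- (x * u)) * ift v x"
    proof (intro AE_I2)
      fix x
      have "(\<lambda>n. cis (- (x * u)) * ift v x * complex_of_real (exp (- (e n * x)\<^sup>2 / 2))) \<longlonglongrightarrow>
         cis (- (x * u)) * ift v x * complex_of_real (exp (- (0 * x)\<^sup>2 / 2))"
        by (intro tendsto_intros e_lim) auto
      then show "(\<lambda>n. cis (- (x * u)) * ift v x * of_real (g n x)) \<longlonglongrightarrow> cis (- (x * u)) * ift v x"
        by (simp add: g_def)
    qed
    show "AE x in lborel. norm (cis (- (x * u)) * ift v x * of_real (g n x)) \<le> norm (ift v x)" for n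
      by (intro AE_I2) (auto simp: norm_mult g_def intro!: mult_right_le_one_le)
  qed measurable
  moreover have "L n = sqrt (2 * pi) * (LINT z|lborel. v (u + e n * z) * of_real (exp (- z\<^sup>2 / 2)))" for n
  proof -
    \<comment> \<open>The damping factor supplies the integrability in x that Fubini
      requires.\<close>
    have int: "integrable (lborel \<Otimes>\<^sub>M lborel) (\<lambda>(x, y). cis (x * (y - u)) * (of_real (g n x) * v y))"
    proof (rule Bochner_Integration.integrable_bound)
      show "integrable (lborel \<Otimes>\<^sub>M lborel) (\<lambda>(x, y). complex_of_real (g n x) * v y)"
        by (rule pair_integrable_mult[OF _ vi]) (use gi[of n] in simp)
      show "(\<lambda>(x, y). cis (x * (y - u)) * (complex_of_real (g n x) * v y)) \<in> borel_measurable (lborel \<Otimes>\<^sub>M lborel)"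
        by measurable
    qed (auto simp: norm_mult)
    have "L n = (LINT x|lborel. LINT y|lborel. cis (x * (y - u)) * (of_real (g n x) * v y))"
      unfolding L_def ift_def
    proof (rule Bochner_Integration.integral_cong[OF refl])
      fix x
      have "cis (- (x * u)) * (LINT y|lborel. cis (x * y) * v y) * of_real (g n x) =
         (LINT y|lborel. (cis (- (x * u)) * of_real (g n x)) * (cis (x * y) * v y))"
        by simp
      also have "\<dots> = (LINT y|lborel. cis (x * (y - u)) * (of_real (g n x) * v y))"
      proof (intro Bochner_Integration.integral_cong refl)
        fix y
        have "cis (x * (y - u)) = cis (x * y) * cis (- (x * u))"
          by (simp add: cis_mult right_diff_distrib)
        then show "(cis (- (x * u)) * of_real (g n x)) * (cis (x * y) * v y) =
            cis (x * (y - u)) * (of_real (g n x) * v y)"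
          by (simp only: mult_ac)
      qed
      finally show "cis (- (x * u)) * (LINT y|lborel. cis (x * y) * v y) * of_real (g n x) =
         (LINT y|lborel. cis (x * (y - u)) * (of_real (g n x) * v y))" .
    qed
    also have "\<dots> = (LINT y|lborel. LINT x|lborel. cis (x * (y - u)) * (of_real (g n x) * v y))"
      by (rule lborel_pair.Fubini_integral[OF int, symmetric])
    also have "\<dots> = (LINT y|lborel. v y * of_real (sqrt (2 * pi) * exp (- ((y - u) / e n)\<^sup>2 / 2) / e n))"
    proof (rule Bochner_Integration.integral_cong[OF refl])
      fix y
      have "(LINT x|lborel. cis ((y - u) * x) * of_real (g n x)) =
         (LINT x|lborel. cis (((y - u) / e n) * (e n * x)) * of_real (exp (- (e n * x)\<^sup>2 / 2)))"
        using e_pos[of n] by (simp add: g_def)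
      also have "\<dots> = (LINT x|lborel. cis (((y - u) / e n) * x) * of_real (exp (- x\<^sup>2 / 2))) /\<^sub>R e n"
        using lborel_integral_real_affine[of "e n" "\<lambda>x. cis (((y - u) / e n) * x) * of_real (exp (- x\<^sup>2 / 2))" 0] e_pos[of n]
        by simp
      finally have "(LINT x|lborel. cis ((y - u) * x) * of_real (g n x)) = of_real (sqrt (2 * pi) * exp (- ((y - u) / e n)\<^sup>2 / 2)) /\<^sub>R e n"
        by (simp only: gaussian_fourier)
      moreover have "(LINT x|lborel. cis (x * (y - u)) * (of_real (g n x) * v y)) = (LINT x|lborel. cis ((y - u) * x) * of_real (g n x)) * v y"
        by (simp add: mult_ac flip: Bochner_Integration.integral_mult_left_zero)
      ultimately show "(LINT x|lborel. cis (x * (y - u)) * (of_real (g n x) * v y)) = v y * of_real (sqrt (2 * pi) * exp (- ((y - u) / e n)\<^sup>2 / 2) / e n)"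
        by (simp add: scaleR_conv_of_real field_simps)
    qed
    \<comment> \<open>The substitution y = u + e z makes the Gaussian kernel independent of n, so
      only the argument of \<open>v\<close> still moves.\<close>
    also have "\<dots> = e n *\<^sub>R (LINT z|lborel. v (u + e n * z) * of_real (sqrt (2 * pi) * exp (- ((u + e n * z - u) / e n)\<^sup>2 / 2) / e n))"
      using lborel_integral_real_affine[of "e n" "\<lambda>y. v y * of_real (sqrt (2 * pi) * exp (- ((y - u) / e n)\<^sup>2 / 2) / e n)" u] e_pos[of n]
      by simp
    also have "\<dots> = (LINT z|lborel. of_real (sqrt (2 * pi)) * (v (u + e n * z) * of_real (exp (- z\<^sup>2 / 2))))"
      unfolding Bochner_Integration.integral_scaleR_right[symmetric] using e_pos[of n]
      by (intro Bochner_Integration.integral_cong refl) (simp add: scaleR_conv_of_real field_simps)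
    finally show ?thesis by simp
  qed
  then have "L = (\<lambda>n. sqrt (2 * pi) * (LINT z|lborel. v (u + e n * z) * of_real (exp (- z\<^sup>2 / 2))))" by blast
  moreover have "(\<lambda>n. (LINT z|lborel. v (u + e n * z) * of_real (exp (- z\<^sup>2 / 2)))) \<longlonglongrightarrow>
      (LINT z|lborel. v u * of_real (exp (- z\<^sup>2 / 2)))"
  proof -
    obtain B where B: "\<And>y. norm (v y) \<le> B"
    proof -
      obtain M where M: "M > 0" "\<And>u. M \<le> \<bar>u\<bar> \<Longrightarrow> v u = 0" using v by (auto elim: test_fun_support)
      have "compact (v ` {-M..M})" by (intro compact_continuous_image test_fun_continuous v) auto
      then obtain B where "\<And>y. y \<in> {-M..M} \<Longrightarrow> norm (v y) \<le> B" by (force dest: compact_imp_bounded simp: bounded_iff)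
      then have "norm (v y) \<le> max B 0" for y using M(2)[of y] by (cases "\<bar>y\<bar> \<le> M") (auto simp: abs_le_iff le_max_iff_disj)
      then show ?thesis using that by blast
    qed
    show ?thesis
    proof (rule integral_dominated_convergence)
      show "integrable lborel (\<lambda>z::real. B * exp (- z\<^sup>2 / 2))" using integrable_gaussian by simp
      show "AE z in lborel. (\<lambda>n. v (u + e n * z) * complex_of_real (exp (- z\<^sup>2 / 2))) \<longlonglongrightarrow> v u * of_real (exp (- z\<^sup>2 / 2))"
      proof (intro AE_I2 tendsto_intros)
        fix z
        have "(\<lambda>n. u + e n * z) \<longlonglongrightarrow> u + 0 * z" by (intro tendsto_intros e_lim)
        then show "(\<lambda>n. v (u + e n * z)) \<longlonglongrightarrow> v u" using isCont_tendsto_compose[OF vc[of u]] by simp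
      qed
      show "AE z in lborel. norm (v (u + e n * z) * complex_of_real (exp (- z\<^sup>2 / 2))) \<le> B * exp (- z\<^sup>2 / 2)" for n
        using B by (intro AE_I2) (auto simp: norm_mult)
    qed measurable
  qed
  then have "(\<lambda>n. sqrt (2 * pi) * (LINT z|lborel. v (u + e n * z) * of_real (exp (- z\<^sup>2 / 2)))) \<longlonglongrightarrow>
      of_real (sqrt (2 * pi)) * (LINT z|lborel. v u * of_real (exp (- z\<^sup>2 / 2)))"
    by (intro tendsto_intros)
  moreover have "of_real (sqrt (2 * pi)) * (LINT z|lborel. v u * of_real (exp (- z\<^sup>2 / 2))) = 2 * pi * v u"
  proof -
    have "(LINT z|lborel. v u * complex_of_real (exp (- z\<^sup>2 / 2))) = v u * of_real (sqrt (2 * pi))"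
      by (simp only: Bochner_Integration.integral_mult_right_zero integral_complex_of_real integral_gaussian)
    moreover have "complex_of_real (sqrt (2 * pi)) * of_real (sqrt (2 * pi)) = 2 * pi"
      by (simp flip: of_real_mult)
    ultimately show ?thesis
      by (simp only: mult.left_commute[of _ "v u"]) (simp only: mult.commute[of "v u"])
  qed
  ultimately show ?thesis
    using LIMSEQ_unique[of L] by (simp only:)
qed

section \<open>Locally finite sums of products\<close>

lemma Basis_cart: "(Basis :: (real ^ 'n) set) = range (\<lambda>i. axis i 1)"
  by (auto simp: Basis_vec_def)

lemma inj_axis_1: "inj (\<lambda>i::'n::finite. axis i (1::real))"
  by (auto simp: inj_on_def axis_eq_axis)

lemma prod_Basis_cart: "(\<Prod>b\<in>(Basis :: (real ^ 'n) set). g b) = (\<Prod>i\<in>UNIV. g (axis i 1))"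
  unfolding Basis_cart by (subst prod.reindex[OF inj_axis_1]) (simp add: o_def)

lemma nn_integral_tensor:
  fixes f :: "'n::finite \<Rightarrow> real \<Rightarrow> ennreal"
  assumes [measurable]: "\<And>i. f i \<in> borel_measurable borel"
  shows "(\<integral>\<^sup>+x. (\<Prod>i\<in>UNIV. f i (x $ i)) \<partial>lborel) = (\<Prod>i\<in>UNIV. \<integral>\<^sup>+x. f i x \<partial>lborel)"
proof -
  \<comment> \<open>Products over \<open>Basis\<close> are indexed by vectors; inverting i |->
    \<open>axis i 1\<close> recovers the coordinate index.\<close>
  define g where "g b = f (inv (\<lambda>i. axis i (1::real)) b)" for b
  have g: "g (axis i 1) = f i" for i by (simp add: g_def inv_f_f[OF inj_axis_1])
  have "(\<integral>\<^sup>+x. (\<Prod>b\<in>(Basis :: (real ^ 'n) set). g b (x \<bullet> b)) \<partial>lborel) = (\<Prod>b\<in>(Basis :: (real ^ 'n) set). (\<integral>\<^sup>+x. g b x \<partial>lborel))"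
    by (rule nn_integral_lborel_prod) (auto simp: g_def)
  then show ?thesis by (simp add: prod_Basis_cart g inner_axis)
qed

text \<open>Lebesgue measure is the image of the product measure over \<open>Basis\<close>, where
  integrals of products split.\<close>

lemma integral_tensor:
  fixes f :: "'n::finite \<Rightarrow> real \<Rightarrow> complex"
  assumes f: "\<And>i. integrable lborel (f i)"
  shows "integrable lborel (\<lambda>x. \<Prod>i\<in>UNIV. f i (x $ i))"
    and "(LINT x|lborel. (\<Prod>i\<in>UNIV. f i (x $ i))) = (\<Prod>i\<in>UNIV. LINT x|lborel. f i x)"
proof -
  define g where "g b = f (inv (\<lambda>i. axis i (1::real)) b)" for b
  have g: "g (axis i 1) = f i" for i by (simp add: g_def inv_f_f[OF inj_axis_1])
  have [measurable]: "f i \<in> borel_measurable borel" for i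
    using f[of i] by (simp add: borel_measurable_integrable)
  have gi: "integrable lborel (g b)" for b using f by (simp add: g_def)
  have [measurable]: "g b \<in> borel_measurable borel" for b by (simp add: g_def)
  let ?T = "\<lambda>h. \<Sum>b\<in>(Basis :: (real ^ 'n) set). h b *\<^sub>R b"
  interpret product_sigma_finite "\<lambda>b::real ^ 'n. lborel :: real measure" ..
  have T: "?T \<in> measurable (\<Pi>\<^sub>M b\<in>(Basis :: (real ^ 'n) set). lborel) borel" by measurable
  have m: "(\<lambda>x::real^'n. \<Prod>i\<in>UNIV. f i (x $ i)) \<in> borel_measurable borel"
    by (intro borel_measurable_prod measurable_compose[OF _ \<open>f _ \<in> borel_measurable borel\<close>])
       (auto intro!: borel_measurable_continuous_onI continuous_intros)
  have eq: "(\<Prod>i\<in>UNIV. f i (?T h $ i)) = (\<Prod>b\<in>Basis. g b (h b))" for h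
  proof -
    have "?T h $ i = h (axis i 1)" for i
    proof -
      have "?T h $ i = ?T h \<bullet> axis i 1" by (simp only: inner_axis inner_real_def mult_1_right)
      also have "\<dots> = h (axis i 1)" by (rule inner_sum_left_Basis) (simp add: Basis_cart)
      finally show ?thesis .
    qed
    then show ?thesis by (simp add: prod_Basis_cart g)
  qed
  show "integrable lborel (\<lambda>x. \<Prod>i\<in>UNIV. f i (x $ i))"
    unfolding lborel_eq[where 'a = "real ^ 'n"]
    by (subst integrable_distr_eq[OF T m]) (simp only: eq, intro product_integrable_prod finite_Basis gi)
  show "(LINT x|lborel. (\<Prod>i\<in>UNIV. f i (x $ i))) = (\<Prod>i\<in>UNIV. LINT x|lborel. f i x)"
    unfolding lborel_eq[where 'a = "real ^ 'n"]
    by (subst integral_distr[OF T m])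
       (simp only: eq product_integral_prod[OF finite_Basis gi], simp add: prod_Basis_cart g)
qed

lemma partial_deriv_eq:
  assumes "(f has_derivative D) (at x)"
  shows "partial_deriv b f x = D b"
proof -
  have "((\<lambda>t. x + t *\<^sub>R b) has_derivative (\<lambda>t. t *\<^sub>R b)) (at 0)"
    by (auto intro!: derivative_eq_intros)
  then have "((\<lambda>t. f (x + t *\<^sub>R b)) has_derivative (\<lambda>t. D (t *\<^sub>R b))) (at 0)"
    using has_derivative_compose[of "\<lambda>t. x + t *\<^sub>R b" _ 0 UNIV f D] assms by simp
  moreover have "D (t *\<^sub>R b) = t *\<^sub>R D b" for t
    using assms has_derivative_linear linear_scale by blast
  ultimately show ?thesis
    by (simp add: partial_deriv_def has_vector_derivative_def[symmetric] vector_derivative_at)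
qed

text \<open>\<open>F i b m\<close> is the m-th derivative of the factor of the i-th term in
  direction b, so the derivatives are part of the data. The neighbourhood and the finite set J must
  serve all orders \<beta> at once; then termwise differentiation can be iterated even if the sum is
  infinite.\<close>

locale tensor_sum =
  fixes I :: "'i set" and c :: "'i \<Rightarrow> complex"
    and F :: "'i \<Rightarrow> 'a::euclidean_space \<Rightarrow> nat \<Rightarrow> real \<Rightarrow> complex"
  assumes deriv: "\<And>i b m t. i \<in> I \<Longrightarrow> b \<in> Basis \<Longrightarrow>
      (F i b m has_vector_derivative F i b (Suc m) t) (at t)"
    and locally_finite: "\<And>z. \<exists>e>0. \<exists>J\<subseteq>I. finite J \<and>
      (\<forall>y\<in>ball z e. \<forall>i\<in>I - J. \<forall>\<beta>. c i * (\<Prod>b\<in>Basis. F i b (\<beta> b) (y \<bullet> b)) = 0)"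
begin

text \<open>\<beta> records the order of differentiation in each basis direction; a partial
  derivative merely increments one entry.\<close>

definition TS :: "('a \<Rightarrow> nat) \<Rightarrow> 'a \<Rightarrow> complex" where
  "TS \<beta> z = (\<Sum>\<^sub>\<infinity>i\<in>I. c i * (\<Prod>b\<in>Basis. F i b (\<beta> b) (z \<bullet> b)))"

lemma TS_local:
  obtains e J where "e > 0" "finite J" "J \<subseteq> I"
    "\<And>y \<beta>. y \<in> ball z e \<Longrightarrow> TS \<beta> y = (\<Sum>i\<in>J. c i * (\<Prod>b\<in>Basis. F i b (\<beta> b) (y \<bullet> b)))"
proof -
  obtain e J where *: "e > 0" "finite J" "J \<subseteq> I"
     "\<forall>y\<in>ball z e. \<forall>i\<in>I - J. \<forall>\<beta>. c i * (\<Prod>b\<in>Basis. F i b (\<beta> b) (y \<bullet> b)) = 0"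
    using locally_finite[of z] by blast
  show ?thesis
  proof (rule that[OF *(1-3)])
    fix y \<beta> assume y: "y \<in> ball z e"
    have "TS \<beta> y = (\<Sum>\<^sub>\<infinity>i\<in>J. c i * (\<Prod>b\<in>Basis. F i b (\<beta> b) (y \<bullet> b)))"
      unfolding TS_def
    proof (rule infsum_cong_neutral)
      show "c i * (\<Prod>b\<in>Basis. F i b (\<beta> b) (y \<bullet> b)) = 0" if "i \<in> I - J" for i
        using *(4) y that by blast
    qed (use *(3) in auto)
    then show "TS \<beta> y = (\<Sum>i\<in>J. c i * (\<Prod>b\<in>Basis. F i b (\<beta> b) (y \<bullet> b)))"
      using *(2) by simp
  qed
qed

lemma TS_has_derivative:
  obtains D where "(TS \<beta> has_derivative D) (at z)"
    "\<And>b. b \<in> Basis \<Longrightarrow> D b = TS (\<beta>(b := Suc (\<beta> b))) z"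
proof -
  obtain e J where eJ: "e > 0" "finite J" "J \<subseteq> I"
    "\<And>y \<beta>. y \<in> ball z e \<Longrightarrow> TS \<beta> y = (\<Sum>i\<in>J. c i * (\<Prod>b\<in>Basis. F i b (\<beta> b) (y \<bullet> b)))"
    by (rule TS_local[of z]) blast
  define D where "D h = (\<Sum>i\<in>J. c i * (\<Sum>b\<in>Basis. ((h \<bullet> b) *\<^sub>R F i b (Suc (\<beta> b)) (z \<bullet> b)) *
      (\<Prod>b'\<in>Basis - {b}. F i b' (\<beta> b') (z \<bullet> b'))))" for h
  have F: "((\<lambda>y. F i b m (y \<bullet> b)) has_derivative (\<lambda>h. (h \<bullet> b) *\<^sub>R F i b (Suc m) (z \<bullet> b))) (at z)"
    if "i \<in> J" "b \<in> Basis" for i b m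
  proof -
    have "(F i b m has_derivative (\<lambda>s. s *\<^sub>R F i b (Suc m) (z \<bullet> b))) (at (z \<bullet> b))"
      using deriv[of i b m] that eJ(3) by (auto simp: has_vector_derivative_def)
    moreover have "((\<lambda>y. y \<bullet> b) has_derivative (\<lambda>h. h \<bullet> b)) (at z)"
      by (auto intro!: derivative_eq_intros)
    ultimately show ?thesis
      using has_derivative_compose[of "\<lambda>y. y \<bullet> b" "\<lambda>h. h \<bullet> b" z UNIV] by simp
  qed
  have "((\<lambda>y. \<Sum>i\<in>J. c i * (\<Prod>b\<in>Basis. F i b (\<beta> b) (y \<bullet> b))) has_derivative D) (at z)"
    unfolding D_def
    by (intro has_derivative_sum has_derivative_mult_right has_derivative_prod F)
  then have "(TS \<beta> has_derivative D) (at z)"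
    by (rule has_derivative_transform_within_open[of _ _ _ _ "ball z e"]) (use eJ in auto)
  moreover have "D b = TS (\<beta>(b := Suc (\<beta> b))) z" if b: "b \<in> Basis" for b
  proof -
    have "D b = (\<Sum>i\<in>J. c i * (\<Prod>b'\<in>Basis. F i b' ((\<beta>(b := Suc (\<beta> b))) b') (z \<bullet> b')))"
      unfolding D_def
    proof (intro sum.cong refl arg_cong2[where f = "(*)"])
      fix i assume "i \<in> J"
      have "(\<Sum>b'\<in>Basis. ((b \<bullet> b') *\<^sub>R F i b' (Suc (\<beta> b')) (z \<bullet> b')) *
        (\<Prod>b''\<in>Basis - {b'}. F i b'' (\<beta> b'') (z \<bullet> b''))) =
        (\<Sum>b'\<in>Basis. if b' = b then F i b (Suc (\<beta> b)) (z \<bullet> b) *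
        (\<Prod>b''\<in>Basis - {b}. F i b'' (\<beta> b'') (z \<bullet> b'')) else 0)"
        by (rule sum.cong) (use b in \<open>auto simp: inner_Basis\<close>)
      also have "\<dots> = F i b (Suc (\<beta> b)) (z \<bullet> b) * (\<Prod>b''\<in>Basis - {b}. F i b'' (\<beta> b'') (z \<bullet> b''))"
        using b by simp
      also have "\<dots> = (\<Prod>b'\<in>Basis. F i b' ((\<beta>(b := Suc (\<beta> b))) b') (z \<bullet> b'))"
        using b by (subst prod.remove[of Basis b]) (auto intro!: prod.cong)
      finally show "(\<Sum>b'\<in>Basis. ((b \<bullet> b') *\<^sub>R F i b' (Suc (\<beta> b')) (z \<bullet> b')) *
        (\<Prod>b''\<in>Basis - {b'}. F i b'' (\<beta> b'') (z \<bullet> b''))) =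
        (\<Prod>b'\<in>Basis. F i b' ((\<beta>(b := Suc (\<beta> b))) b') (z \<bullet> b'))" .
    qed
    then show ?thesis using eJ by simp
  qed
  ultimately show ?thesis by (rule that)
qed

lemma TS_differentiable: "TS \<beta> differentiable (at z)"
  by (metis TS_has_derivative differentiable_def)

lemma partial_deriv_TS: "b \<in> Basis \<Longrightarrow> partial_deriv b (TS \<beta>) = TS (\<beta>(b := Suc (\<beta> b)))"
  by (metis TS_has_derivative partial_deriv_eq ext)

lemma funpow_partial_deriv_TS:
  "b \<in> Basis \<Longrightarrow> (partial_deriv b ^^ k) (TS \<beta>) = TS (\<beta>(b := \<beta> b + k))"
  by (induction k) (auto simp: partial_deriv_TS)

lemma smooth_TS: "smooth (TS \<beta>)"
proof -
  have "\<exists>\<beta>'. foldr partial_deriv bs (TS \<beta>) = TS \<beta>'" if "set bs \<subseteq> Basis" for bs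
    using that by (induction bs) (auto simp: partial_deriv_TS)
  then show ?thesis unfolding smooth_def by (metis TS_differentiable)
qed

end

lemma coords: "distinct (coords :: 'n::finite list)" "set (coords :: 'n list) = UNIV"
proof -
  have "\<exists>is :: 'n list. distinct is \<and> set is = UNIV"
    using finite_distinct_list[of "UNIV :: 'n set"] by auto
  then have "distinct (coords :: 'n list) \<and> set (coords :: 'n list) = UNIV"
    unfolding coords_def by (rule someI_ex)
  then show "distinct (coords :: 'n list)" "set (coords :: 'n list) = UNIV" by auto
qed

text \<open>Induction over the enumeration of coordinates: since it is distinct, each direction
  receives its order exactly once, whatever the enumeration is.\<close>

lemma multi_deriv_TS:
  fixes F :: "'i \<Rightarrow> real ^ 'n \<Rightarrow> nat \<Rightarrow> real \<Rightarrow> complex"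
  assumes "tensor_sum I c F"
  shows "multi_deriv \<alpha> (\<lambda>z. \<Sum>\<^sub>\<infinity>i\<in>I. c i * (\<Prod>j\<in>UNIV. F i (axis j 1) 0 (z $ j))) =
    (\<lambda>z. \<Sum>\<^sub>\<infinity>i\<in>I. c i * (\<Prod>j\<in>UNIV. F i (axis j 1) (\<alpha> $ j) (z $ j)))"
proof -
  interpret tensor_sum I c F by fact
  have *: "foldr (\<lambda>i. partial_deriv (axis i 1) ^^ (\<alpha> $ i)) is (TS \<beta>) =
     TS (\<lambda>b. \<beta> b + (\<Sum>i\<in>set is. if b = axis i 1 then \<alpha> $ i else 0))" if "distinct is" for "is" \<beta>
    using that
  proof (induction "is")
    case (Cons i "is")
    have "(\<lambda>b. \<beta> b + (\<Sum>i\<in>set is. if b = axis i 1 then \<alpha> $ i else 0))(axis i 1 :=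
        (\<beta> (axis i 1) + (\<Sum>j\<in>set is. if axis i (1::real) = axis j 1 then \<alpha> $ j else 0)) + \<alpha> $ i) =
       (\<lambda>b. \<beta> b + (\<Sum>i\<in>set (i # is). if b = axis i 1 then \<alpha> $ i else 0))"
      using Cons.prems by (auto simp: fun_eq_iff)
    then show ?case
      using Cons by (simp add: funpow_partial_deriv_TS Basis_cart)
  qed simp
  have TS: "TS \<beta> = (\<lambda>z. \<Sum>\<^sub>\<infinity>i\<in>I. c i * (\<Prod>j\<in>UNIV. F i (axis j 1) (\<beta> (axis j 1)) (z $ j)))" for \<beta>
    by (simp add: TS_def fun_eq_iff prod_Basis_cart inner_axis)
  have "multi_deriv \<alpha> (TS (\<lambda>_. 0)) = TS (\<lambda>b. \<Sum>i\<in>UNIV. if b = axis i 1 then \<alpha> $ i else 0)"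
    unfolding multi_deriv_def using *[OF coords(1), of "\<lambda>_. 0"] by (simp add: coords(2))
  then show ?thesis
    unfolding TS by (simp add: axis_eq_axis)
qed

section \<open>Affine substitutions and integrals of directional derivatives\<close>

lemma integral_euclidean_affine:
  fixes f :: "'a::euclidean_space \<Rightarrow> 'b::{banach, second_countable_topology}"
  assumes f: "integrable lborel f" and c: "c \<noteq> 0"
  shows "integrable lborel (\<lambda>x. f (t + c *\<^sub>R x))"
    and "(LINT x|lborel. f (t + c *\<^sub>R x)) = (LINT x|lborel. f x) /\<^sub>R \<bar>c\<bar> ^ DIM('a)"
proof -
  have [measurable]: "f \<in> borel_measurable borel" using f by (simp add: borel_measurable_integrable)
  have eq: "lborel = density (distr lborel borel (\<lambda>x::'a. t + c *\<^sub>R x)) (\<lambda>_. ennreal (\<bar>c\<bar> ^ DIM('a)))"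
    using lborel_affine[OF c, of t] by simp
  have "integrable (density (distr lborel borel (\<lambda>x::'a. t + c *\<^sub>R x)) (\<lambda>_. ennreal (\<bar>c\<bar> ^ DIM('a)))) f"
    using f eq by simp
  then have "integrable lborel (\<lambda>x. \<bar>c\<bar> ^ DIM('a) *\<^sub>R f (t + c *\<^sub>R x))"
    by (subst (asm) integrable_density, simp_all, subst (asm) integrable_distr_eq, simp_all)
  from integrable_scaleR_right[OF this, of "inverse (\<bar>c\<bar> ^ DIM('a))"]
  show "integrable lborel (\<lambda>x. f (t + c *\<^sub>R x))" using c by simp
  have "(LINT x|lborel. f x) = (LINT x|density (distr lborel borel (\<lambda>x::'a. t + c *\<^sub>R x)) (\<lambda>_. ennreal (\<bar>c\<bar> ^ DIM('a))). f x)"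
    using eq by simp
  also have "\<dots> = (LINT x|lborel. \<bar>c\<bar> ^ DIM('a) *\<^sub>R f (t + c *\<^sub>R x))"
    by (subst integral_density, simp_all, subst integral_distr, simp_all)
  finally show "(LINT x|lborel. f (t + c *\<^sub>R x)) = (LINT x|lborel. f x) /\<^sub>R \<bar>c\<bar> ^ DIM('a)"
    using c by simp
qed

text \<open>Write f(y + b) - f(y) as the integral of f'(y + t b) over t in [0, 1] and integrate over
  y. The difference integrates to 0 by translation invariance, while Fubini turns the other side
  into the integral of f'.\<close>

lemma integral_directional_derivative_eq_0:
  fixes f f' :: "'a::euclidean_space \<Rightarrow> complex"
  assumes deriv: "\<And>y t. ((\<lambda>t. f (y + t *\<^sub>R b)) has_vector_derivative f' (y + t *\<^sub>R b)) (at t)"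
    and f: "integrable lborel f" and f': "integrable lborel f'" and cont: "continuous_on UNIV f'"
  shows "(LINT y|lborel. f' y) = 0"
proof -
  have [measurable]: "f' \<in> borel_measurable borel" using cont by (rule borel_measurable_continuous_onI)
  have tr: "integrable lborel (\<lambda>y. h (y + s))" "(LINT y|lborel. h (y + s)) = (LINT y|lborel. h y)"
    if "integrable lborel h" for h :: "'a \<Rightarrow> complex" and s
    using integral_euclidean_affine[OF that, of 1 s] by (simp_all add: add.commute)
  let ?g = "\<lambda>t y. indicator {0..1::real} t *\<^sub>R f' (y + t *\<^sub>R b)"
  have int: "integrable (lborel \<Otimes>\<^sub>M lborel) (\<lambda>(t, y). ?g t y)"
  proof (rule lborel_pair.Fubini_integrable)
    have "(\<integral>y. norm (case (t, y) of (t, y) \<Rightarrow> ?g t y) \<partial>lborel) = indicator {0..1} t *\<^sub>R (LINT y|lborel. norm (f' y))" for t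
    proof -
      have "(LINT y|lborel. norm (f' (y + t *\<^sub>R b))) = (LINT y|lborel. norm (f' y))"
        using tr(2)[of "\<lambda>y. complex_of_real (norm (f' y))" "t *\<^sub>R b"] f'
        by (simp add: integral_complex_of_real)
      then show ?thesis by (simp add: indicator_def)
    qed
    moreover have "integrable lborel (\<lambda>t::real. indicator {0..1::real} t *\<^sub>R (LINT y|lborel. norm (f' y)))"
      by (rule borel_integrable_compact) (auto intro: continuous_intros)
    ultimately show "integrable lborel (\<lambda>t. \<integral>y. norm (case (t, y) of (t, y) \<Rightarrow> ?g t y) \<partial>lborel)"
      by (simp only:)
    show "AE t in lborel. integrable lborel (\<lambda>y. case (t, y) of (t, y) \<Rightarrow> ?g t y)"
      using tr(1)[OF f'] by (intro AE_I2) auto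
  qed measurable
  have "(LINT y|lborel. LINT t|lborel. ?g t y) = (LINT t|lborel. LINT y|lborel. ?g t y)"
    by (rule lborel_pair.Fubini_integral[OF int])
  also have "\<dots> = (LINT t|lborel. indicator {0..1::real} t *\<^sub>R (LINT y|lborel. f' y))"
    using tr(2)[OF f'] by simp
  also have "\<dots> = (LINT y|lborel. f' y)"
    by simp
  finally have 1: "(LINT y|lborel. LINT t|lborel. ?g t y) = (LINT y|lborel. f' y)" .
  have "(LINT t|lborel. ?g t y) = f (y + b) - f y" for y
  proof -
    have c: "continuous_on {0..1::real} (\<lambda>t. f' (y + t *\<^sub>R b))"
      by (rule continuous_on_compose2[OF cont]) (auto intro!: continuous_intros)
    have "(LINT t|lborel. ?g t y) = integral {0..1} (\<lambda>t. f' (y + t *\<^sub>R b))"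
      using set_borel_integral_eq_integral(2)[of "{0..1}" "\<lambda>t. f' (y + t *\<^sub>R b)"] borel_integrable_compact[OF _ c]
      by (simp add: set_integrable_def set_lebesgue_integral_def)
    moreover have "((\<lambda>t. f' (y + t *\<^sub>R b)) has_integral f (y + 1 *\<^sub>R b) - f (y + 0 *\<^sub>R b)) {0..1}"
      by (rule fundamental_theorem_of_calculus) (use deriv in \<open>auto intro: has_vector_derivative_at_within\<close>)
    ultimately show ?thesis by (simp add: integral_unique)
  qed
  then have "(LINT y|lborel. LINT t|lborel. ?g t y) = (LINT y|lborel. f (y + b)) - (LINT y|lborel. f y)"
    using tr(1)[OF f] f by simp
  then show ?thesis using 1 tr(2)[OF f] by simp
qed

lemma directional_derivative:
  assumes "\<And>x. f differentiable (at x)"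
  shows "((\<lambda>t. f (y + t *\<^sub>R b)) has_vector_derivative partial_deriv b f (y + t *\<^sub>R b)) (at t)"
proof -
  obtain D where D: "(f has_derivative D) (at (y + t *\<^sub>R b))"
    using assms unfolding differentiable_def by blast
  have "((\<lambda>t. y + t *\<^sub>R b) has_derivative (\<lambda>t. t *\<^sub>R b)) (at t)"
    by (auto intro!: derivative_eq_intros)
  then have "((\<lambda>t. f (y + t *\<^sub>R b)) has_derivative (\<lambda>t. D (t *\<^sub>R b))) (at t)"
    using has_derivative_compose[of "\<lambda>t. y + t *\<^sub>R b" _ t UNIV f D] D by simp
  moreover have "D (t *\<^sub>R b) = t *\<^sub>R D b" for t
    using D has_derivative_linear linear_scale by blast
  ultimately show ?thesis
    by (simp add: has_vector_derivative_def partial_deriv_eq[OF D])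
qed

section \<open>Tensor products\<close>

text \<open>Up to the factor (2 pi)^n this is the inverse Fourier transform on R^n of the tensor
  product of the functions \<open>v i\<close>.\<close>

definition tensor_ift :: "('n::finite \<Rightarrow> real \<Rightarrow> complex) \<Rightarrow> real ^ 'n \<Rightarrow> complex" where
  "tensor_ift v x = (\<Prod>i\<in>UNIV. ift (v i) (x $ i))"

text \<open>A sum with one term: the calculus built for sums of products then yields smoothness and
  all derivatives.\<close>

lemma tensor_ift_tensor_sum:
  fixes v :: "'n::finite \<Rightarrow> real \<Rightarrow> complex"
  assumes "\<And>i. test_fun (v i)"
  shows "tensor_sum {()} (\<lambda>_. 1) (\<lambda>_ (b :: real ^ 'n) m. (vderiv ^^ m) (ift (v (inv (\<lambda>i. axis i 1) b))))"
proof
  fix m t and b :: "real ^ 'n"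
  let ?f = "ift (v (inv (\<lambda>i. axis i 1) b))"
  have "smooth1 ((vderiv ^^ m) ?f)" using assms by (intro smooth1_funpow smooth1_ift)
  from smooth1_vderiv(1)[OF this]
  show "((vderiv ^^ m) ?f has_vector_derivative (vderiv ^^ Suc m) ?f t) (at t)" by simp
next
  fix z :: "real ^ 'n"
  show "\<exists>e>0. \<exists>J\<subseteq>{()}. finite J \<and> (\<forall>y\<in>ball z e. \<forall>i\<in>{()} - J. \<forall>\<beta>. 1 *
      (\<Prod>b\<in>Basis. (vderiv ^^ \<beta> b) (ift (v (inv (\<lambda>i. axis i 1) b))) (y \<bullet> b)) = 0)"
    by (intro exI[of _ 1] conjI exI[of _ "{()}"]) auto
qed

lemma exp_inner_eq_prod:
  fixes x \<xi> :: "real ^ 'm"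
  shows "exp (c * complex_of_real (x \<bullet> \<xi>)) = (\<Prod>i\<in>UNIV. exp (c * of_real (x $ i * \<xi> $ i)))"
  by (simp add: inner_vec_def exp_sum sum_distrib_left flip: of_real_mult)

context
  fixes v :: "'n::finite \<Rightarrow> real \<Rightarrow> complex"
  assumes v: "\<And>i. test_fun (v i)"
begin

interpretation tensor_sum "{()}" "\<lambda>_. 1" "\<lambda>_ (b :: real ^ 'n) m. (vderiv ^^ m) (ift (v (inv (\<lambda>i. axis i 1) b)))"
  by (rule tensor_ift_tensor_sum[OF v])

lemma tensor_ift_eq_TS: "tensor_ift v = TS (\<lambda>_. 0)"
  by (simp add: TS_def fun_eq_iff tensor_ift_def prod_Basis_cart inner_axis inv_f_f[OF inj_axis_1])

lemma smooth_tensor_ift: "smooth (tensor_ift v)"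
  unfolding tensor_ift_eq_TS by (rule smooth_TS)

lemma differentiable_tensor_ift: "tensor_ift v differentiable (at x)"
  unfolding tensor_ift_eq_TS by (rule TS_differentiable)

lemma partial_deriv_tensor_ift:
  "partial_deriv (axis i 1) (tensor_ift v) = tensor_ift (v(i := (\<lambda>u. \<i> * of_real u * v i u)))"
proof -
  have "partial_deriv (axis i 1) (tensor_ift v) = TS ((\<lambda>_. 0)(axis i 1 := 1))"
    unfolding tensor_ift_eq_TS by (subst partial_deriv_TS) (auto simp: Basis_cart)
  also have "\<dots> = tensor_ift (v(i := (\<lambda>u. \<i> * of_real u * v i u)))"
    by (auto simp: TS_def fun_eq_iff tensor_ift_def prod_Basis_cart inner_axis inv_f_f[OF inj_axis_1]
        axis_eq_axis vderiv_ift[OF v] intro!: prod.cong)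
  finally show ?thesis .
qed

lemma multi_deriv_tensor_ift:
  "multi_deriv \<alpha> (tensor_ift v) = (\<lambda>x. \<Prod>j\<in>UNIV. (vderiv ^^ (\<alpha> $ j)) (ift (v j)) (x $ j))"
  using multi_deriv_TS[OF tensor_ift_tensor_sum[OF v], of \<alpha>]
  by (simp add: inv_f_f[OF inj_axis_1] tensor_ift_def[abs_def])

lemma tensor_ift_schwartz: "tensor_ift v \<in> schwartz"
proof -
  have "bounded (range (\<lambda>x. multi_pow x \<alpha> *\<^sub>R multi_deriv \<beta> (tensor_ift v) x))" for \<alpha> \<beta>
  proof -
    have "\<exists>C. \<forall>x. \<bar>x\<bar> ^ (\<alpha> $ j) * norm ((vderiv ^^ (\<beta> $ j)) (ift (v j)) x) \<le> C" for j
      unfolding funpow_vderiv_ift[OF v] by (rule ift_power_bound[OF test_fun_ipow[OF v]])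
    then obtain C where C: "\<And>j x. \<bar>x\<bar> ^ (\<alpha> $ j) * norm ((vderiv ^^ (\<beta> $ j)) (ift (v j)) x) \<le> C j"
      by metis
    have "norm (multi_pow x \<alpha> *\<^sub>R multi_deriv \<beta> (tensor_ift v) x) \<le> (\<Prod>j\<in>UNIV. C j)" for x
    proof -
      have "norm (multi_pow x \<alpha> *\<^sub>R multi_deriv \<beta> (tensor_ift v) x) =
         (\<Prod>j\<in>UNIV. \<bar>x $ j\<bar> ^ (\<alpha> $ j) * norm ((vderiv ^^ (\<beta> $ j)) (ift (v j)) (x $ j)))"
        by (simp add: multi_deriv_tensor_ift multi_pow_def prod.distrib abs_prod power_abs flip: prod_norm)
      also have "\<dots> \<le> (\<Prod>j\<in>UNIV. C j)" by (intro prod_mono) (use C in auto)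
      finally show ?thesis .
    qed
    then show ?thesis by (auto simp: bounded_iff)
  qed
  then show ?thesis by (simp add: schwartz_def smooth_tensor_ift)
qed

lemma fourier_tensor_ift: "fourier (tensor_ift v) \<xi> = (\<Prod>i\<in>UNIV. 2 * pi * v i (\<xi> $ i))"
proof -
  have "fourier (tensor_ift v) \<xi> = (LINT x|lborel. (\<Prod>i\<in>UNIV. cis (- (x $ i * \<xi> $ i)) * ift (v i) (x $ i)))"
    unfolding fourier_def exp_inner_eq_prod tensor_ift_def prod.distrib by (simp add: cis_conv_exp)
  also have "\<dots> = (\<Prod>i\<in>UNIV. (LINT x|lborel. cis (- (x * \<xi> $ i)) * ift (v i) x))"
    by (intro integral_tensor(2) integrable_cis_mult integrable_ift v) auto
  finally show ?thesis by (simp add: fourier_inversion[OF v])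
qed

lemma tensor_ift_decay: "\<exists>C\<ge>0. \<forall>x. norm (tensor_ift v x) \<le> C / (1 + norm x) ^ K"
proof -
  have "\<exists>C\<ge>0. \<forall>x. norm (ift (v i) x) \<le> C / (1 + \<bar>x\<bar>) ^ K" for i by (rule ift_decay[OF v])
  then obtain C where C: "\<And>i. C i \<ge> 0" "\<And>i x. norm (ift (v i) x) \<le> C i / (1 + \<bar>x\<bar>) ^ K" by metis
  \<comment> \<open>Turns decay in each coordinate into decay in the norm.\<close>
  have prod_ge: "1 + (\<Sum>i\<in>A. \<bar>x $ i\<bar>) \<le> (\<Prod>i\<in>A. 1 + \<bar>x $ i\<bar>)" if "finite A" for x :: "real ^ 'n" and A
    using that
  proof (induction A rule: finite_induct)
    case (insert i A)
    have "1 + (\<Sum>i\<in>insert i A. \<bar>x $ i\<bar>) \<le> (1 + \<bar>x $ i\<bar>) * (1 + (\<Sum>i\<in>A. \<bar>x $ i\<bar>))"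
      using insert by (simp add: algebra_simps sum_nonneg)
    also have "\<dots> \<le> (1 + \<bar>x $ i\<bar>) * (\<Prod>i\<in>A. 1 + \<bar>x $ i\<bar>)"
      by (intro mult_left_mono insert.IH) auto
    finally show ?case using insert by simp
  qed simp
  have "norm (tensor_ift v x) \<le> (\<Prod>i\<in>UNIV. C i) / (1 + norm x) ^ K" for x
  proof -
    have "norm (tensor_ift v x) \<le> (\<Prod>i\<in>UNIV. C i / (1 + \<bar>x $ i\<bar>) ^ K)"
      unfolding tensor_ift_def prod_norm[symmetric] by (intro prod_mono) (use C in auto)
    also have "\<dots> = (\<Prod>i\<in>UNIV. C i) / (\<Prod>i\<in>UNIV. 1 + \<bar>x $ i\<bar>) ^ K"
      by (simp add: prod_dividef prod_power_distrib)
    also have "\<dots> \<le> (\<Prod>i\<in>UNIV. C i) / (1 + norm x) ^ K"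
    proof (intro divide_left_mono power_mono mult_pos_pos zero_less_power prod_nonneg prod_pos)
      show "1 + norm x \<le> (\<Prod>i\<in>UNIV. 1 + \<bar>x $ i\<bar>)"
        using norm_le_l1_cart[of x] prod_ge[of UNIV x, OF finite] by linarith
    qed (use C in \<open>auto simp: add_pos_nonneg\<close>)
    finally show ?thesis .
  qed
  then show ?thesis using C by (meson prod_nonneg)
qed

end

section \<open>Decay of Schwartz functions\<close>

text \<open>The pure powers of single coordinates are enough, because the largest coordinate is
  comparable to the norm.\<close>

lemma decay_if_bounded_multi_pow:
  fixes g :: "real ^ 'n \<Rightarrow> complex"
  assumes "\<And>\<alpha>. bounded (range (\<lambda>x. multi_pow x \<alpha> *\<^sub>R g x))"
  shows "\<exists>C\<ge>0. \<forall>x. norm (g x) \<le> C / (1 + norm x) ^ K"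
proof -
  have mp: "multi_pow x (\<chi> i. if i = j then K else 0) = (x $ j) ^ K" for x :: "real ^ 'n" and j
  proof -
    have "multi_pow x (\<chi> i. if i = j then K else 0) = (\<Prod>i\<in>UNIV. if i = j then (x $ j) ^ K else 1)"
      unfolding multi_pow_def by (intro prod.cong) auto
    then show ?thesis by simp
  qed
  have "\<exists>C. \<forall>x. \<bar>x $ j\<bar> ^ K * norm (g x) \<le> C" for j
    using assms[of "\<chi> i. if i = j then K else 0"]
    by (auto simp: bounded_iff mp power_abs abs_mult)
  then obtain C where C: "\<And>j x. \<bar>x $ j\<bar> ^ K * norm (g x) \<le> C j" by metis
  obtain C0 where C0: "\<And>x. norm (g x) \<le> C0"
    using assms[of "\<chi> i. 0"] by (auto simp: bounded_iff multi_pow_def)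
  let ?B = "real (CARD('n) + 1) ^ K * (C0 + (\<Sum>j\<in>UNIV. C j))"
  have *: "(1 + norm x) ^ K * norm (g x) \<le> ?B" for x
  proof -
    \<comment> \<open>The entry 1 gives M >= 1, which absorbs the 1 of 1 + |x|.\<close>
    define M where "M = Max (insert 1 (range (\<lambda>j. \<bar>x $ j\<bar>)))"
    have M: "1 \<le> M" "\<bar>x $ j\<bar> \<le> M" for j unfolding M_def by (intro Max_ge; simp)+
    have "M \<in> insert 1 (range (\<lambda>j. \<bar>x $ j\<bar>))" unfolding M_def by (rule Max_in) auto
    then have MK: "M ^ K \<le> 1 + (\<Sum>j\<in>UNIV. \<bar>x $ j\<bar> ^ K)"
    proof
      assume "M \<in> range (\<lambda>j. \<bar>x $ j\<bar>)"
      then obtain j where "M = \<bar>x $ j\<bar>" by auto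
      then show ?thesis using member_le_sum[of j UNIV "\<lambda>j. \<bar>x $ j\<bar> ^ K"] by simp
    qed (auto intro: sum_nonneg)
    have "norm x \<le> (\<Sum>j\<in>UNIV. \<bar>x $ j\<bar>)" by (rule norm_le_l1_cart)
    also have "\<dots> \<le> (\<Sum>j\<in>(UNIV::'n set). M)" by (intro sum_mono M)
    finally have "1 + norm x \<le> real (CARD('n) + 1) * M" using M(1) by (simp add: algebra_simps)
    then have "(1 + norm x) ^ K \<le> (real (CARD('n) + 1) * M) ^ K" by (intro power_mono) auto
    also have "\<dots> \<le> real (CARD('n) + 1) ^ K * (1 + (\<Sum>j\<in>UNIV. \<bar>x $ j\<bar> ^ K))"
      unfolding power_mult_distrib by (intro mult_left_mono MK) auto
    finally have "(1 + norm x) ^ K * norm (g x) \<le> real (CARD('n) + 1) ^ K * (1 + (\<Sum>j\<in>UNIV. \<bar>x $ j\<bar> ^ K)) * norm (g x)"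
      by (rule mult_right_mono) auto
    also have "\<dots> = real (CARD('n) + 1) ^ K * (norm (g x) + (\<Sum>j\<in>UNIV. \<bar>x $ j\<bar> ^ K * norm (g x)))"
      by (simp add: algebra_simps sum_distrib_left sum_distrib_right)
    also have "\<dots> \<le> ?B" by (intro mult_left_mono add_mono sum_mono C C0) auto
    finally show ?thesis .
  qed
  show ?thesis
  proof (intro exI conjI allI)
    show "0 \<le> ?B" using *[of 0] by (rule order.trans[rotated]) auto
    fix x :: "real ^ 'n"
    have "(1 + norm x) ^ K > 0" by (intro zero_less_power add_pos_nonneg) auto
    then show "norm (g x) \<le> ?B / (1 + norm x) ^ K" using *[of x] by (simp add: field_simps)
  qed
qed

lemma multi_deriv_single:
  "multi_deriv (\<chi> i. if i = j then k else 0) f = (partial_deriv (axis j 1) ^^ k) f"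
proof -
  have 0: "foldr (\<lambda>i. partial_deriv (axis i 1) ^^ (if i = j then k else 0)) xs g = g"
    if "j \<notin> set xs" for xs g using that by (induction xs) auto
  have "foldr (\<lambda>i. partial_deriv (axis i 1) ^^ (if i = j then k else 0)) xs f = (partial_deriv (axis j 1) ^^ k) f"
    if "distinct xs" "j \<in> set xs" for xs
    using that by (induction xs) (auto simp: 0)
  from this[OF coords(1)] show ?thesis by (simp add: multi_deriv_def coords(2))
qed

lemma schwartz_partial_deriv_decay:
  assumes "f \<in> schwartz"
  shows "\<exists>C\<ge>0. \<forall>x. norm ((partial_deriv (axis j 1) ^^ k) f x) \<le> C / (1 + norm x) ^ K"
proof (rule decay_if_bounded_multi_pow)
  show "bounded (range (\<lambda>x. multi_pow x \<alpha> *\<^sub>R (partial_deriv (axis j 1) ^^ k) f x))" for \<alpha>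
    using assms unfolding schwartz_def multi_deriv_single[symmetric] by blast
qed

lemma schwartz_partial_deriv_differentiable:
  assumes "f \<in> schwartz"
  shows "(partial_deriv (axis j 1) ^^ k) f differentiable (at x)"
proof -
  have "foldr partial_deriv (replicate k (axis j 1)) f differentiable (at x)"
    using assms unfolding schwartz_def smooth_def mem_Collect_eq
    by (elim conjE, elim allE[of _ "replicate k (axis j 1)"] impE) (auto simp: Basis_cart)
  also have "foldr partial_deriv (replicate k (axis j 1)) f = (partial_deriv (axis j 1) ^^ k) f"
    by (induction k) auto
  finally show ?thesis .
qed

lemma differentiable_imp_continuous_on_UNIV:
  "(\<And>x. f differentiable (at x)) \<Longrightarrow> continuous_on UNIV f"
  by (simp add: continuous_at_imp_continuous_on differentiable_imp_continuous_within)

lemma schwartz_continuous: "f \<in> schwartz \<Longrightarrow> continuous_on UNIV f"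
  using schwartz_partial_deriv_differentiable[of f, where k = 0]
  by (auto intro: differentiable_imp_continuous_on_UNIV)

text \<open>Pairing with an integrable function is continuous already for the supremum norm, that
  is, for the Schwartz seminorm with both multi-indices 0.\<close>

lemma distr_of_tempered:
  fixes f :: "real ^ 'n \<Rightarrow> complex"
  assumes f: "integrable lborel f"
  shows "distr_of f \<in> tempered"
proof -
  have int: "integrable lborel (\<lambda>y. f y * \<psi> y)" if "\<psi> \<in> schwartz" for \<psi>
  proof -
    obtain C where C: "C \<ge> 0" "\<And>x. norm (\<psi> x) \<le> C"
      using schwartz_partial_deriv_decay[of \<psi>, where k = 0 and K = 0] \<open>\<psi> \<in> schwartz\<close> by auto
    have [measurable]: "\<psi> \<in> borel_measurable borel" "f \<in> borel_measurable borel"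
      using schwartz_continuous[OF that] f by (auto intro: borel_measurable_continuous_onI simp: borel_measurable_integrable)
    show ?thesis
    proof (rule Bochner_Integration.integrable_bound)
      show "integrable lborel (\<lambda>y. C * norm (f y))" using f by simp
      show "AE y in lborel. norm (f y * \<psi> y) \<le> norm (C * norm (f y))"
        using C by (intro AE_I2) (auto simp: norm_mult abs_mult mult.commute intro: mult_right_mono)
    qed measurable
  qed
  have "(\<lambda>k. distr_of f (\<psi> k)) \<longlonglongrightarrow> 0"
    if s: "\<And>k::nat. \<psi> k \<in> schwartz" and
       u: "\<And>\<alpha> \<beta>. uniform_limit UNIV (\<lambda>k x. multi_pow x \<alpha> *\<^sub>R multi_deriv \<beta> (\<psi> k) x) (\<lambda>x. 0) sequentially" for \<psi>
  proof -
    have "multi_pow x (\<chi> i. 0) = 1" for x :: "real ^ 'n" by (simp add: multi_pow_def)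
    moreover have "multi_deriv (\<chi> i. 0) g = g" for g :: "real ^ 'n \<Rightarrow> complex"
      using multi_deriv_single[of undefined 0 g] by simp
    ultimately have ul: "uniform_limit UNIV \<psi> (\<lambda>x. 0) sequentially"
      using u[of "\<chi> i. 0" "\<chi> i. 0"] by simp
    show ?thesis
    proof (rule tendsto_norm_zero_cancel, rule LIMSEQ_I)
      fix r :: real assume r: "r > 0"
      define I where "I = (LINT y|lborel. norm (f y))"
      have I: "I \<ge> 0" by (simp add: I_def)
      have "\<forall>\<^sub>F k in sequentially. \<forall>x\<in>UNIV. dist (\<psi> k x) 0 < r / (I + 1)"
        using ul r I by (auto simp: uniform_limit_iff)
      then obtain k0 where k0: "\<And>k x. k \<ge> k0 \<Longrightarrow> norm (\<psi> k x) < r / (I + 1)"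
        by (auto simp: eventually_sequentially)
      have "norm (distr_of f (\<psi> k)) < r" if "k \<ge> k0" for k
      proof -
        have "norm (distr_of f (\<psi> k)) \<le> (LINT y|lborel. norm (f y * \<psi> k y))"
          unfolding distr_of_def by (rule integral_norm_bound)
        also have "\<dots> \<le> (LINT y|lborel. norm (f y) * (r / (I + 1)))"
        proof (rule integral_mono)
          show "integrable lborel (\<lambda>y. norm (f y * \<psi> k y))" using int[OF s] by (rule integrable_norm)
          show "integrable lborel (\<lambda>y. norm (f y) * (r / (I + 1)))" using f by simp
          show "norm (f y * \<psi> k y) \<le> norm (f y) * (r / (I + 1))" for y
            unfolding norm_mult by (intro mult_left_mono less_imp_le[OF k0] that) auto
        qed
        also have "\<dots> = I * r / (I + 1)" by (simp add: I_def)
        also have "\<dots> < r" using I r by (simp add: field_simps)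
        finally show ?thesis .
      qed
      then show "\<exists>no. \<forall>n\<ge>no. norm (norm (distr_of f (\<psi> n)) - 0) < r" by auto
    qed
  qed
  moreover have "distr_of f (\<lambda>x. a * \<psi>1 x + b * \<psi>2 x) = a * distr_of f \<psi>1 + b * distr_of f \<psi>2"
    if "\<psi>1 \<in> schwartz" "\<psi>2 \<in> schwartz" for \<psi>1 \<psi>2 a b
  proof -
    have "distr_of f (\<lambda>x. a * \<psi>1 x + b * \<psi>2 x) = (LINT y|lborel. a * (f y * \<psi>1 y) + b * (f y * \<psi>2 y))"
      unfolding distr_of_def by (intro Bochner_Integration.integral_cong) (auto simp: algebra_simps)
    also have "\<dots> = a * distr_of f \<psi>1 + b * distr_of f \<psi>2"
      unfolding distr_of_def using int[OF that(1)] int[OF that(2)] by simp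
    finally show ?thesis .
  qed
  ultimately show ?thesis unfolding tempered_def by blast
qed

section \<open>Weighted convolution estimates and the maximal function\<close>

lemma one_plus_norm_neq_0 [simp]: "1 + norm (x :: 'a::real_normed_vector) \<noteq> 0"
  using norm_ge_zero[of x] by linarith

lemma one_plus_le_mult: "a \<le> b + c \<Longrightarrow> 0 \<le> b \<Longrightarrow> 0 \<le> c \<Longrightarrow> 1 + a \<le> (1 + b) * (1 + (c::real))"
proof -
  assume "a \<le> b + c" "0 \<le> b" "0 \<le> c"
  moreover have "(1 + b) * (1 + c) = 1 + (b + c) + b * c" by (simp add: algebra_simps)
  ultimately show ?thesis using mult_nonneg_nonneg[of b c] by linarith
qed

text \<open>The exponent 2n makes the weight at most the product of the one-dimensional weights
  1/(1+|x_i|)^2, hence integrable.\<close>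

definition weight :: "real ^ 'n \<Rightarrow> real" where
  "weight y = 1 / (1 + norm y) ^ (2 * CARD('n))"

lemma one_plus_norm_pos [simp]: "1 + norm (x :: 'a::real_normed_vector) > 0"
  by (simp add: add_pos_nonneg)

lemma weight_pos: "weight y > 0"
  by (simp add: weight_def)

lemma continuous_weight: "continuous_on S weight"
  unfolding weight_def[abs_def]
  by (intro continuous_intros) (simp add: less_imp_neq[symmetric])

lemma integrable_weight: "integrable lborel (weight :: real ^ 'n \<Rightarrow> real)"
proof (rule Bochner_Integration.integrable_bound)
  have "integrable lborel (\<lambda>x::real ^ 'n. \<Prod>i\<in>UNIV. complex_of_real (1 / (1 + \<bar>x $ i\<bar>) ^ 2))"
    by (rule integral_tensor(1)[of "\<lambda>i x. complex_of_real (1 / (1 + \<bar>x\<bar>) ^ 2)"])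
       (intro integrable_of_real integrable_inverse_square)
  then show "integrable lborel (\<lambda>x::real ^ 'n. norm (\<Prod>i\<in>UNIV. complex_of_real (1 / (1 + \<bar>x $ i\<bar>) ^ 2)))"
    by (rule integrable_norm)
  show "weight \<in> borel_measurable lborel"
    using borel_measurable_continuous_onI[OF continuous_weight[of UNIV]] by simp
  have "norm (weight x) \<le> (\<Prod>i\<in>UNIV. 1 / (1 + \<bar>x $ i\<bar>) ^ 2)" for x :: "real ^ 'n"
  proof -
    have "norm (weight x) = (\<Prod>i\<in>(UNIV::'n set). 1 / (1 + norm x) ^ 2)"
      by (simp add: weight_def power_mult power_one_over)
    also have "\<dots> \<le> (\<Prod>i\<in>UNIV. 1 / (1 + \<bar>x $ i\<bar>) ^ 2)"
      by (intro prod_mono conjI divide_left_mono power_mono)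
         (auto simp: component_le_norm_cart add_pos_nonneg intro!: mult_pos_pos)
    finally show ?thesis .
  qed
  then show "AE x::real ^ 'n in lborel. norm (weight x) \<le> norm (norm (\<Prod>i\<in>UNIV. complex_of_real (1 / (1 + \<bar>x $ i\<bar>) ^ 2)))"
    by (intro AE_I2) (simp only: prod_norm[symmetric] norm_of_real, simp add: abs_prod)
qed

text \<open>The type argument carries the dimension, on which this constant depends.\<close>

definition weight_integral :: "'n::finite itself \<Rightarrow> real" where
  "weight_integral _ = (LINT y|lborel. weight (y :: real ^ 'n))"

lemma weight_integral_pos: "weight_integral TYPE('n::finite) > 0"
proof -
  have "(LINT y|lborel. weight (y :: real ^ 'n)) \<noteq> 0"
  proof
    assume "(LINT y|lborel. weight (y :: real ^ 'n)) = 0"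
    then have "AE y :: real ^ 'n in lborel. weight y = 0"
      by (subst (asm) integral_nonneg_eq_0_iff_AE[OF integrable_weight])
         (auto simp: weight_pos less_imp_le)
    then have "AE y :: real ^ 'n in lborel. False"
      by (rule eventually_mono) (metis weight_pos less_irrefl)
    then show False by (simp add: eventually_False ae_filter_eq_bot_iff)
  qed
  moreover have "(LINT y|lborel. weight (y :: real ^ 'n)) \<ge> 0"
    by (intro integral_nonneg_AE) (auto simp: weight_pos less_imp_le)
  ultimately show ?thesis unfolding weight_integral_def by simp
qed

text \<open>A non-integrable \<open>h\<close> has integral 0 by convention, and \<open>g\<close> is
  nonnegative because it dominates a norm.\<close>

lemma norm_integral_le:
  fixes h :: "'a \<Rightarrow> 'b::{banach, second_countable_topology}" and g :: "'a \<Rightarrow> real"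
  assumes "integrable M g" "\<And>x. norm (h x) \<le> g x"
  shows "norm (integral\<^sup>L M h) \<le> integral\<^sup>L M g"
proof (cases "integrable M h")
  case True
  then have "(LINT x|M. norm (h x)) \<le> integral\<^sup>L M g"
    by (intro integral_mono assms integrable_norm)
  then show ?thesis using integral_norm_bound[of M h] by linarith
next
  case False
  have "0 \<le> g x" for x using assms(2)[of x] norm_ge_zero order.trans by blast
  then show ?thesis using False by (simp add: not_integrable_integral_eq)
qed

text \<open>For t <= 1 one has |x| <= |y| + |x-y|/t, so 1+|x| is at most a product of the two
  weights and the decay of both factors passes to x. The surplus decay of \<phi> is integrated and
  yields t^n.\<close>

lemma weight_convolution_small:
  fixes f \<phi> :: "real ^ 'n \<Rightarrow> complex"
  assumes t: "0 < t" "t \<le> 1"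
    and f: "\<And>y. norm (f y) \<le> A / (1 + norm y) ^ L"
    and \<phi>: "\<And>z. norm (\<phi> z) \<le> B / (1 + norm z) ^ (L + 2 * CARD('n))"
  shows "norm (LINT y|lborel. f y * \<phi> ((x - y) /\<^sub>R t)) \<le>
      A * B * weight_integral TYPE('n) * t ^ CARD('n) / (1 + norm x) ^ L"
proof -
  have A: "A \<ge> 0" using order.trans[OF norm_ge_zero f[of 0]] by simp
  have B: "B \<ge> 0" using order.trans[OF norm_ge_zero \<phi>[of 0]] by simp
  have eq: "(x - y) /\<^sub>R t = x /\<^sub>R t + (- inverse t) *\<^sub>R y" for y
    by (simp add: scaleR_right_diff_distrib)
  have t0: "- inverse t \<noteq> 0" using t by simp
  note w = integral_euclidean_affine[OF integrable_weight t0, of "x /\<^sub>R t"]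
  have "norm (LINT y|lborel. f y * \<phi> ((x - y) /\<^sub>R t)) \<le>
     (LINT y|lborel. A * B / (1 + norm x) ^ L * weight (x /\<^sub>R t + (- inverse t) *\<^sub>R y))"
  proof (rule norm_integral_le)
    show "integrable lborel (\<lambda>y. A * B / (1 + norm x) ^ L * weight (x /\<^sub>R t + (- inverse t) *\<^sub>R y))"
      by (rule integrable_mult_right[OF w(1)])
    fix y
    let ?z = "(x - y) /\<^sub>R t"
    have "norm ?z = norm (x - y) / t" using t by (simp add: divide_inverse mult.commute)
    moreover have "norm (x - y) \<le> norm (x - y) / t" using t by (simp add: le_divide_eq mult_left_le)
    ultimately have "norm (x - y) \<le> norm ?z" by simp
    then have "norm x \<le> norm y + norm ?z" using norm_triangle_ineq[of y "x - y"] by simp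
    then have "1 + norm x \<le> (1 + norm y) * (1 + norm ?z)"
      by (rule one_plus_le_mult) auto
    then have le: "(1 + norm x) ^ L \<le> (1 + norm y) ^ L * (1 + norm ?z) ^ L"
      unfolding power_mult_distrib[symmetric] by (intro power_mono) auto
    have "norm (f y * \<phi> ?z) \<le> (A / (1 + norm y) ^ L) * (B / (1 + norm ?z) ^ (L + 2 * CARD('n)))"
      unfolding norm_mult using A by (intro mult_mono f \<phi>) auto
    also have "\<dots> = A * B / ((1 + norm y) ^ L * (1 + norm ?z) ^ L) * weight ?z"
      by (simp add: weight_def power_add)
    also have "\<dots> \<le> A * B / (1 + norm x) ^ L * weight ?z"
      using le A B by (intro mult_right_mono divide_left_mono mult_pos_pos zero_less_power)
        (auto simp: weight_pos less_imp_le simp del: norm_scaleR)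
    finally show "norm (f y * \<phi> ?z) \<le> A * B / (1 + norm x) ^ L * weight (x /\<^sub>R t + (- inverse t) *\<^sub>R y)"
      by (simp only: eq)
  qed
  also have "\<dots> = A * B * weight_integral TYPE('n) * t ^ CARD('n) / (1 + norm x) ^ L"
    using t w(2) by (simp add: weight_integral_def power_inverse field_simps)
  finally show ?thesis .
qed

text \<open>For t >= 1 the same splitting works only for |x|/t, so the decay sets in at distance t.
  The surplus decay now sits on \<open>f\<close>, and no power of t is gained: this is what
  cancellation must repair.\<close>

lemma weight_convolution_large:
  fixes f \<phi> :: "real ^ 'n \<Rightarrow> complex"
  assumes t: "1 \<le> t"
    and f: "\<And>y. norm (f y) \<le> A / (1 + norm y) ^ (L + 2 * CARD('n))"
    and \<phi>: "\<And>z. norm (\<phi> z) \<le> B / (1 + norm z) ^ L"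
  shows "norm (LINT y|lborel. f y * \<phi> ((x - y) /\<^sub>R t)) \<le>
      A * B * weight_integral TYPE('n) / (1 + norm x / t) ^ L"
proof -
  have A: "A \<ge> 0" using order.trans[OF norm_ge_zero f[of 0]] by simp
  have B: "B \<ge> 0" using order.trans[OF norm_ge_zero \<phi>[of 0]] by simp
  have xt: "1 + norm x / t > 0" using t by (intro add_pos_nonneg) auto
  have "norm (LINT y|lborel. f y * \<phi> ((x - y) /\<^sub>R t)) \<le>
     (LINT y|lborel. A * B / (1 + norm x / t) ^ L * weight (y :: real ^ 'n))"
  proof (rule norm_integral_le)
    show "integrable lborel (\<lambda>y. A * B / (1 + norm x / t) ^ L * weight (y :: real ^ 'n))"
      by (rule integrable_mult_right[OF integrable_weight])
    fix y
    let ?z = "(x - y) /\<^sub>R t"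
    have "norm x \<le> norm y + norm (x - y)" using norm_triangle_ineq[of y "x - y"] by simp
    then have "norm x / t \<le> (norm y + norm (x - y)) / t" using t by (intro divide_right_mono) auto
    also have "\<dots> = norm y / t + norm ?z" using t by (simp add: divide_inverse algebra_simps flip: scaleR_right_diff_distrib)
    also have "norm y / t \<le> norm y" using t by (simp add: divide_le_eq mult_le_cancel_left1)
    finally have "1 + norm x / t \<le> (1 + norm y) * (1 + norm ?z)"
      by (rule one_plus_le_mult) auto
    then have le: "(1 + norm x / t) ^ L \<le> (1 + norm y) ^ L * (1 + norm ?z) ^ L"
      unfolding power_mult_distrib[symmetric] using xt by (intro power_mono) auto
    have "norm (f y * \<phi> ?z) \<le> (A / (1 + norm y) ^ (L + 2 * CARD('n))) * (B / (1 + norm ?z) ^ L)"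
      unfolding norm_mult using A by (intro mult_mono f \<phi>) auto
    also have "\<dots> = A * B / ((1 + norm y) ^ L * (1 + norm ?z) ^ L) * weight y"
      by (simp add: weight_def power_add)
    also have "\<dots> \<le> A * B / (1 + norm x / t) ^ L * weight y"
      using le A B xt by (intro mult_right_mono divide_left_mono mult_pos_pos zero_less_power)
        (auto simp: weight_pos less_imp_le simp del: norm_scaleR)
    finally show "norm (f y * \<phi> ?z) \<le> A * B / (1 + norm x / t) ^ L * weight y" .
  qed
  also have "\<dots> = A * B * weight_integral TYPE('n) / (1 + norm x / t) ^ L"
    by (simp add: weight_integral_def)
  finally show ?thesis .
qed

lemma integrable_decay:
  fixes f :: "real ^ 'n \<Rightarrow> complex"
  assumes "continuous_on UNIV f" "\<And>y. norm (f y) \<le> A / (1 + norm y) ^ (L + 2 * CARD('n))"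
  shows "integrable lborel f"
proof (rule Bochner_Integration.integrable_bound)
  have A: "A \<ge> 0" using order.trans[OF norm_ge_zero assms(2)[of 0]] by simp
  show "integrable lborel (\<lambda>y::real ^ 'n. A * weight y)" by (intro integrable_mult_right integrable_weight)
  show "f \<in> borel_measurable lborel" using borel_measurable_continuous_onI[OF assms(1)] by simp
  have "norm (f y) \<le> A * weight y" for y
  proof (rule order.trans[OF assms(2)])
    have "(1 + norm y) ^ (2 * CARD('n)) \<le> (1 + norm y) ^ (L + 2 * CARD('n))"
      by (rule power_increasing) auto
    then show "A / (1 + norm y) ^ (L + 2 * CARD('n)) \<le> A * weight y"
      using A unfolding weight_def by (auto intro!: divide_left_mono mult_pos_pos)
  qed
  then show "AE y in lborel. norm (f y) \<le> norm (A * weight y)"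
    using A by (intro AE_I2) (simp add: weight_pos less_imp_le)
qed

text \<open>The integral of the derivative of y |-> g(y) \<psi>((x-y)/t) in direction
  \<open>b\<close> vanishes; the chain rule produces the factor -1/t.\<close>

lemma integration_by_parts:
  fixes g g' \<psi> :: "real ^ 'n \<Rightarrow> complex"
  assumes t: "t > 0"
    and g: "\<And>x. g differentiable (at x)" and g': "partial_deriv b g = g'"
    and \<psi>: "\<And>x. \<psi> differentiable (at x)"
    and int: "integrable lborel g" "integrable lborel g'"
    and cont: "continuous_on UNIV g'" "continuous_on UNIV (partial_deriv b \<psi>)"
    and bd: "\<And>z. norm (\<psi> z) \<le> B" "\<And>z. norm (partial_deriv b \<psi> z) \<le> B"
  shows "(LINT y|lborel. g' y * \<psi> ((x - y) /\<^sub>R t)) =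
     (LINT y|lborel. g y * partial_deriv b \<psi> ((x - y) /\<^sub>R t)) /\<^sub>R t"
proof -
  have c\<psi>: "continuous_on UNIV \<psi>" and cg: "continuous_on UNIV g"
    using \<psi> g by (auto intro: differentiable_imp_continuous_on_UNIV)
  have comp: "continuous_on UNIV (\<lambda>y. h ((x - y) /\<^sub>R t))" if "continuous_on UNIV h" for h :: "real ^ 'n \<Rightarrow> complex"
    by (rule continuous_on_compose2[OF that]) (use t in \<open>auto intro!: continuous_intros\<close>)
  have B: "B \<ge> 0" using bd(1)[of 0] norm_ge_zero order.trans by blast
  have prod_int: "integrable lborel (\<lambda>y. h y * k ((x - y) /\<^sub>R t))"
    if h: "integrable lborel h" and k: "continuous_on UNIV k" "\<And>z. norm (k z) \<le> B" for h k :: "real ^ 'n \<Rightarrow> complex"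
  proof (rule Bochner_Integration.integrable_bound)
    show "integrable lborel (\<lambda>y. B * norm (h y))" using h by simp
    have [measurable]: "(\<lambda>y. k ((x - y) /\<^sub>R t)) \<in> borel_measurable borel" "h \<in> borel_measurable borel"
      using comp[OF k(1)] h by (auto intro: borel_measurable_continuous_onI simp: borel_measurable_integrable)
    show "(\<lambda>y. h y * k ((x - y) /\<^sub>R t)) \<in> borel_measurable lborel" by measurable
    show "AE y in lborel. norm (h y * k ((x - y) /\<^sub>R t)) \<le> norm (B * norm (h y))"
      using B k(2) by (intro AE_I2) (simp add: norm_mult abs_mult mult.commute[of B] mult_left_mono)
  qed
  let ?F = "\<lambda>y. g y * \<psi> ((x - y) /\<^sub>R t)"
  let ?F' = "\<lambda>y. g' y * \<psi> ((x - y) /\<^sub>R t) - inverse t *\<^sub>R (g y * partial_deriv b \<psi> ((x - y) /\<^sub>R t))"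
  have "(LINT y|lborel. ?F' y) = 0"
  proof (rule integral_directional_derivative_eq_0[where f = ?F and b = b])
    show "integrable lborel ?F" by (rule prod_int[OF int(1) c\<psi> bd(1)])
    show "integrable lborel ?F'"
      by (intro Bochner_Integration.integrable_diff integrable_scaleR_right prod_int int c\<psi> cont bd)
    show "continuous_on UNIV ?F'"
      by (intro continuous_intros comp cg c\<psi> cont)
    fix y s
    have 1: "((\<lambda>s. g (y + s *\<^sub>R b)) has_vector_derivative g' (y + s *\<^sub>R b)) (at s)"
      using directional_derivative[of g y b s] g by (simp add: g')
    have "((\<lambda>s. - s / t) has_vector_derivative (- inverse t)) (at s)"
      using t by (auto intro!: derivative_eq_intros simp: has_vector_derivative_def field_simps)
    from vector_diff_chain_at[OF this directional_derivative[OF \<psi>, of "(x - y) /\<^sub>R t" b "- s / t"]]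
    have "((\<lambda>s. \<psi> ((x - (y + s *\<^sub>R b)) /\<^sub>R t)) has_vector_derivative
        - inverse t *\<^sub>R partial_deriv b \<psi> ((x - (y + s *\<^sub>R b)) /\<^sub>R t)) (at s)"
      by (simp add: o_def algebra_simps divide_inverse)
    from has_vector_derivative_mult[OF 1 this]
    show "((\<lambda>s. ?F (y + s *\<^sub>R b)) has_vector_derivative ?F' (y + s *\<^sub>R b)) (at s)"
      by (simp add: algebra_simps)
  qed
  also have "(LINT y|lborel. ?F' y) = (LINT y|lborel. g' y * \<psi> ((x - y) /\<^sub>R t)) -
      inverse t *\<^sub>R (LINT y|lborel. g y * partial_deriv b \<psi> ((x - y) /\<^sub>R t))"
    by (subst Bochner_Integration.integral_diff)
       (intro prod_int integrable_scaleR_right int c\<psi> cont bd | simp)+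
  finally show ?thesis by simp
qed

text \<open>The functions \<open>G 1, \<dots>, G K\<close> are iterated antiderivatives of \<open>G 0\<close> in direction \<open>i\<close>.  For \<open>t \<le> 1\<close>
  the decay of \<open>G 0\<close> suffices; for \<open>t > 1\<close>, integration by parts moves \<open>K\<close> derivatives
  to \<open>\<phi>\<close> and gains \<open>t\<^bsup>-K\<^esup>\<close>.\<close>

lemma maximal_bound:
  fixes \<phi> :: "real ^ 'n \<Rightarrow> complex"
  assumes \<phi>: "\<phi> \<in> schwartz" and LK: "L \<le> CARD('n) + K"
  shows "\<exists>C>0. \<forall>G A t x. (\<forall>j\<le>K. continuous_on UNIV (G j)) \<longrightarrow>
      (\<forall>j\<le>K. \<forall>y. norm (G j y) \<le> A / (1 + norm y) ^ (L + 2 * CARD('n))) \<longrightarrow>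
      (\<forall>j<K. (\<forall>x. G (Suc j) differentiable (at x)) \<and> partial_deriv (axis i 1) (G (Suc j)) = G j) \<longrightarrow>
      t > 0 \<longrightarrow> norm (conv (dilate t \<phi>) (distr_of (G 0)) x) \<le> C * A / (1 + norm x) ^ L"
proof -
  let ?\<phi> = "\<lambda>j. (partial_deriv (axis i 1) ^^ j) \<phi>"
  obtain B1 where B1: "B1 \<ge> 0" "\<And>z. norm (\<phi> z) \<le> B1 / (1 + norm z) ^ (L + 2 * CARD('n))"
    using schwartz_partial_deriv_decay[OF \<phi>, where k = 0 and K = "L + 2 * CARD('n)"] by auto
  obtain B2 where B2: "B2 \<ge> 0" "\<And>z. norm (?\<phi> K z) \<le> B2 / (1 + norm z) ^ L"
    using schwartz_partial_deriv_decay[OF \<phi>, where k = K and K = L] by blast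
  have "\<exists>B. \<forall>z. norm (?\<phi> j z) \<le> B" for j
    using schwartz_partial_deriv_decay[OF \<phi>, where k = j and K = 0] by auto
  then obtain B where B: "\<And>j z. norm (?\<phi> j z) \<le> B j" by metis
  define W where "W = weight_integral TYPE('n)"
  have W: "W > 0" unfolding W_def by (rule weight_integral_pos)
  \<comment> \<open>The summand 1 keeps the constant positive even if both decay constants
    vanish.\<close>
  have "norm (conv (dilate t \<phi>) (distr_of (G 0)) x) \<le> ((B1 + B2) * W + 1) * A / (1 + norm x) ^ L"
    if c: "\<forall>j\<le>K. continuous_on UNIV (G j)"
      and A: "\<forall>j\<le>K. \<forall>y. norm (G j y) \<le> A / (1 + norm y) ^ (L + 2 * CARD('n))"
      and d: "\<forall>j<K. (\<forall>x. G (Suc j) differentiable (at x)) \<and> partial_deriv (axis i 1) (G (Suc j)) = G j"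
      and t: "t > 0" for G A t x
  proof -
    have A0: "A \<ge> 0" using order.trans[OF norm_ge_zero, of "G 0 0"] A by force
    have conv: "conv (dilate t \<phi>) (distr_of (G 0)) x = (LINT y|lborel. G 0 y * \<phi> ((x - y) /\<^sub>R t)) /\<^sub>R t ^ CARD('n)"
      by (simp add: conv_def distr_of_def dilate_def)
    have "norm (LINT y|lborel. G 0 y * \<phi> ((x - y) /\<^sub>R t)) \<le> (B1 + B2) * W * A * t ^ CARD('n) / (1 + norm x) ^ L"
    proof (cases "t \<le> 1")
      case True
      have "norm (LINT y|lborel. G 0 y * \<phi> ((x - y) /\<^sub>R t)) \<le>
        A * B1 * weight_integral TYPE('n) * t ^ CARD('n) / (1 + norm x) ^ L"
      proof (rule weight_convolution_small[OF t True _ B1(2)])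
        fix y
        have "norm (G 0 y) \<le> A / (1 + norm y) ^ (L + 2 * CARD('n))" using A by blast
        also have "\<dots> \<le> A / (1 + norm y) ^ L"
          using A0 by (intro divide_left_mono power_increasing mult_pos_pos zero_less_power) auto
        finally show "norm (G 0 y) \<le> A / (1 + norm y) ^ L" .
      qed
      also have "\<dots> \<le> (B1 + B2) * W * A * t ^ CARD('n) / (1 + norm x) ^ L"
        unfolding W_def[symmetric]
        using A0 B1(1) B2(1) W t by (intro divide_right_mono) (auto simp: algebra_simps)
      finally show ?thesis .
    next
      case False
      have ibp: "(LINT y|lborel. G 0 y * \<phi> ((x - y) /\<^sub>R t)) =
        (LINT y|lborel. G j y * ?\<phi> j ((x - y) /\<^sub>R t)) /\<^sub>R t ^ j" if "j \<le> K" for j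
        using that
      proof (induction j)
        case (Suc j)
        have "(LINT y|lborel. G j y * ?\<phi> j ((x - y) /\<^sub>R t)) =
          (LINT y|lborel. G (Suc j) y * partial_deriv (axis i 1) (?\<phi> j) ((x - y) /\<^sub>R t)) /\<^sub>R t"
        proof (rule integration_by_parts[OF t, where B = "max (B j) (B (Suc j))"])
          show "continuous_on UNIV (partial_deriv (axis i 1) (?\<phi> j))"
            using schwartz_partial_deriv_differentiable[OF \<phi>, where k = "Suc j" and j = i]
            by (intro differentiable_imp_continuous_on_UNIV) simp
          show "?\<phi> j differentiable (at x)" for x by (rule schwartz_partial_deriv_differentiable[OF \<phi>])
          show "norm (?\<phi> j z) \<le> max (B j) (B (Suc j))" for z using B[of j z] by simp
          show "norm (partial_deriv (axis i 1) (?\<phi> j) z) \<le> max (B j) (B (Suc j))" for z using B[of "Suc j" z] by simp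
          show "integrable lborel (G (Suc j))" "integrable lborel (G j)"
            using c A Suc.prems by (auto intro!: integrable_decay[of _ A L])
        qed (use d c Suc.prems in auto)
        then show ?case using Suc by (simp add: divideR_right)
      qed simp
      have "norm (LINT y|lborel. G 0 y * \<phi> ((x - y) /\<^sub>R t)) = norm (LINT y|lborel. G K y * ?\<phi> K ((x - y) /\<^sub>R t)) / t ^ K"
        unfolding ibp[OF order.refl] using t by (simp add: divide_inverse mult.commute)
      also have "\<dots> \<le> (A * B2 * W / (1 + norm x / t) ^ L) / t ^ K"
        unfolding W_def using A False t
        by (intro divide_right_mono weight_convolution_large[OF _ _ B2(2)]) auto
      \<comment> \<open>By L <= n + K the gain t^(-K) is at most t^n t^(-L). The t^(-L) merges with
        (1+|x|/t)^(-L) into (t+|x|)^(-L), which is at most (1+|x|)^(-L).\<close>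
      also have "\<dots> \<le> (A * B2 * W / (1 + norm x / t) ^ L) * (t ^ CARD('n) / t ^ L)"
      proof -
        have "t ^ L \<le> t ^ (CARD('n) + K)" using LK False by (intro power_increasing) auto
        then have "1 / t ^ K \<le> t ^ CARD('n) / t ^ L" using t by (simp add: field_simps power_add)
        moreover have "0 \<le> A * B2 * W / (1 + norm x / t) ^ L" using A0 B2 W t by simp
        ultimately show ?thesis using mult_left_mono by fastforce
      qed
      also have "\<dots> = A * B2 * W * t ^ CARD('n) / (t + norm x) ^ L"
      proof -
        have "(1 + norm x / t) ^ L * t ^ L = (t + norm x) ^ L"
          using t by (simp add: power_mult_distrib[symmetric] field_simps)
        then show ?thesis by simp
      qed
      also have "\<dots> \<le> A * B2 * W * t ^ CARD('n) / (1 + norm x) ^ L"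
        using A0 B2 W t False
        by (intro divide_left_mono power_mono mult_pos_pos zero_less_power) (auto intro: add_pos_nonneg)
      also have "\<dots> \<le> (B1 + B2) * W * A * t ^ CARD('n) / (1 + norm x) ^ L"
        using A0 B1(1) B2(1) W t by (intro divide_right_mono) (auto simp: algebra_simps)
      finally show ?thesis .
    qed
    then have "norm (conv (dilate t \<phi>) (distr_of (G 0)) x) \<le> (B1 + B2) * W * A * t ^ CARD('n) / (1 + norm x) ^ L / t ^ CARD('n)"
      unfolding conv using t by (simp add: divide_inverse mult.commute mult_right_mono)
    also have "\<dots> = (B1 + B2) * W * A / (1 + norm x) ^ L" using t by simp
    also have "\<dots> \<le> ((B1 + B2) * W + 1) * A / (1 + norm x) ^ L"
      using A0 by (intro divide_right_mono) (auto simp: algebra_simps)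
    finally show ?thesis .
  qed
  moreover have "(B1 + B2) * W + 1 > 0" using B1(1) B2(1) W by (intro add_nonneg_pos) auto
  ultimately show ?thesis by blast
qed

section \<open>From pointwise maximal bounds to Hardy quasi-norms\<close>

lemma integrable_mult_bounded:
  fixes h k :: "'a::euclidean_space \<Rightarrow> complex"
  assumes h: "integrable lborel h" and k: "k \<in> borel_measurable borel" "\<And>y. norm (k y) \<le> B"
  shows "integrable lborel (\<lambda>y. h y * k y)"
proof (rule Bochner_Integration.integrable_bound)
  have B: "B \<ge> 0" using k(2)[of undefined] norm_ge_zero order.trans by blast
  show "integrable lborel (\<lambda>y. B * norm (h y))" using h by simp
  have "h \<in> borel_measurable borel" using h by (simp add: borel_measurable_integrable)
  then show "(\<lambda>y. h y * k y) \<in> borel_measurable lborel" using k(1) by simp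
  show "AE y in lborel. norm (h y * k y) \<le> norm (B * norm (h y))"
    using B k(2) by (intro AE_I2) (simp add: norm_mult abs_mult mult.commute[of B] mult_left_mono)
qed

lemma schwartz_measurable: "f \<in> schwartz \<Longrightarrow> f \<in> borel_measurable borel"
  by (intro borel_measurable_continuous_onI schwartz_continuous)

lemma schwartz_bounded: "f \<in> schwartz \<Longrightarrow> \<exists>B. \<forall>x. norm (f x) \<le> B"
  using schwartz_partial_deriv_decay[of f, where k = 0 and K = 0] by auto

lemma conv_dilate: "conv (dilate t \<phi>) (distr_of f) x =
    (LINT y|lborel. f y * \<phi> ((x - y) /\<^sub>R t)) /\<^sub>R t ^ CARD('n)" for x :: "real ^ 'n"
  by (simp add: conv_def distr_of_def dilate_def)

lemma continuous_conv_dilate: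
  fixes f \<phi> :: "real ^ 'n \<Rightarrow> complex"
  assumes f: "integrable lborel f" and \<phi>: "\<phi> \<in> schwartz" and t: "t > 0"
  shows "continuous_on UNIV (conv (dilate t \<phi>) (distr_of f))"
proof -
  obtain B where B: "\<And>x. norm (\<phi> x) \<le> B" using schwartz_bounded[OF \<phi>] by blast
  have c: "isCont \<phi> x" for x
    using schwartz_continuous[OF \<phi>] by (simp add: continuous_on_eq_continuous_at)
  have fm [measurable]: "f \<in> borel_measurable borel" using f by (simp add: borel_measurable_integrable)
  have pm [measurable]: "\<phi> \<in> borel_measurable borel" by (rule schwartz_measurable[OF \<phi>])
  have "isCont (\<lambda>x. LINT y|lborel. f y * \<phi> ((x - y) /\<^sub>R t)) x" for x
    unfolding continuous_at_sequentially o_def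
  proof (intro allI impI)
    fix s assume s: "s \<longlonglongrightarrow> x"
    show "(\<lambda>n. LINT y|lborel. f y * \<phi> ((s n - y) /\<^sub>R t)) \<longlonglongrightarrow> (LINT y|lborel. f y * \<phi> ((x - y) /\<^sub>R t))"
    proof (rule integral_dominated_convergence)
      show "integrable lborel (\<lambda>y. norm (f y) * B)" using f by simp
      show "AE y in lborel. (\<lambda>n. f y * \<phi> ((s n - y) /\<^sub>R t)) \<longlonglongrightarrow> f y * \<phi> ((x - y) /\<^sub>R t)"
        by (intro AE_I2 tendsto_intros isCont_tendsto_compose[OF c] s)
      show "AE y in lborel. norm (f y * \<phi> ((s n - y) /\<^sub>R t)) \<le> norm (f y) * B" for n
        by (intro AE_I2) (simp add: norm_mult B mult_left_mono)
    qed measurable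
  qed
  then have "continuous_on UNIV (\<lambda>x. LINT y|lborel. f y * \<phi> ((x - y) /\<^sub>R t))"
    by (simp add: continuous_on_eq_continuous_at)
  then show ?thesis
    unfolding conv_dilate[abs_def] by (intro continuous_intros)
qed

text \<open>The supremum runs over uncountably many t, but its superlevel sets are unions of open
  sets, so it is lower semicontinuous.\<close>

lemma borel_measurable_SUP_continuous:
  fixes g :: "'t \<Rightarrow> 'a::topological_space \<Rightarrow> complex"
  assumes "\<And>t. t \<in> T \<Longrightarrow> continuous_on UNIV (g t)"
  shows "(\<lambda>x. SUP t\<in>T. ennreal (norm (g t x))) \<in> borel_measurable borel"
proof (rule borel_measurableI_greater)
  fix a
  have "{x. a < (SUP t\<in>T. ennreal (norm (g t x)))} = (\<Union>t\<in>T. {x. a < ennreal (norm (g t x))})"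
    by (auto simp: less_SUP_iff)
  moreover have "open {x. a < ennreal (norm (g t x))}" if "t \<in> T" for t
    by (intro open_Collect_less continuous_intros continuous_on_ennreal assms that)
  ultimately show "{x \<in> space borel. a < (SUP t\<in>T. ennreal (norm (g t x)))} \<in> sets borel"
    by (auto intro!: borel_open)
qed

lemma epowr_ennreal: "r \<ge> 0 \<Longrightarrow> epowr (ennreal r) q = ennreal (r powr q)"
  by (simp add: epowr_def)

lemma epowr_mono: "a \<le> b \<Longrightarrow> q \<ge> 0 \<Longrightarrow> epowr a q \<le> epowr b q"
  by (auto simp: epowr_def top_unique less_top intro!: ennreal_leI powr_mono2 enn2real_mono)

lemma enn2real_inverse: "q > 0 \<Longrightarrow> enn2real (1 / ennreal q) = 1 / q"
  by (simp add: divide_ennreal flip: ennreal_1)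

lemma nn_integral_weight_scaled:
  assumes "c > 0"
  shows "(\<integral>\<^sup>+x. ennreal (weight (c *\<^sub>R x :: real ^ 'n)) \<partial>lborel) = ennreal (weight_integral TYPE('n) / c ^ CARD('n))"
proof -
  have c: "c \<noteq> 0" using assms by simp
  note w = integral_euclidean_affine[OF integrable_weight[where 'n = 'n] c, of 0]
  have "(\<integral>\<^sup>+x. ennreal (weight (c *\<^sub>R x :: real ^ 'n)) \<partial>lborel) = ennreal (LINT x|lborel. weight (c *\<^sub>R x :: real ^ 'n))"
    by (rule nn_integral_eq_integral) (use w(1) in \<open>auto simp: weight_pos less_imp_le\<close>)
  then show ?thesis using w(2) assms by (simp add: weight_integral_def divide_inverse mult.commute)
qed

text \<open>If p is finite, L p >= 2n bounds the p-th power of the maximal function by a multiple of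
  the dilated weight, whose integral is known. If p is infinite, the exponent 1/p is 0 and the bound
  reduces to D.\<close>

lemma hardy_norm_le:
  fixes f \<phi> :: "real ^ 'n \<Rightarrow> complex"
  assumes \<phi>: "\<phi> \<in> schwartz" and f: "integrable lborel f" and p: "p > 0" and c: "c > 0" and D: "D \<ge> 0"
    and bound: "\<And>t x. t > 0 \<Longrightarrow> norm (conv (dilate t \<phi>) (distr_of f) x) \<le> D / (1 + norm (c *\<^sub>R x)) ^ L"
    and pL: "p = \<infinity> \<or> 2 * CARD('n) \<le> L * enn2real p"
  shows "hardy_norm \<phi> p (distr_of f) \<le> ennreal (D * (weight_integral TYPE('n) / c ^ CARD('n)) powr enn2real (1 / p))"
proof -
  define g where "g x = (SUP t\<in>{0<..}. ennreal (norm (conv (dilate t \<phi>) (distr_of f) x)))" for x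
  have gm [measurable]: "g \<in> borel_measurable borel"
    unfolding g_def
    by (rule borel_measurable_SUP_continuous) (use continuous_conv_dilate[OF f \<phi>] in auto)
  have g_le: "g x \<le> ennreal (D / (1 + norm (c *\<^sub>R x)) ^ L)" for x
    unfolding g_def by (intro SUP_least ennreal_leI bound) auto
  have Wc: "weight_integral TYPE('n) / c ^ CARD('n) > 0" using weight_integral_pos[where 'n = 'n] c by simp
  have "Lp_norm p g \<le> ennreal (D * (weight_integral TYPE('n) / c ^ CARD('n)) powr enn2real (1 / p))"
  proof (cases "p = \<infinity>")
    case True
    have "g x \<le> ennreal D" for x
    proof (rule order.trans[OF g_le ennreal_leI])
      have "1 \<le> (1 + norm (c *\<^sub>R x)) ^ L" by (rule one_le_power) simp
      then have "D / (1 + norm (c *\<^sub>R x)) ^ L \<le> D / 1"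
        using D by (intro divide_left_mono) (auto simp del: norm_scaleR)
      then show "D / (1 + norm (c *\<^sub>R x)) ^ L \<le> D" by simp
    qed
    moreover have "(weight_integral TYPE('n) / c ^ CARD('n)) powr enn2real (1 / p) = 1"
    proof -
      have "enn2real (1 / p) = 0" using True by simp
      then show ?thesis using Wc c by auto
    qed
    ultimately show ?thesis using True gm by (auto simp: Lp_norm_def intro!: esssup_I)
  next
    case False
    then obtain q where q: "p = ennreal q" "q > 0" using p by (cases p) auto
    have qL: "2 * CARD('n) \<le> L * q" using pL False q by simp
    have "epowr (g x) q \<le> ennreal (D powr q * weight (c *\<^sub>R x))" for x
    proof -
      let ?m = "1 + norm (c *\<^sub>R x)"
      have "epowr (g x) q \<le> ennreal ((D / ?m ^ L) powr q)"
        using epowr_mono[OF g_le, of q x] q D by (simp add: epowr_ennreal del: norm_scaleR)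
      also have "(D / ?m ^ L) powr q = D powr q / ?m powr (L * q)"
        unfolding powr_realpow[OF one_plus_norm_pos, symmetric]
        by (simp only: powr_divide powr_powr)
      also have "\<dots> \<le> D powr q / ?m powr (2 * CARD('n))"
        using qL by (intro divide_left_mono powr_mono mult_pos_pos) (auto simp del: norm_scaleR)
      also have "\<dots> = D powr q * weight (c *\<^sub>R x)"
        using powr_realpow[of ?m "2 * CARD('n)"] by (simp add: weight_def del: norm_scaleR)
      finally show ?thesis using ennreal_leI by blast
    qed
    then have "(\<integral>\<^sup>+x. epowr (g x) q \<partial>lborel) \<le> (\<integral>\<^sup>+x. ennreal (D powr q) * ennreal (weight (c *\<^sub>R x :: real ^ 'n)) \<partial>lborel)"
      by (intro nn_integral_mono) (simp add: ennreal_mult' weight_pos less_imp_le)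
    also have "\<dots> = ennreal (D powr q) * ennreal (weight_integral TYPE('n) / c ^ CARD('n))"
    proof -
      have "(\<lambda>x::real ^ 'n. ennreal (weight (c *\<^sub>R x))) \<in> borel_measurable borel"
        by (intro borel_measurable_continuous_onI continuous_on_ennreal continuous_on_compose2[OF continuous_weight[of UNIV]])
           (auto intro: continuous_intros)
      then show ?thesis
        by (subst nn_integral_cmult) (simp_all add: nn_integral_weight_scaled[OF c])
    qed
    also have "\<dots> = ennreal (D powr q * (weight_integral TYPE('n) / c ^ CARD('n)))"
      by (rule ennreal_mult[symmetric]) (use Wc in auto)
    finally have "epowr (\<integral>\<^sup>+x. epowr (g x) q \<partial>lborel) (1 / q) \<le>
        epowr (ennreal (D powr q * (weight_integral TYPE('n) / c ^ CARD('n)))) (1 / q)"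
      using q by (intro epowr_mono) auto
    also have "\<dots> = ennreal ((D powr q * (weight_integral TYPE('n) / c ^ CARD('n))) powr (1 / q))"
      by (intro epowr_ennreal mult_nonneg_nonneg less_imp_le[OF Wc]) simp
    also have "(D powr q * (weight_integral TYPE('n) / c ^ CARD('n))) powr (1 / q) =
       D * (weight_integral TYPE('n) / c ^ CARD('n)) powr (1 / q)"
      using q D by (simp only: powr_mult powr_powr) simp
    finally show ?thesis
      using q gm by (simp add: Lp_norm_def enn2real_inverse)
  qed
  then show ?thesis by (simp add: hardy_norm_def g_def[abs_def])
qed

text \<open>Dilating the function only rescales t, and the maximal function takes all t > 0; so
  estimates at unit scale transfer to every scale \<open>c\<close>.\<close>

lemma conv_dilate_scaled:
  fixes F \<phi> :: "real ^ 'n \<Rightarrow> complex"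
  assumes F: "integrable lborel F" and \<phi>: "\<phi> \<in> schwartz" and c: "c > 0" and t: "t > 0"
  shows "conv (dilate t \<phi>) (distr_of (\<lambda>x. F (c *\<^sub>R x))) x = conv (dilate (c * t) \<phi>) (distr_of F) (c *\<^sub>R x)"
proof -
  have pm [measurable]: "\<phi> \<in> borel_measurable borel" by (rule schwartz_measurable[OF \<phi>])
  obtain B where B: "\<And>x. norm (\<phi> x) \<le> B" using schwartz_bounded[OF \<phi>] by blast
  let ?h = "\<lambda>z. F z * \<phi> ((c *\<^sub>R x - z) /\<^sub>R (c * t))"
  have "integrable lborel ?h"
    by (rule integrable_mult_bounded[OF F _ B]) measurable
  from integral_euclidean_affine(2)[OF this, of c 0]
  have "(LINT y|lborel. F (c *\<^sub>R y) * \<phi> ((c *\<^sub>R x - c *\<^sub>R y) /\<^sub>R (c * t))) = (LINT z|lborel. ?h z) /\<^sub>R c ^ CARD('n)"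
    using c by simp
  moreover have "(c *\<^sub>R x - c *\<^sub>R y) /\<^sub>R (c * t) = (x - y) /\<^sub>R t" for y
  proof -
    have "inverse (c * t) * c = inverse t" using c by (simp add: field_simps)
    then show ?thesis by (simp only: scaleR_right_diff_distrib[symmetric] scaleR_scaleR)
  qed
  ultimately show ?thesis
    unfolding conv_dilate by (simp add: power_mult_distrib mult.commute)
qed

text \<open>The constant is chosen before \<open>G\<close>, \<open>A\<close> and \<open>c\<close>,
  so it serves inputs that change with the scale.\<close>

lemma hardy_bound:
  fixes \<phi> :: "real ^ 'n \<Rightarrow> complex"
  assumes \<phi>: "\<phi> \<in> schwartz" and LK: "L \<le> CARD('n) + K" and p: "p > 0"
    and pL: "p = \<infinity> \<or> 2 * CARD('n) \<le> L * enn2real p"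
  shows "\<exists>C>0. \<forall>G A c. (\<forall>j\<le>K. continuous_on UNIV (G j)) \<longrightarrow>
      (\<forall>j\<le>K. \<forall>y. norm (G j y) \<le> A / (1 + norm y) ^ (L + 2 * CARD('n))) \<longrightarrow>
      (\<forall>j<K. (\<forall>x. G (Suc j) differentiable (at x)) \<and> partial_deriv (axis i 1) (G (Suc j)) = G j) \<longrightarrow>
      c > 0 \<longrightarrow> distr_of (\<lambda>x. G 0 (c *\<^sub>R x)) \<in> hardy \<phi> p \<and>
        hardy_norm \<phi> p (distr_of (\<lambda>x. G 0 (c *\<^sub>R x))) \<le> ennreal (C * A * c powr (- real CARD('n) * enn2real (1 / p)))"
proof -
  obtain C where C: "C > 0" "\<And>G A t x. (\<forall>j\<le>K. continuous_on UNIV (G j)) \<Longrightarrow>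
      (\<forall>j\<le>K. \<forall>y. norm (G j y) \<le> A / (1 + norm y) ^ (L + 2 * CARD('n))) \<Longrightarrow>
      (\<forall>j<K. (\<forall>x. G (Suc j) differentiable (at x)) \<and> partial_deriv (axis i 1) (G (Suc j)) = G j) \<Longrightarrow>
      t > 0 \<Longrightarrow> norm (conv (dilate t \<phi>) (distr_of (G 0)) x) \<le> C * A / (1 + norm x) ^ L"
    using maximal_bound[OF \<phi> LK, of i] by blast
  define W where "W = weight_integral TYPE('n)"
  have W: "W > 0" unfolding W_def by (rule weight_integral_pos)
  define a where "a = enn2real (1 / p)"
  have main: "distr_of (\<lambda>x. G 0 (c *\<^sub>R x)) \<in> hardy \<phi> p \<and>
     hardy_norm \<phi> p (distr_of (\<lambda>x. G 0 (c *\<^sub>R x))) \<le> ennreal (C * W powr a * A * c powr (- real CARD('n) * a))"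
    if G: "\<forall>j\<le>K. continuous_on UNIV (G j)"
      "\<forall>j\<le>K. \<forall>y. norm (G j y) \<le> A / (1 + norm y) ^ (L + 2 * CARD('n))"
      "\<forall>j<K. (\<forall>x. G (Suc j) differentiable (at x)) \<and> partial_deriv (axis i 1) (G (Suc j)) = G j"
      and c: "c > 0" for G A c
  proof -
    have A0: "A \<ge> 0" using order.trans[OF norm_ge_zero, of "G 0 0"] G(2) by force
    have int: "integrable lborel (G 0)" by (rule integrable_decay) (use G in auto)
    have "c \<noteq> 0" using c by simp
    from integral_euclidean_affine(1)[OF int this, of 0]
    have int': "integrable lborel (\<lambda>x. G 0 (c *\<^sub>R x))" by simp
    have "hardy_norm \<phi> p (distr_of (\<lambda>x. G 0 (c *\<^sub>R x))) \<le> ennreal ((C * A) * (W / c ^ CARD('n)) powr a)"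
      unfolding W_def a_def
    proof (rule hardy_norm_le[OF \<phi> int' p c _ _ pL])
      fix t x assume t: "t > (0::real)"
      show "norm (conv (dilate t \<phi>) (distr_of (\<lambda>x. G 0 (c *\<^sub>R x))) x) \<le> C * A / (1 + norm (c *\<^sub>R x)) ^ L"
        unfolding conv_dilate_scaled[OF int \<phi> c t] using C(2)[OF G, of "c * t" "c *\<^sub>R x"] c t by simp
    qed (use A0 C in auto)
    also have "(C * A) * (W / c ^ CARD('n)) powr a = C * W powr a * A * c powr (- real CARD('n) * a)"
    proof -
      have "c ^ CARD('n) = c powr real CARD('n)" using powr_realpow[OF c] by simp
      then have "(W / c ^ CARD('n)) powr a = W powr a / c powr (real CARD('n) * a)"
        using W c by (simp only: powr_divide powr_powr)
      then show ?thesis by (simp add: powr_minus divide_inverse)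
    qed
    finally have le: "hardy_norm \<phi> p (distr_of (\<lambda>x. G 0 (c *\<^sub>R x))) \<le> ennreal (C * W powr a * A * c powr (- real CARD('n) * a))" .
    then have "hardy_norm \<phi> p (distr_of (\<lambda>x. G 0 (c *\<^sub>R x))) < \<infinity>"
      by (rule le_less_trans) (simp add: less_top[symmetric])
    then show ?thesis using le distr_of_tempered[OF int'] by (simp add: hardy_def)
  qed
  show ?thesis
    unfolding a_def[symmetric]
    using C(1) W main by (intro exI[of _ "C * W powr a"] conjI allI impI) auto
qed

section \<open>Antiderivatives of band-limited functions\<close>

lemma DERIV_inverse_power:
  fixes z :: complex
  assumes "z \<noteq> 0"
  shows "((\<lambda>z. inverse (z ^ k)) has_field_derivative - (of_nat k / z ^ (k + 1))) (at z)"
proof (cases k)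
  case (Suc l)
  have "((\<lambda>z. z ^ Suc l) has_field_derivative of_nat (Suc l) * z ^ l) (at z)"
    using DERIV_power[OF DERIV_ident, of "Suc l" z] by simp
  from DERIV_inverse_fun[OF this] assms
  have "((\<lambda>z. inverse (z ^ Suc l)) has_field_derivative
      - (of_nat (Suc l) * z ^ l * inverse ((z ^ Suc l) ^ Suc (Suc 0)))) (at z)" by simp
  also have "of_nat (Suc l) * z ^ l * inverse ((z ^ Suc l) ^ Suc (Suc 0)) = of_nat k / z ^ (k + 1)"
    using assms Suc by (simp add: field_simps)
  finally show ?thesis using Suc by simp
qed simp

text \<open>On the Fourier side, an antiderivative is division by \<open>\<i> u\<close>.\<close>

lemma test_fun_div_power:
  assumes v: "test_fun v" and \<delta>: "\<delta> > 0" "\<And>u. u \<le> \<delta> \<Longrightarrow> v u = 0"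
  shows "test_fun (\<lambda>u. v u / (\<i> * of_real u) ^ k)"
proof -
  have dt: "diff_times m (\<lambda>u. v u / (\<i> * of_real u) ^ k)"
    if "smooth1 v" "\<And>u. u \<le> \<delta> \<Longrightarrow> v u = 0" for m k v
    using that
  proof (induction m arbitrary: v k)
    case (Suc m)
    let ?f' = "\<lambda>u. vderiv v u / (\<i> * of_real u) ^ k + (- (of_nat k * \<i>)) * (v u / (\<i> * of_real u) ^ (k + 1))"
    have v'0: "vderiv v u = 0" if "u < \<delta>" for u
      using funpow_vderiv_eq_0[of "{..<\<delta>}" v u 1] Suc.prems(2) that by simp
    have "((\<lambda>u. v u / (\<i> * of_real u) ^ k) has_vector_derivative ?f' u) (at u)" for u
    proof (cases "u < \<delta>")
      case True
      have "((\<lambda>u. v u / (\<i> * of_real u) ^ k) has_vector_derivative 0) (at u)"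
        by (rule has_vector_derivative_transform_within_open[of "\<lambda>_. 0" _ _ "{..<\<delta>}"])
           (use True Suc.prems(2) in auto)
      then show ?thesis using True v'0 Suc.prems(2)[of u] by simp
    next
      case False
      then have u: "u \<noteq> 0" using \<delta> by auto
      have "((\<lambda>u. \<i> * complex_of_real u) has_vector_derivative \<i>) (at u)"
        by (auto intro!: derivative_eq_intros simp: has_vector_derivative_def scaleR_conv_of_real)
      then have pw: "((\<lambda>u. inverse ((\<i> * complex_of_real u) ^ k)) has_vector_derivative
          - (of_nat k * \<i>) / (\<i> * of_real u) ^ (k + 1)) (at u)"
      proof -
        have "((\<lambda>z. inverse (z ^ k)) has_field_derivative - (of_nat k / (\<i> * of_real u) ^ (k + 1))) (at (\<i> * of_real u))"
          by (rule DERIV_inverse_power) (use u in simp)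
        from field_vector_diff_chain_at[OF \<open>((\<lambda>u. \<i> * complex_of_real u) has_vector_derivative \<i>) (at u)\<close> this]
        show ?thesis by (simp add: o_def)
      qed
      show ?thesis
        using has_vector_derivative_mult[OF smooth1_vderiv(1)[OF Suc.prems(1)] pw]
        by (simp add: divide_inverse algebra_simps)
    qed
    moreover have "diff_times m ?f'"
    proof (intro diff_times_add diff_times_mult diff_times_const Suc.IH)
      \<comment> \<open>The induction needs vanishing up to and including \<delta>. Locality gives
        it only for u < \<delta>; at \<delta> itself continuity of the derivative closes the
        gap.\<close>
      show "vderiv v u = 0" if "u \<le> \<delta>" for u
      proof (rule ccontr)
        assume n: "vderiv v u \<noteq> 0"
        then have "u = \<delta>" using v'0[of u] that by force
        have "(vderiv v \<longlongrightarrow> vderiv v \<delta>) (at_left \<delta>)"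
          using smooth1_continuous_on[OF smooth1_vderiv(2)[OF Suc.prems(1)], of UNIV]
          by (auto simp: continuous_on_def intro: tendsto_within_subset)
        moreover have "(vderiv v \<longlongrightarrow> 0) (at_left \<delta>)"
          by (rule tendsto_eventually) (auto simp: v'0 eventually_at_filter)
        ultimately show False using tendsto_unique[of "at_left \<delta>"] n \<open>u = \<delta>\<close> by auto
      qed
    qed (use Suc.prems smooth1_vderiv in auto)
    ultimately show ?case by (rule diff_times_SucI)
  qed simp
  obtain M where "M > 0" "\<And>u. M \<le> \<bar>u\<bar> \<Longrightarrow> v u = 0" using v by (auto elim: test_fun_support)
  then show ?thesis
    using dt[of v] v \<delta> by (auto simp: test_fun_def smooth1_def)
qed

lemma ift_cmult: "ift (\<lambda>u. k * v u) x = k * ift v x"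
  unfolding ift_def by (simp add: mult.left_commute)

lemma ift_scale:
  assumes "c > 0"
  shows "ift (\<lambda>u. v (u / c)) x = of_real c * ift v (c * x)"
proof -
  have "ift (\<lambda>u. v (u / c)) x = c *\<^sub>R (LINT u|lborel. cis (x * (c * u)) * v (c * u / c))"
    unfolding ift_def using assms
    by (subst lborel_integral_real_affine[where c = c and t = 0]) simp_all
  then show ?thesis
    using assms by (simp add: ift_def scaleR_conv_of_real mult_ac)
qed

lemma tensor_ift_scale:
  assumes "c > 0"
  shows "tensor_ift (\<lambda>_ u. of_real (A / c) * w (u / c)) x = tensor_ift (\<lambda>_ u. of_real A * w u) (c *\<^sub>R x)"
proof -
  have "ift (\<lambda>u. of_real (A / c) * w (u / c)) y = ift (\<lambda>u. of_real A * w u) (c * y)" for y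
    unfolding ift_cmult ift_scale[OF assms] using assms by simp
  then show ?thesis by (simp only: tensor_ift_def vector_scaleR_component real_scaleR_def)
qed

text \<open>As \<open>w\<close> vanishes near 0 and on the negative axis, dividing by powers of i u
  is harmless, which supplies as many antiderivatives as small exponents demand. Hence the estimate
  covers every p > 0.\<close>

lemma hardy_norm_dilated_band_limited:
  fixes \<phi> :: "real ^ 'n \<Rightarrow> complex"
  assumes \<phi>: "\<phi> \<in> schwartz" and p: "p > 0"
    and w: "test_fun w" and \<delta>: "\<delta> > 0" "\<And>u. u \<le> \<delta> \<Longrightarrow> w u = 0"
  shows "\<exists>C>0. \<forall>A>0. \<forall>c>0.
      distr_of (tensor_ift (\<lambda>_::'n. \<lambda>u. of_real (A / c) * w (u / c))) \<in> hardy \<phi> p \<and>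
      hardy_norm \<phi> p (distr_of (tensor_ift (\<lambda>_::'n. \<lambda>u. of_real (A / c) * w (u / c)))) \<le>
        ennreal (C * A ^ CARD('n) * c powr (- real CARD('n) * enn2real (1 / p)))"
proof -
  \<comment> \<open>Enough decay for the p-th power to be integrable; L antiderivatives then satisfy
    L <= n + L.\<close>
  obtain L where L: "p = \<infinity> \<or> 2 * CARD('n) \<le> real L * enn2real p"
  proof (cases "p = \<infinity>")
    case False
    then have q: "enn2real p > 0" using p by (simp add: enn2real_positive_iff less_top)
    define L where "L = nat \<lceil>2 * CARD('n) / enn2real p\<rceil>"
    have "2 * CARD('n) / enn2real p \<le> L" unfolding L_def by linarith
    then show ?thesis using q by (intro that[of L]) (simp add: field_simps)
  qed (use that in auto)
  \<comment> \<open>Antiderivatives in a single, arbitrary direction suffice.\<close>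
  define i0 :: 'n where "i0 = undefined"
  define v where "v j A k u = of_real A * (if k = i0 then w u / (\<i> * of_real u) ^ j else w u)"
    for j and A :: real and k :: 'n and u :: real
  have v: "test_fun (v j A k)" for j A k
    unfolding v_def[abs_def] using test_fun_mult[OF smooth1_const test_fun_div_power[OF w \<delta>]] test_fun_mult[OF smooth1_const w]
    by (cases "k = i0") auto
  obtain C where C: "C > 0" "\<And>G A c. (\<forall>j\<le>L. continuous_on UNIV (G j)) \<Longrightarrow>
      (\<forall>j\<le>L. \<forall>y. norm (G j y) \<le> A / (1 + norm y) ^ (L + 2 * CARD('n))) \<Longrightarrow>
      (\<forall>j<L. (\<forall>x. G (Suc j) differentiable (at x)) \<and> partial_deriv (axis i0 1) (G (Suc j)) = G j) \<Longrightarrow>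
      c > 0 \<Longrightarrow> distr_of (\<lambda>x. G 0 (c *\<^sub>R x)) \<in> hardy \<phi> p \<and>
        hardy_norm \<phi> p (distr_of (\<lambda>x. G 0 (c *\<^sub>R x))) \<le> ennreal (C * A * c powr (- real CARD('n) * enn2real (1 / p)))"
    using hardy_bound[OF \<phi> _ p L, of L i0] by auto
  have "\<exists>B\<ge>0. \<forall>x. norm (tensor_ift (v j 1) x) \<le> B / (1 + norm x) ^ (L + 2 * CARD('n))" for j
    by (rule tensor_ift_decay[OF v])
  then obtain B where B: "\<And>j. B j \<ge> 0" "\<And>j x. norm (tensor_ift (v j 1) x) \<le> B j / (1 + norm x) ^ (L + 2 * CARD('n))"
    by metis
  define B' where "B' = 1 + (\<Sum>j\<le>L. B j)"
  have B': "B' > 0" "B j \<le> B'" if "j \<le> L" for j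
    using B(1) member_le_sum[of j "{..L}" B] that by (auto simp: B'_def intro!: add_pos_nonneg sum_nonneg)
  have vA: "tensor_ift (v j A) x = of_real (A ^ CARD('n)) * tensor_ift (v j 1) x" for j A x
  proof -
    have "ift (v j A k) y = of_real A * ift (v j 1 k) y" for k y
      unfolding v_def[abs_def] by (simp add: ift_cmult)
    then show ?thesis by (simp add: tensor_ift_def prod.distrib)
  qed
  have "distr_of (\<lambda>x. tensor_ift (v 0 A) (c *\<^sub>R x)) \<in> hardy \<phi> p \<and>
      hardy_norm \<phi> p (distr_of (\<lambda>x. tensor_ift (v 0 A) (c *\<^sub>R x))) \<le>
        ennreal (C * (A ^ CARD('n) * B') * c powr (- real CARD('n) * enn2real (1 / p)))"
    if A: "A > 0" and c: "c > 0" for A c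
  proof (rule C(2)[where G = "\<lambda>j. tensor_ift (v j A)"])
    show "\<forall>j\<le>L. continuous_on UNIV (tensor_ift (v j A))"
      by (intro allI impI differentiable_imp_continuous_on_UNIV differentiable_tensor_ift v)
    show "\<forall>j\<le>L. \<forall>y. norm (tensor_ift (v j A) y) \<le> A ^ CARD('n) * B' / (1 + norm y) ^ (L + 2 * CARD('n))"
    proof (intro allI impI)
      fix j y assume j: "j \<le> L"
      have "norm (tensor_ift (v j A) y) = A ^ CARD('n) * norm (tensor_ift (v j 1) y)"
        using A unfolding vA[of j A] norm_mult norm_of_real by simp
      also have "\<dots> \<le> A ^ CARD('n) * (B' / (1 + norm y) ^ (L + 2 * CARD('n)))"
        using A B'(2)[OF j] by (intro mult_left_mono order.trans[OF B(2)] divide_right_mono) auto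
      finally show "norm (tensor_ift (v j A) y) \<le> A ^ CARD('n) * B' / (1 + norm y) ^ (L + 2 * CARD('n))" by simp
    qed
    show "\<forall>j<L. (\<forall>x. tensor_ift (v (Suc j) A) differentiable (at x)) \<and>
        partial_deriv (axis i0 1) (tensor_ift (v (Suc j) A)) = tensor_ift (v j A)"
    proof (intro allI impI conjI)
      fix j
      have "(v (Suc j) A)(i0 := (\<lambda>u. \<i> * of_real u * v (Suc j) A i0 u)) = v j A"
        using \<delta>(2)[of 0] \<delta>(1) by (auto simp: fun_eq_iff v_def)
      then show "partial_deriv (axis i0 1) (tensor_ift (v (Suc j) A)) = tensor_ift (v j A)"
        using partial_deriv_tensor_ift[of "v (Suc j) A" i0, OF v] by simp
    qed (rule differentiable_tensor_ift[OF v])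
  qed (rule c)
  moreover have "(\<lambda>x. tensor_ift (v 0 A) (c *\<^sub>R x)) = tensor_ift (\<lambda>_::'n. \<lambda>u. of_real (A / c) * w (u / c))"
    if "c > 0" for A c
  proof -
    have v0: "v 0 A = (\<lambda>_ u. of_real A * w u)" by (intro ext) (simp add: v_def)
    show ?thesis by (rule ext) (simp only: v0 tensor_ift_scale[OF that])
  qed
  ultimately show ?thesis
    using C(1) B'(1)[OF order.refl] by (intro exI[of _ "C * B'"]) (simp add: mult_ac)
qed

text \<open>For p >= 2 the decay exponent L = n satisfies both L <= n + 0 and 2n <= L p, so no
  antiderivative occurs and a pointwise bound on \<open>F\<close> is all that enters. The constant
  does not depend on \<open>F\<close>, which may therefore contain trigonometric polynomials of
  growing degree.\<close>

lemma hardy_norm_dominated: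
  fixes \<phi> :: "real ^ 'n \<Rightarrow> complex"
  assumes \<phi>: "\<phi> \<in> schwartz" and p: "2 \<le> p" and \<theta>: "test_fun \<theta>"
  shows "\<exists>C>0. \<forall>A>0. \<forall>c>0. \<forall>F. continuous_on UNIV F \<longrightarrow>
      (\<forall>y. norm (F y) \<le> A * norm (tensor_ift (\<lambda>_::'n. \<theta>) y)) \<longrightarrow>
      distr_of (\<lambda>x. F (c *\<^sub>R x)) \<in> hardy \<phi> p \<and>
      hardy_norm \<phi> p (distr_of (\<lambda>x. F (c *\<^sub>R x))) \<le>
        ennreal (C * A * c powr (- real CARD('n) * enn2real (1 / p)))"
proof -
  have p0: "p > 0" using p by (rule less_le_trans[rotated]) simp
  have pL: "p = \<infinity> \<or> 2 * CARD('n) \<le> real CARD('n) * enn2real p"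
  proof (cases "p = \<infinity>")
    case False
    then have "2 \<le> enn2real p" using p enn2real_mono[of 2 p] by (simp add: less_top)
    then show ?thesis by simp
  qed simp
  obtain C where C: "C > 0" "\<And>G A c. (\<forall>j\<le>0. continuous_on UNIV (G j)) \<Longrightarrow>
      (\<forall>j\<le>0. \<forall>y. norm (G j y) \<le> A / (1 + norm y) ^ (CARD('n) + 2 * CARD('n))) \<Longrightarrow>
      (\<forall>j<0. (\<forall>x. G (Suc j) differentiable (at x)) \<and> partial_deriv (axis undefined 1) (G (Suc j)) = G j) \<Longrightarrow>
      c > 0 \<Longrightarrow> distr_of (\<lambda>x. G (0::nat) (c *\<^sub>R x)) \<in> hardy \<phi> p \<and>
        hardy_norm \<phi> p (distr_of (\<lambda>x. G 0 (c *\<^sub>R x))) \<le> ennreal (C * A * c powr (- real CARD('n) * enn2real (1 / p)))"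
    using hardy_bound[OF \<phi> _ p0 pL, of 0 undefined] by auto
  obtain B where B: "B \<ge> 0" "\<And>x. norm (tensor_ift (\<lambda>_::'n. \<theta>) x) \<le> B / (1 + norm x) ^ (CARD('n) + 2 * CARD('n))"
    using tensor_ift_decay[of "\<lambda>_. \<theta>", OF \<theta>] by blast
  have "distr_of (\<lambda>x. F (c *\<^sub>R x)) \<in> hardy \<phi> p \<and>
      hardy_norm \<phi> p (distr_of (\<lambda>x. F (c *\<^sub>R x))) \<le>
        ennreal (C * (A * (B + 1)) * c powr (- real CARD('n) * enn2real (1 / p)))"
    if A: "A > 0" and c: "c > 0" and F: "continuous_on UNIV F" "\<forall>y. norm (F y) \<le> A * norm (tensor_ift (\<lambda>_::'n. \<theta>) y)" for A c F
  proof (rule C(2)[where G = "\<lambda>_. F"])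
    show "\<forall>j\<le>0. \<forall>y. norm (F y) \<le> A * (B + 1) / (1 + norm y) ^ (CARD('n) + 2 * CARD('n))"
    proof (intro allI impI)
      fix y
      have "norm (F y) \<le> A * (B / (1 + norm y) ^ (CARD('n) + 2 * CARD('n)))"
        using A by (intro order.trans[OF F(2)[rule_format]] mult_left_mono B) auto
      also have "\<dots> \<le> A * ((B + 1) / (1 + norm y) ^ (CARD('n) + 2 * CARD('n)))"
        using A by (intro mult_left_mono divide_right_mono) auto
      finally show "norm (F y) \<le> A * (B + 1) / (1 + norm y) ^ (CARD('n) + 2 * CARD('n))" by simp
    qed
  qed (use F c in auto)
  then show ?thesis
    using C(1) B(1) by (intro exI[of _ "C * (B + 1)"]) (simp add: mult_ac)
qed

section \<open>Rudin--Shapiro polynomials\<close>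

text \<open>Coefficients of the Rudin--Shapiro pair P, Q with P_(k+1) = P_k + z^(2^k) Q_k and
  Q_(k+1) = P_k - z^(2^k) Q_k; the index shift by 2^k is the multiplication by z^(2^k).\<close>

fun rs_coeff :: "nat \<Rightarrow> nat \<Rightarrow> real" and rs_coeff' :: "nat \<Rightarrow> nat \<Rightarrow> real" where
  "rs_coeff 0 j = 1"
| "rs_coeff (Suc k) j = (if j < 2 ^ k then rs_coeff k j else rs_coeff' k (j - 2 ^ k))"
| "rs_coeff' 0 j = 1"
| "rs_coeff' (Suc k) j = (if j < 2 ^ k then rs_coeff k j else - rs_coeff' k (j - 2 ^ k))"

lemma abs_rs_coeff: "\<bar>rs_coeff k j\<bar> = 1" "\<bar>rs_coeff' k j\<bar> = 1"
  by (induction k arbitrary: j) auto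

definition rs_poly :: "nat \<Rightarrow> real \<Rightarrow> complex" where
  "rs_poly k y = (\<Sum>j<2^k. of_real (rs_coeff k j) * cis (real j * y))"

definition rs_poly' :: "nat \<Rightarrow> real \<Rightarrow> complex" where
  "rs_poly' k y = (\<Sum>j<2^k. of_real (rs_coeff' k j) * cis (real j * y))"

lemma sum_lessThan_double:
  fixes f :: "nat \<Rightarrow> 'a::comm_monoid_add"
  shows "(\<Sum>j<2^Suc k. f j) = (\<Sum>j<2^k. f j) + (\<Sum>j<2^k. f (j + 2^k))"
proof -
  have "(\<Sum>j<2^Suc k. f j) = (\<Sum>j\<in>{0..<2^k}. f j) + (\<Sum>j\<in>{2^k..<2^Suc k}. f j)"
    unfolding lessThan_atLeast0 by (rule sum.atLeastLessThan_concat[symmetric]) auto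
  also have "(\<Sum>j\<in>{2^k..<2^Suc k}. f j) = (\<Sum>j\<in>{0..<2^k}. f (j + 2^k))"
    using sum.shift_bounds_nat_ivl[of f 0 "2^k" "2^k"] by (simp add: mult_2)
  finally show ?thesis by (simp add: lessThan_atLeast0)
qed

lemma rs_poly_Suc:
  "rs_poly (Suc k) y = rs_poly k y + cis (2 ^ k * y) * rs_poly' k y"
  "rs_poly' (Suc k) y = rs_poly k y - cis (2 ^ k * y) * rs_poly' k y"
  unfolding rs_poly_def rs_poly'_def sum_lessThan_double
  by (simp_all add: sum_distrib_left sum_negf[symmetric] distrib_left distrib_right cis_mult[symmetric] mult_ac)

lemma parallelogram: "(norm (a + b))\<^sup>2 + (norm (a - b))\<^sup>2 = 2 * (norm a)\<^sup>2 + 2 * (norm (b::complex))\<^sup>2"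
  unfolding cmod_power2 by (simp add: power2_eq_square algebra_simps)

lemma norm_diff_squares: "(norm (a + b))\<^sup>2 - (norm (a - b))\<^sup>2 = 4 * Re (cnj a * (b::complex))"
  unfolding cmod_power2 by (simp add: power2_eq_square algebra_simps)

text \<open>The parallelogram law doubles the sum of squares at every step, for each y
  separately.\<close>

lemma rs_poly_squares: "(norm (rs_poly k y))\<^sup>2 + (norm (rs_poly' k y))\<^sup>2 = 2 ^ Suc k"
proof (induction k)
  case 0
  show ?case by (simp add: rs_poly_def rs_poly'_def)
next
  case (Suc k)
  show ?case unfolding rs_poly_Suc parallelogram norm_mult norm_cis using Suc by simp
qed

text \<open>Flatness: 2^k unimodular terms never exceed sqrt 2 times their root mean square. This
  bounds the flat inputs.\<close>

lemma norm_rs_poly_le: "norm (rs_poly k y) \<le> sqrt (2 * 2 ^ k)"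
proof (rule real_le_rsqrt)
  have "(norm (rs_poly' k y))\<^sup>2 \<ge> 0" by simp
  then have "(norm (rs_poly k y))\<^sup>2 \<le> 2 ^ Suc k" using rs_poly_squares[of k y] by linarith
  then show "(norm (rs_poly k y))\<^sup>2 \<le> 2 * 2 ^ k" by simp
qed

text \<open>For \<open>k = 0\<close> this fails, since \<open>rs_poly 0 = rs_poly' 0 = 1\<close>.\<close>

lemma rs_poly_antiperiodic:
  "cnj (rs_poly (Suc k) (y + pi)) * rs_poly' (Suc k) (y + pi) = - (cnj (rs_poly (Suc k) y) * rs_poly' (Suc k) y) \<and>
   (norm (rs_poly (Suc k) (y + pi)))\<^sup>2 - (norm (rs_poly' (Suc k) (y + pi)))\<^sup>2 =
     - ((norm (rs_poly (Suc k) y))\<^sup>2 - (norm (rs_poly' (Suc k) y))\<^sup>2)"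
proof (induction k)
  case 0
  \<comment> \<open>At level one the pair is 1 + cis y and 1 - cis y, which the shift by pi
    exchanges.\<close>
  have "cis (y + pi) = - cis y" by (simp flip: cis_mult)
  moreover have "rs_poly 0 z = 1" "rs_poly' 0 z = 1" for z by (simp_all add: rs_poly_def rs_poly'_def)
  ultimately show ?case
    by (simp add: rs_poly_Suc algebra_simps norm_minus_commute cis_cnj cis_mult)
next
  case (Suc k)
  let ?P = "rs_poly (Suc k)" and ?Q = "rs_poly' (Suc k)"
  define e where "e z = cis (2 ^ Suc k * z)" for z
  \<comment> \<open>From level one on, the factor of the recursion has even frequency and is
    pi-periodic, so the sign changes of both quantities pass to the next level.\<close>
  have "cis (2 ^ Suc k * pi) = 1"
    using cis_multiple_2pi[of "2 ^ k"] by (simp add: mult_ac)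
  then have e: "e (y + pi) = e y" by (simp add: e_def distrib_left flip: cis_mult)
  have ee: "cnj (e z) * e z = 1" for z by (simp add: e_def cis_mult cis_cnj)
  have h: "cnj (?P z + e z * ?Q z) * (?P z - e z * ?Q z) =
     of_real ((norm (?P z))\<^sup>2 - (norm (?Q z))\<^sup>2) - e z * (cnj (?P z) * ?Q z) + cnj (e z * (cnj (?P z) * ?Q z))" for z
  proof -
    have "cnj (e z * ?Q z) * (e z * ?Q z) = cnj (?Q z) * ?Q z" using ee[of z] by (simp add: algebra_simps)
    moreover have "complex_of_real ((norm (?P z))\<^sup>2 - (norm (?Q z))\<^sup>2) = cnj (?P z) * ?P z - cnj (?Q z) * ?Q z"
      by (simp only: of_real_diff complex_norm_square mult.commute)
    moreover have "cnj (?P z + e z * ?Q z) * (?P z - e z * ?Q z) =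
        (cnj (?P z) * ?P z - cnj (e z * ?Q z) * (e z * ?Q z)) - e z * (cnj (?P z) * ?Q z) + cnj (e z * (cnj (?P z) * ?Q z))"
      by (simp add: algebra_simps)
    ultimately show ?thesis by (simp only:)
  qed
  have 1: "rs_poly (Suc (Suc k)) z = ?P z + e z * ?Q z" "rs_poly' (Suc (Suc k)) z = ?P z - e z * ?Q z" for z
    unfolding rs_poly_Suc[of "Suc k"] e_def by simp_all
  have D: "(norm (?P z + e z * ?Q z))\<^sup>2 - (norm (?P z - e z * ?Q z))\<^sup>2 = 4 * Re (e z * (cnj (?P z) * ?Q z))" for z
    unfolding norm_diff_squares by (simp add: mult.left_commute)
  have hh: "cnj (?P (y + pi)) * ?Q (y + pi) = - (cnj (?P y) * ?Q y)"
    and dd: "(norm (?P (y + pi)))\<^sup>2 - (norm (?Q (y + pi)))\<^sup>2 = - ((norm (?P y))\<^sup>2 - (norm (?Q y))\<^sup>2)"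
    using Suc by simp_all
  show ?case
    unfolding 1 D h unfolding e hh dd by simp
qed

text \<open>Since |P|^2 + |Q|^2 is constant and |P|^2 - |Q|^2 changes sign under the shift, |P|^2
  deviates oppositely at y and y + pi. At one of the two points |P| is at least its root mean
  square, which bounds every L^q norm from below, also for q < 1.\<close>

lemma rs_poly_shift_squares:
  assumes "k > 0"
  shows "(norm (rs_poly k y))\<^sup>2 + (norm (rs_poly k (y + pi)))\<^sup>2 = 2 ^ Suc k"
proof -
  obtain l where "k = Suc l" using assms by (cases k) auto
  then show ?thesis
    using rs_poly_squares[of k y] rs_poly_squares[of k "y + pi"] rs_poly_antiperiodic[of l y] by simp
qed

section \<open>Symbols given by sums of bumps\<close>

lemma prod_Basis_prod:
  "(\<Prod>b\<in>(Basis :: ('a::euclidean_space \<times> 'b::euclidean_space) set). g b) =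
     (\<Prod>u\<in>Basis. g (u, 0)) * (\<Prod>v\<in>Basis. g (0, v))"
proof -
  have "(\<Prod>b\<in>(Basis :: ('a \<times> 'b) set). g b) = (\<Prod>b\<in>(\<lambda>u. (u, 0)) ` Basis. g b) * (\<Prod>b\<in>(\<lambda>v. (0, v)) ` Basis. g b)"
    unfolding Basis_prod_def by (rule prod.union_disjoint) auto
  then show ?thesis by (simp add: prod.reindex inj_on_def)
qed

lemma partial_deriv_const: "partial_deriv b (\<lambda>_. c) = (\<lambda>_. 0)"
  by (simp add: partial_deriv_def fun_eq_iff)

text \<open>Serves the derivatives in x: the symbols constructed below do not depend on x.\<close>

lemma multi_deriv_const:
  fixes \<alpha> :: "nat ^ 'n"
  shows "multi_deriv \<alpha> (\<lambda>_. c) = (\<lambda>_. if multi_abs \<alpha> = 0 then c else 0)"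
proof -
  have pow: "(partial_deriv b ^^ k) (\<lambda>_. d) = (\<lambda>_. if k = 0 then d else 0)" for b :: "real ^ 'n" and k d
    by (induction k) (auto simp: partial_deriv_const)
  have "foldr (\<lambda>i. partial_deriv (axis i (1::real)) ^^ (\<alpha> $ i)) is (\<lambda>_. c) =
     (\<lambda>_. if (\<forall>i\<in>set is. \<alpha> $ i = 0) then c else 0)" for "is"
  proof (induction "is")
    case (Cons i "is")
    have "foldr (\<lambda>i. partial_deriv (axis i (1::real)) ^^ (\<alpha> $ i)) (i # is) (\<lambda>_. c) =
       (partial_deriv (axis i 1) ^^ (\<alpha> $ i)) (\<lambda>_. if (\<forall>i\<in>set is. \<alpha> $ i = 0) then c else 0)"
      by (simp only: foldr.simps o_apply Cons)
    also have "\<dots> = (\<lambda>_. if (\<forall>i\<in>set (i # is). \<alpha> $ i = 0) then c else 0)"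
      by (simp only: pow) auto
    finally show ?case .
  qed simp
  then show ?thesis by (simp add: multi_deriv_def multi_abs_def coords(2))
qed

text \<open>Term i is a bump of width \<open>s i\<close> centred at \<open>s i\<close> times
  (\<open>P i\<close>, \<open>Q i\<close>) in the two frequency variables. \<open>inj\<close> makes
  the supports disjoint, \<open>comparable\<close> places term i at frequencies of size
  \<open>R i\<close>, and \<open>finite_meeting\<close> gives local finiteness. A derivative costs 1
  / \<open>s i\<close>, the power of \<open>R i\<close> that the symbol class allows.\<close>

locale symbol_data =
  fixes I :: "'i set" and amp :: "'i \<Rightarrow> complex" and s R :: "'i \<Rightarrow> real"
    and P Q :: "'i \<Rightarrow> real ^ 'n" and \<theta> :: "real \<Rightarrow> complex" and m \<rho> D :: real
  assumes \<theta>: "smooth1 \<theta>" "\<And>u. 1/8 \<le> \<bar>u\<bar> \<Longrightarrow> \<theta> u = 0"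
    and R: "\<And>i. i \<in> I \<Longrightarrow> R i > 0" and s: "\<And>i. i \<in> I \<Longrightarrow> s i = R i powr \<rho>"
    and amp: "\<And>i. i \<in> I \<Longrightarrow> norm (amp i) \<le> R i powr m"
    and D: "D \<ge> 1"
    and inj: "\<And>i i' x y. i \<in> I \<Longrightarrow> i' \<in> I \<Longrightarrow>
       (\<And>j. \<bar>x $ j / s i - P i $ j\<bar> \<le> 1/8 \<and> \<bar>y $ j / s i - Q i $ j\<bar> \<le> 1/8) \<Longrightarrow>
       (\<And>j. \<bar>x $ j / s i' - P i' $ j\<bar> \<le> 1/8 \<and> \<bar>y $ j / s i' - Q i' $ j\<bar> \<le> 1/8) \<Longrightarrow> i = i'"
    and comparable: "\<And>i x y. i \<in> I \<Longrightarrow>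
       (\<And>j. \<bar>x $ j / s i - P i $ j\<bar> \<le> 1/8 \<and> \<bar>y $ j / s i - Q i $ j\<bar> \<le> 1/8) \<Longrightarrow>
       R i \<le> D * (1 + norm x + norm y) \<and> 1 + norm x + norm y \<le> D * R i"
    and finite_meeting: "\<And>M. finite {i\<in>I. \<exists>x y. norm x \<le> M \<and> norm y \<le> M \<and>
       (\<forall>j. \<bar>x $ j / s i - P i $ j\<bar> \<le> 1/8 \<and> \<bar>y $ j / s i - Q i $ j\<bar> \<le> 1/8)}"
begin

definition active :: "'i \<Rightarrow> real ^ 'n \<Rightarrow> real ^ 'n \<Rightarrow> bool" where
  "active i x y \<longleftrightarrow> (\<forall>j. \<bar>x $ j / s i - P i $ j\<bar> \<le> 1/8 \<and> \<bar>y $ j / s i - Q i $ j\<bar> \<le> 1/8)"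

text \<open>\<open>bump c r k\<close> is the k-th derivative of t |-> \<theta>(t/r - c).\<close>

definition bump :: "real \<Rightarrow> real \<Rightarrow> nat \<Rightarrow> real \<Rightarrow> complex" where
  "bump c r k t = of_real (1 / r ^ k) * (vderiv ^^ k) \<theta> (t / r - c)"

definition symbol :: "real ^ 'n \<Rightarrow> real ^ 'n \<Rightarrow> real ^ 'n \<Rightarrow> complex" where
  "symbol x \<xi>1 \<xi>2 = (\<Sum>\<^sub>\<infinity>i\<in>I. amp i * ((\<Prod>j\<in>UNIV. \<theta> (\<xi>1 $ j / s i - P i $ j)) * (\<Prod>j\<in>UNIV. \<theta> (\<xi>2 $ j / s i - Q i $ j))))"

lemma s_pos: "i \<in> I \<Longrightarrow> s i > 0"
  using R[of i] s[of i] by force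

lemma bump_deriv:
  assumes "r \<noteq> 0"
  shows "(bump c r k has_vector_derivative bump c r (Suc k) t) (at t)"
proof -
  have "((\<lambda>t. t / r - c) has_vector_derivative (1 / r)) (at t)"
    using assms by (auto intro!: derivative_eq_intros simp: has_vector_derivative_def)
  from vector_diff_chain_at[OF this smooth1_vderiv(1)[OF smooth1_funpow[OF \<theta>(1), of k]]]
  have "((\<lambda>t. (vderiv ^^ k) \<theta> (t / r - c)) has_vector_derivative (1 / r) *\<^sub>R (vderiv ^^ Suc k) \<theta> (t / r - c)) (at t)"
    by (simp add: o_def)
  from has_vector_derivative_mult_right[OF this, of "of_real (1 / r ^ k)"]
  show ?thesis
    using assms unfolding bump_def[abs_def] by (simp add: scaleR_conv_of_real field_simps)
qed

lemma bump_eq_0: "\<not> \<bar>t / r - c\<bar> \<le> 1/8 \<Longrightarrow> bump c r k t = 0"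
proof -
  assume *: "\<not> \<bar>t / r - c\<bar> \<le> 1/8"
  have "open {u. 1/8 < \<bar>u::real\<bar>}" by (intro open_Collect_less continuous_intros)
  from funpow_vderiv_eq_0[OF this, of \<theta> "t / r - c" k] show ?thesis
    using * \<theta>(2) by (simp add: bump_def)
qed

lemma bump_bound: "\<exists>B. \<forall>k. B k \<ge> 0 \<and> (\<forall>r>0. \<forall>c t. norm (bump c r k t) \<le> B k / r ^ k)"
proof -
  have tf: "test_fun \<theta>" unfolding test_fun_def using \<theta> by blast
  have "\<exists>B\<ge>0. \<forall>u. norm ((vderiv ^^ k) \<theta> u) \<le> B" for k
  proof -
    obtain M where M: "M > 0" "\<And>u. M \<le> \<bar>u\<bar> \<Longrightarrow> (vderiv ^^ k) \<theta> u = 0"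
      using test_fun_support[OF test_fun_funpow[OF tf]] by blast
    have "compact ((vderiv ^^ k) \<theta> ` {-M..M})"
      by (intro compact_continuous_image test_fun_continuous test_fun_funpow tf) auto
    then obtain B where B: "\<And>u. u \<in> {-M..M} \<Longrightarrow> norm ((vderiv ^^ k) \<theta> u) \<le> B"
      by (force dest: compact_imp_bounded simp: bounded_iff)
    have "norm ((vderiv ^^ k) \<theta> u) \<le> max B 0" for u
      using M(2)[of u] B[of u] by (cases "\<bar>u\<bar> \<le> M") (auto simp: abs_le_iff le_max_iff_disj)
    then show ?thesis by (meson max.cobounded2)
  qed
  then obtain B where "\<And>k. B k \<ge> 0" "\<And>k u. norm ((vderiv ^^ k) \<theta> u) \<le> B k" by metis
  then show ?thesis
  proof (intro exI[of _ B] allI conjI impI)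
    fix k t and r c :: real
    assume B: "\<And>k. B k \<ge> 0" "\<And>k u. norm ((vderiv ^^ k) \<theta> u) \<le> B k" and r: "r > 0"
    have "norm (bump c r k t) = (1 / r ^ k) * norm ((vderiv ^^ k) \<theta> (t / r - c))"
      unfolding bump_def norm_mult norm_of_real using r by simp
    also have "\<dots> \<le> (1 / r ^ k) * B k" using r B by (intro mult_left_mono) auto
    finally show "norm (bump c r k t) \<le> B k / r ^ k" by simp
  qed
qed

definition summand where
  "summand \<beta>1 \<beta>2 i \<xi>1 \<xi>2 = amp i * ((\<Prod>j\<in>UNIV. bump (P i $ j) (s i) (\<beta>1 j) (\<xi>1 $ j)) *
     (\<Prod>j\<in>UNIV. bump (Q i $ j) (s i) (\<beta>2 j) (\<xi>2 $ j)))"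

lemma symbol_eq: "symbol x \<xi>1 \<xi>2 = (\<Sum>\<^sub>\<infinity>i\<in>I. summand (\<lambda>_. 0) (\<lambda>_. 0) i \<xi>1 \<xi>2)"
  by (simp add: symbol_def summand_def bump_def)

lemma summand_eq_0: "\<not> active i \<xi>1 \<xi>2 \<Longrightarrow> summand \<beta>1 \<beta>2 i \<xi>1 \<xi>2 = 0"
  using bump_eq_0 by (force simp: summand_def active_def)

definition meets where "meets M = {i\<in>I. \<exists>x y. norm x \<le> M \<and> norm y \<le> M \<and> active i x y}"

lemma finite_meets: "finite (meets M)"
  using finite_meeting[of M] by (simp add: meets_def active_def)

lemma summand_eq_0_not_meets:
  "i \<in> I - meets M \<Longrightarrow> norm \<xi>1 \<le> M \<Longrightarrow> norm \<xi>2 \<le> M \<Longrightarrow> summand \<beta>1 \<beta>2 i \<xi>1 \<xi>2 = 0"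
  by (rule summand_eq_0) (auto simp: meets_def)

lemma norm_ball_le: "y \<in> ball z 1 \<Longrightarrow> norm y \<le> norm z + 1" for y z :: "'b::real_normed_vector"
  using norm_triangle_sub[of y z] by (simp add: dist_norm norm_minus_commute)

text \<open>The symbol class nests derivatives in separate variables but asks for joint smoothness,
  so the same sum is viewed in three ways: with the second frequency frozen into the coefficient,
  with the first one frozen, and on the triple product.\<close>

lemma tensor_sum_first:
  "tensor_sum I (\<lambda>i. amp i * (\<Prod>j\<in>UNIV. bump (Q i $ j) (s i) (\<beta>2 j) (\<xi>2 $ j))) (\<lambda>i b. bump (P i \<bullet> b) (s i))"
proof
  show "(bump (P i \<bullet> b) (s i) k has_vector_derivative bump (P i \<bullet> b) (s i) (Suc k) t) (at t)" if "i \<in> I" for i b k t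
    using s_pos[OF that] by (intro bump_deriv) auto
next
  fix z :: "real ^ 'n"
  let ?M = "max (norm z + 1) (norm \<xi>2)"
  have "amp i * (\<Prod>j\<in>UNIV. bump (Q i $ j) (s i) (\<beta>2 j) (\<xi>2 $ j)) * (\<Prod>b\<in>Basis. bump (P i \<bullet> b) (s i) (\<beta> b) (y \<bullet> b)) = 0"
    if "y \<in> ball z 1" "i \<in> I - meets ?M" for y i \<beta>
    using summand_eq_0_not_meets[OF that(2), of y \<xi>2 "\<lambda>j. \<beta> (axis j 1)" \<beta>2] norm_ball_le[OF that(1)]
    by (auto simp: summand_def prod_Basis_cart inner_axis)
  then show "\<exists>e>0. \<exists>J\<subseteq>I. finite J \<and> (\<forall>y\<in>ball z e. \<forall>i\<in>I - J. \<forall>\<beta>.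
      amp i * (\<Prod>j\<in>UNIV. bump (Q i $ j) (s i) (\<beta>2 j) (\<xi>2 $ j)) * (\<Prod>b\<in>Basis. bump (P i \<bullet> b) (s i) (\<beta> b) (y \<bullet> b)) = 0)"
    using finite_meets[of ?M] by (intro exI[of _ 1] conjI exI[of _ "meets ?M"]) (auto simp: meets_def)
qed

lemma tensor_sum_second:
  "tensor_sum I (\<lambda>i. amp i * (\<Prod>j\<in>UNIV. bump (P i $ j) (s i) (\<beta>1 j) (\<xi>1 $ j))) (\<lambda>i b. bump (Q i \<bullet> b) (s i))"
proof
  show "(bump (Q i \<bullet> b) (s i) k has_vector_derivative bump (Q i \<bullet> b) (s i) (Suc k) t) (at t)" if "i \<in> I" for i b k t
    using s_pos[OF that] by (intro bump_deriv) auto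
next
  fix z :: "real ^ 'n"
  let ?M = "max (norm z + 1) (norm \<xi>1)"
  have "amp i * (\<Prod>j\<in>UNIV. bump (P i $ j) (s i) (\<beta>1 j) (\<xi>1 $ j)) * (\<Prod>b\<in>Basis. bump (Q i \<bullet> b) (s i) (\<beta> b) (y \<bullet> b)) = 0"
    if "y \<in> ball z 1" "i \<in> I - meets ?M" for y i \<beta>
    using summand_eq_0_not_meets[OF that(2), of \<xi>1 y \<beta>1 "\<lambda>j. \<beta> (axis j 1)"] norm_ball_le[OF that(1)]
    by (auto simp: summand_def prod_Basis_cart inner_axis)
  then show "\<exists>e>0. \<exists>J\<subseteq>I. finite J \<and> (\<forall>y\<in>ball z e. \<forall>i\<in>I - J. \<forall>\<beta>.
      amp i * (\<Prod>j\<in>UNIV. bump (P i $ j) (s i) (\<beta>1 j) (\<xi>1 $ j)) * (\<Prod>b\<in>Basis. bump (Q i \<bullet> b) (s i) (\<beta> b) (y \<bullet> b)) = 0)"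
    using finite_meets[of ?M] by (intro exI[of _ 1] conjI exI[of _ "meets ?M"]) (auto simp: meets_def)
qed

lemma multi_deriv_first:
  "multi_deriv \<beta> (\<lambda>\<xi>1. \<Sum>\<^sub>\<infinity>i\<in>I. summand (\<lambda>_. 0) \<beta>2 i \<xi>1 \<xi>2) = (\<lambda>\<xi>1. \<Sum>\<^sub>\<infinity>i\<in>I. summand (($) \<beta>) \<beta>2 i \<xi>1 \<xi>2)"
  using multi_deriv_TS[OF tensor_sum_first[of \<beta>2 \<xi>2], of \<beta>]
  by (simp add: summand_def inner_axis mult_ac)

lemma multi_deriv_second:
  "multi_deriv \<beta> (\<lambda>\<xi>2. \<Sum>\<^sub>\<infinity>i\<in>I. summand \<beta>1 (\<lambda>_. 0) i \<xi>1 \<xi>2) = (\<lambda>\<xi>2. \<Sum>\<^sub>\<infinity>i\<in>I. summand \<beta>1 (($) \<beta>) i \<xi>1 \<xi>2)"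
  using multi_deriv_TS[OF tensor_sum_second[of \<beta>1 \<xi>1], of \<beta>]
  by (simp add: summand_def inner_axis mult_ac)

text \<open>A basis vector of the triple product has exactly one nonzero component, which tells the
  variable it belongs to. In x the factor is the constant 1, whose derivatives of positive order are
  0.\<close>

definition joint where
  "joint i b k = (if fst b \<noteq> 0 then (\<lambda>_. if k = 0 then 1 else 0)
     else if fst (snd b) \<noteq> 0 then bump (P i \<bullet> fst (snd b)) (s i) k else bump (Q i \<bullet> snd (snd b)) (s i) k)"
  for b :: "(real ^ 'n) \<times> (real ^ 'n) \<times> (real ^ 'n)"

lemma prod_joint:
  "amp i * (\<Prod>b\<in>Basis. joint i b (\<beta> b) ((x, \<xi>1, \<xi>2) \<bullet> b)) =
     (\<Prod>u\<in>Basis. if \<beta> (u, 0, 0) = 0 then 1 else 0) *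
     summand (\<lambda>j. \<beta> (0, axis j 1, 0)) (\<lambda>j. \<beta> (0, 0, axis j 1)) i \<xi>1 \<xi>2"
proof -
  have "(\<Prod>b\<in>Basis. joint i b (\<beta> b) ((x, \<xi>1, \<xi>2) \<bullet> b)) =
     (\<Prod>u\<in>Basis. if \<beta> (u, 0, 0) = 0 then 1 else 0) *
     ((\<Prod>u\<in>Basis. bump (P i \<bullet> u) (s i) (\<beta> (0, u, 0)) (\<xi>1 \<bullet> u)) *
      (\<Prod>u\<in>Basis. bump (Q i \<bullet> u) (s i) (\<beta> (0, 0, u)) (\<xi>2 \<bullet> u)))"
    unfolding prod_Basis_prod
    by (intro arg_cong2[where f = "(*)"] prod.cong refl) (auto simp: joint_def zero_prod_def)
  then show ?thesis by (simp add: summand_def prod_Basis_cart inner_axis mult_ac)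
qed

lemma tensor_sum_joint: "tensor_sum I amp joint"
proof
  show "(joint i b k has_vector_derivative joint i b (Suc k) t) (at t)" if "i \<in> I" for i b k t
    using s_pos[OF that] bump_deriv by (auto simp: joint_def)
next
  fix z :: "(real ^ 'n) \<times> (real ^ 'n) \<times> (real ^ 'n)"
  let ?M = "norm z + 1"
  have "amp i * (\<Prod>b\<in>Basis. joint i b (\<beta> b) (y \<bullet> b)) = 0" if y: "y \<in> ball z 1" "i \<in> I - meets ?M" for y i \<beta>
  proof -
    obtain x \<xi>1 \<xi>2 where y': "y = (x, \<xi>1, \<xi>2)" by (cases y)
    have "norm \<xi>1 \<le> norm y" "norm \<xi>2 \<le> norm y"
      using norm_snd_le[of y x] norm_fst_le[of \<xi>1 \<xi>2] norm_snd_le[of \<xi>2 \<xi>1] norm_snd_le[of "(\<xi>1, \<xi>2)" x]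
      unfolding y' by linarith+
    then have "norm \<xi>1 \<le> ?M" "norm \<xi>2 \<le> ?M" using norm_ball_le[OF y(1)] by linarith+
    then show ?thesis unfolding y' prod_joint using summand_eq_0_not_meets[OF y(2)] by simp
  qed
  then show "\<exists>e>0. \<exists>J\<subseteq>I. finite J \<and> (\<forall>y\<in>ball z e. \<forall>i\<in>I - J. \<forall>\<beta>.
      amp i * (\<Prod>b\<in>Basis. joint i b (\<beta> b) (y \<bullet> b)) = 0)"
    using finite_meets[of ?M] by (intro exI[of _ 1] conjI exI[of _ "meets ?M"]) (auto simp: meets_def)
qed

lemma smooth_symbol: "smooth (\<lambda>(x, \<xi>1, \<xi>2). symbol x \<xi>1 \<xi>2)"
proof -
  interpret tensor_sum I amp joint by (rule tensor_sum_joint)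
  have "TS (\<lambda>_. 0) = (\<lambda>(x, \<xi>1, \<xi>2). symbol x \<xi>1 \<xi>2)"
    by (auto simp: TS_def fun_eq_iff symbol_eq prod_joint)
  then show ?thesis using smooth_TS by metis
qed

text \<open>At each point at most one bump is active, so no summation occurs: its derivative has
  size R^m s^(-N) = R^(m - \<rho> N) for N frequency derivatives, and R is comparable to 1 +
  |\<xi>1| + |\<xi>2|.\<close>

lemma symbol_in_BS: "symbol \<in> BS m \<rho>"
proof -
  obtain B where B: "\<And>k. B k \<ge> 0" "\<And>k r c t. r > 0 \<Longrightarrow> norm (bump c r k t) \<le> B k / r ^ k"
    using bump_bound by metis
  have main: "\<exists>C. \<forall>x \<xi>1 \<xi>2. norm (multi_deriv \<alpha> (\<lambda>x. multi_deriv \<beta>1 (\<lambda>\<xi>1. multi_deriv \<beta>2 (\<lambda>\<xi>2. symbol x \<xi>1 \<xi>2) \<xi>2) \<xi>1) x)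
        \<le> C * (1 + norm \<xi>1 + norm \<xi>2) powr (m + \<rho> * real (multi_abs \<alpha>) - \<rho> * real (multi_abs \<beta>1 + multi_abs \<beta>2))"
    for \<alpha> \<beta>1 \<beta>2 :: "nat ^ 'n"
  proof -
    have eq: "multi_deriv \<alpha> (\<lambda>x. multi_deriv \<beta>1 (\<lambda>\<xi>1. multi_deriv \<beta>2 (\<lambda>\<xi>2. symbol x \<xi>1 \<xi>2) \<xi>2) \<xi>1) x =
       (if multi_abs \<alpha> = 0 then \<Sum>\<^sub>\<infinity>i\<in>I. summand (($) \<beta>1) (($) \<beta>2) i \<xi>1 \<xi>2 else 0)" for x \<xi>1 \<xi>2
      unfolding symbol_eq multi_deriv_second multi_deriv_first multi_deriv_const by simp
    define e where "e = m - \<rho> * real (multi_abs \<beta>1 + multi_abs \<beta>2)"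
    define K where "K = (\<Prod>j\<in>UNIV. B (\<beta>1 $ j)) * (\<Prod>j\<in>UNIV. B (\<beta>2 $ j))"
    have K: "K \<ge> 0" unfolding K_def by (intro mult_nonneg_nonneg prod_nonneg B)
    have "norm (\<Sum>\<^sub>\<infinity>i\<in>I. summand (($) \<beta>1) (($) \<beta>2) i \<xi>1 \<xi>2) \<le> K * D powr \<bar>e\<bar> * (1 + norm \<xi>1 + norm \<xi>2) powr e" for \<xi>1 \<xi>2
    proof (cases "\<exists>i\<in>I. active i \<xi>1 \<xi>2")
      case False
      then have "(\<Sum>\<^sub>\<infinity>i\<in>I. summand (($) \<beta>1) (($) \<beta>2) i \<xi>1 \<xi>2) = 0"
        by (intro infsum_0 summand_eq_0) auto
      then show ?thesis using K by simp
    next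
      case True
      then obtain i where i: "i \<in> I" "active i \<xi>1 \<xi>2" by blast
      have "(\<Sum>\<^sub>\<infinity>i\<in>I. summand (($) \<beta>1) (($) \<beta>2) i \<xi>1 \<xi>2) = (\<Sum>\<^sub>\<infinity>i\<in>{i}. summand (($) \<beta>1) (($) \<beta>2) i \<xi>1 \<xi>2)"
      proof (rule infsum_cong_neutral)
        show "summand (($) \<beta>1) (($) \<beta>2) i' \<xi>1 \<xi>2 = 0" if "i' \<in> I - {i}" for i'
        proof (rule summand_eq_0)
          show "\<not> active i' \<xi>1 \<xi>2" using inj[of i i' \<xi>1 \<xi>2] i that by (auto simp: active_def)
        qed
      qed (use i in auto)
      also have "\<dots> = summand (($) \<beta>1) (($) \<beta>2) i \<xi>1 \<xi>2" by simp
      also have "norm \<dots> \<le> R i powr m * ((\<Prod>j\<in>UNIV. B (\<beta>1 $ j) / s i ^ (\<beta>1 $ j)) * (\<Prod>j\<in>UNIV. B (\<beta>2 $ j) / s i ^ (\<beta>2 $ j)))"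
        unfolding summand_def norm_mult prod_norm[symmetric]
        by (intro mult_mono amp i prod_mono conjI norm_ge_zero B s_pos prod_nonneg mult_nonneg_nonneg powr_ge_zero divide_nonneg_pos zero_less_power ballI)
      also have "\<dots> = K * (R i powr m / s i ^ (multi_abs \<beta>1 + multi_abs \<beta>2))"
        by (simp add: K_def prod_dividef power_sum multi_abs_def power_add)
      also have "R i powr m / s i ^ (multi_abs \<beta>1 + multi_abs \<beta>2) = R i powr e"
      proof -
        have "s i ^ (multi_abs \<beta>1 + multi_abs \<beta>2) = R i powr (\<rho> * real (multi_abs \<beta>1 + multi_abs \<beta>2))"
          using powr_realpow[OF s_pos[OF i(1)], of "multi_abs \<beta>1 + multi_abs \<beta>2"] s[OF i(1)]
          by (simp add: powr_powr)
        then show ?thesis by (simp only: e_def powr_diff)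
      qed
      \<comment> \<open>The sign of the exponent decides which half of the comparability is used;
        either way the loss is D^|e|.\<close>
      also have "R i powr e \<le> D powr \<bar>e\<bar> * (1 + norm \<xi>1 + norm \<xi>2) powr e"
      proof -
        let ?x = "1 + norm \<xi>1 + norm \<xi>2"
        have c: "R i \<le> D * ?x" "?x \<le> D * R i" using comparable[OF i(1), of \<xi>1 \<xi>2] i(2) by (auto simp: active_def)
        have x: "?x > 0" by (simp add: add_pos_nonneg)
        show ?thesis
        proof (cases "e \<ge> 0")
          case True
          have "R i powr e \<le> (D * ?x) powr e" using True R[OF i(1)] c by (intro powr_mono2) auto
          then show ?thesis using True by (simp add: powr_mult)
        next
          case False
          have "?x / D \<le> R i" using c(2) D by (simp add: field_simps)
          then have "R i powr e \<le> (?x / D) powr e" using False x D by (intro powr_mono2') auto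
          also have "\<dots> = D powr \<bar>e\<bar> * ?x powr e" using False by (simp only: powr_divide) (simp add: powr_minus divide_inverse)
          finally show ?thesis .
        qed
      qed
      finally show ?thesis using K by (simp add: mult_left_mono mult.assoc)
    qed
    then show ?thesis
      using K by (intro exI[of _ "K * D powr \<bar>e\<bar>"]) (auto simp: eq e_def)
  qed
  show ?thesis unfolding BS_def using smooth_symbol main by blast
qed

end

lemma ift_shift:
  assumes "r > 0"
  shows "ift (\<lambda>u. \<eta> (u / r - a) / of_real r) x = cis (a * (r * x)) * ift \<eta> (r * x)"
proof -
  have "ift (\<lambda>u. \<eta> (u / r - a) / of_real r) x =
      r *\<^sub>R (LINT u|lborel. cis (x * (r * a + r * u)) * (\<eta> ((r * a + r * u) / r - a) / of_real r))"
    unfolding ift_def using assms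
    by (subst lborel_integral_real_affine[where c = r and t = "r * a"]) simp_all
  also have "\<dots> = (LINT u|lborel. cis (a * (r * x)) * (cis (r * x * u) * \<eta> u))"
    unfolding Bochner_Integration.integral_scaleR_right[symmetric]
  proof (rule Bochner_Integration.integral_cong[OF refl])
    fix u
    have "(r * a + r * u) / r - a = u" using assms by (simp add: field_simps)
    moreover have "cis (x * (r * a + r * u)) = cis (a * (r * x)) * cis (r * x * u)"
      by (simp add: cis_mult algebra_simps)
    ultimately show "r *\<^sub>R (cis (x * (r * a + r * u)) * (\<eta> ((r * a + r * u) / r - a) / of_real r)) =
        cis (a * (r * x)) * (cis (r * x * u) * \<eta> u)"
      using assms by (simp add: scaleR_conv_of_real)
  qed
  finally show ?thesis by (simp add: ift_def)
qed

context symbol_data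
begin

text \<open>Only the bumps in \<open>J\<close> meet the spectrum of the first input, so the
  integrand is a finite sum of tensor products. The powers of 2 pi from the two Fourier transforms
  cancel the normalisation of the operator.\<close>

lemma T_op_symbol:
  assumes v: "test_fun v1" "test_fun v2" and J: "finite J" "J \<subseteq> I"
    and zero: "\<And>i \<xi>1 \<xi>2. i \<in> I - J \<Longrightarrow> (\<Prod>j\<in>UNIV. \<theta> (\<xi>1 $ j / s i - P i $ j)) * (\<Prod>j\<in>UNIV. v1 (\<xi>1 $ j)) = 0"
  shows "T_op symbol (tensor_ift (\<lambda>_. v1)) (tensor_ift (\<lambda>_. v2)) x =
    (\<Sum>i\<in>J. amp i * (\<Prod>j\<in>UNIV. ift (\<lambda>u. \<theta> (u / s i - P i $ j) * v1 u) (x $ j) *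
        ift (\<lambda>u. \<theta> (u / s i - Q i $ j) * v2 u) (x $ j)))"
proof -
  define g where "g c r v y u = cis (y * u) * (\<theta> (u / r - c) * (2 * pi * v u))" for c r y u and v :: "real \<Rightarrow> complex"
  have g_int: "integrable lborel (g c (s i) v y)" if "test_fun v" "i \<in> I" for v y c i
  proof -
    have "smooth1 (\<lambda>u. \<theta> (1 / s i * u + (- c)))" by (rule smooth1_affine[OF \<theta>(1)])
    then have "test_fun (\<lambda>u. \<theta> (u / s i - c) * (2 * pi * v u))"
      using that by (intro test_fun_mult smooth1_const) auto
    from integrable_cis_mult[OF test_fun_integrable[OF this], of "\<lambda>u. y * u"]
    show ?thesis by (simp add: g_def[abs_def])
  qed
  have g_ift: "(LINT u|lborel. g c r v y u) = 2 * pi * ift (\<lambda>u. \<theta> (u / r - c) * v u) y" for c r v y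
    unfolding ift_def Bochner_Integration.integral_mult_right_zero[symmetric]
    by (intro Bochner_Integration.integral_cong refl) (simp add: g_def mult_ac)
  define A where "A i \<xi> = (\<Prod>j\<in>UNIV. g (P i $ j) (s i) v1 (x $ j) (\<xi> $ j))" for i and \<xi> :: "real ^ 'n"
  define B where "B i \<xi> = (\<Prod>j\<in>UNIV. g (Q i $ j) (s i) v2 (x $ j) (\<xi> $ j))" for i and \<xi> :: "real ^ 'n"
  have A_int: "integrable lborel (A i)" and B_int: "integrable lborel (B i)" if "i \<in> I" for i
    unfolding A_def[abs_def] B_def[abs_def] using that v g_int by (auto intro!: integral_tensor(1))
  have A: "(LINT \<xi>|lborel. A i \<xi>) = (\<Prod>j\<in>UNIV. 2 * pi * ift (\<lambda>u. \<theta> (u / s i - P i $ j) * v1 u) (x $ j))" if "i \<in> I" for i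
    unfolding A_def integral_tensor(2)[OF g_int[OF v(1) that]] g_ift ..
  have B: "(LINT \<xi>|lborel. B i \<xi>) = (\<Prod>j\<in>UNIV. 2 * pi * ift (\<lambda>u. \<theta> (u / s i - Q i $ j) * v2 u) (x $ j))" if "i \<in> I" for i
    unfolding B_def integral_tensor(2)[OF g_int[OF v(2) that]] g_ift ..
  have integrand: "exp (\<i> * of_real (x \<bullet> (\<xi>1 + \<xi>2))) * symbol x \<xi>1 \<xi>2 *
      fourier (tensor_ift (\<lambda>_. v1)) \<xi>1 * fourier (tensor_ift (\<lambda>_. v2)) \<xi>2 = (\<Sum>i\<in>J. amp i * (A i \<xi>1 * B i \<xi>2))" for \<xi>1 \<xi>2
  proof -
    let ?t = "\<lambda>i. amp i * ((\<Prod>j\<in>UNIV. \<theta> (\<xi>1 $ j / s i - P i $ j)) * (\<Prod>j\<in>UNIV. \<theta> (\<xi>2 $ j / s i - Q i $ j)))"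
    let ?F1 = "\<Prod>j\<in>UNIV. 2 * pi * v1 (\<xi>1 $ j)" and ?F2 = "\<Prod>j\<in>UNIV. 2 * pi * v2 (\<xi>2 $ j)"
    \<comment> \<open>The infinite sum collapses to \<open>J\<close> only where the first input is
      nonzero, so the two are multiplied before any rearrangement.\<close>
    have "symbol x \<xi>1 \<xi>2 * ?F1 = (\<Sum>i\<in>J. ?t i) * ?F1"
    proof (cases "(\<Prod>j\<in>UNIV. v1 (\<xi>1 $ j)) = 0")
      case False
      then have "?t i = 0" if "i \<in> I - J" for i using zero[OF that, of \<xi>1] by simp
      then have "symbol x \<xi>1 \<xi>2 = (\<Sum>\<^sub>\<infinity>i\<in>J. ?t i)"
        unfolding symbol_def using J by (intro infsum_cong_neutral) auto
      then show ?thesis using J by simp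
    qed (auto simp: prod.distrib)
    moreover have "exp (\<i> * of_real (x \<bullet> (\<xi>1 + \<xi>2))) = (\<Prod>j\<in>UNIV. cis (x $ j * \<xi>1 $ j)) * (\<Prod>j\<in>UNIV. cis (x $ j * \<xi>2 $ j))"
      unfolding inner_add_right of_real_add distrib_left exp_add exp_inner_eq_prod cis_conv_exp ..
    ultimately have "exp (\<i> * of_real (x \<bullet> (\<xi>1 + \<xi>2))) * symbol x \<xi>1 \<xi>2 * ?F1 * ?F2 =
        (\<Prod>j\<in>UNIV. cis (x $ j * \<xi>1 $ j)) * (\<Prod>j\<in>UNIV. cis (x $ j * \<xi>2 $ j)) * ((\<Sum>i\<in>J. ?t i) * ?F1) * ?F2"
      by (simp only: mult.assoc[of _ "symbol x \<xi>1 \<xi>2" ?F1])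
    also have "\<dots> = (\<Sum>i\<in>J. amp i * (A i \<xi>1 * B i \<xi>2))"
      unfolding sum_distrib_left sum_distrib_right
      by (intro sum.cong refl) (simp add: A_def B_def g_def prod.distrib mult_ac)
    finally show ?thesis by (simp only: fourier_tensor_ift v)
  qed
  have "(LINT (\<xi>1, \<xi>2)|(lborel \<Otimes>\<^sub>M lborel). exp (\<i> * of_real (x \<bullet> (\<xi>1 + \<xi>2))) * symbol x \<xi>1 \<xi>2 *
      fourier (tensor_ift (\<lambda>_. v1)) \<xi>1 * fourier (tensor_ift (\<lambda>_. v2)) \<xi>2) =
      (LINT p|(lborel \<Otimes>\<^sub>M lborel). (\<Sum>i\<in>J. amp i * (case p of (\<xi>1, \<xi>2) \<Rightarrow> A i \<xi>1 * B i \<xi>2)))"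
    unfolding integrand by (intro Bochner_Integration.integral_cong refl) (auto simp: split_beta)
  also have "\<dots> = (\<Sum>i\<in>J. amp i * ((LINT \<xi>|lborel. A i \<xi>) * (LINT \<xi>|lborel. B i \<xi>)))"
    using J by (subst Bochner_Integration.integral_sum)
      (auto simp: pair_integrable_mult(2)[OF A_int B_int] subset_iff intro!: integrable_mult_right pair_integrable_mult(1) A_int B_int)
  also have "\<dots> = (\<Sum>i\<in>J. (2 * pi) ^ (2 * CARD('n)) * (amp i * (\<Prod>j\<in>UNIV. ift (\<lambda>u. \<theta> (u / s i - P i $ j) * v1 u) (x $ j) *
        ift (\<lambda>u. \<theta> (u / s i - Q i $ j) * v2 u) (x $ j))))"
  proof (rule sum.cong[OF refl])
    fix i assume "i \<in> J"
    then have i: "i \<in> I" using J by blast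
    have c2: "2 * CARD('n) = CARD('n) + CARD('n)" by simp
    show "amp i * ((LINT \<xi>|lborel. A i \<xi>) * (LINT \<xi>|lborel. B i \<xi>)) =
        (2 * pi) ^ (2 * CARD('n)) * (amp i * (\<Prod>j\<in>UNIV. ift (\<lambda>u. \<theta> (u / s i - P i $ j) * v1 u) (x $ j) *
        ift (\<lambda>u. \<theta> (u / s i - Q i $ j) * v2 u) (x $ j)))"
      unfolding A[OF i] B[OF i] prod.distrib prod_constant c2 power_add
        of_real_mult[of "(2 * pi) ^ CARD('n)" "(2 * pi) ^ CARD('n)"] of_real_power by (simp only: mult_ac)
  qed
  finally show ?thesis
    unfolding T_op_def by (simp flip: sum_distrib_left)
qed

end

section \<open>Lattice symbols\<close>

definition freq :: "real \<Rightarrow> nat \<Rightarrow> real" where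
  "freq \<rho> k = (8 powr (1 / (1 - \<rho>))) ^ k"

definition spacing :: "real \<Rightarrow> nat \<Rightarrow> real" where
  "spacing \<rho> k = freq \<rho> k powr \<rho>"

lemma freq_pos: "freq \<rho> k > 0"
  by (simp add: freq_def)

lemma spacing_pos: "spacing \<rho> k > 0"
  using freq_pos[of \<rho> k] by (simp add: spacing_def)

lemma freq_eq:
  assumes "\<rho> < 1"
  shows "freq \<rho> k = (8 ^ k) powr (1 / (1 - \<rho>))"
proof -
  have "freq \<rho> k = 8 powr (1 / (1 - \<rho>) * real k)"
    unfolding freq_def by (subst powr_realpow[symmetric]) (simp_all add: powr_powr)
  also have "\<dots> = (8 powr real k) powr (1 / (1 - \<rho>))" by (simp add: powr_powr mult.commute)
  finally show ?thesis by (simp add: powr_realpow)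
qed

lemma spacing_eq:
  assumes "\<rho> < 1"
  shows "spacing \<rho> k = (8 ^ k) powr (\<rho> / (1 - \<rho>))"
  unfolding spacing_def freq_eq[OF assms] by (simp add: powr_powr)

lemma freq_spacing:
  assumes "\<rho> < 1"
  shows "freq \<rho> k = spacing \<rho> k * 8 ^ k"
proof -
  have "1 / (1 - \<rho>) = \<rho> / (1 - \<rho>) + 1" using assms by (simp add: field_simps)
  then show ?thesis unfolding spacing_eq[OF assms] freq_eq[OF assms] by (simp add: powr_add)
qed

text \<open>The quotient of consecutive frequencies is 8^(1/(1-\<rho>)), at least 8; this keeps the
  shells apart.\<close>

lemma freq_ratio:
  assumes \<rho>: "0 < \<rho>" "\<rho> < 1" and "k < k'"
  shows "8 * freq \<rho> k \<le> freq \<rho> k'"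
proof -
  let ?g = "(8::real) powr (1 / (1 - \<rho>))"
  have g: "8 \<le> ?g" using \<rho> powr_mono[of 1 "1 / (1 - \<rho>)" 8] by (simp add: field_simps)
  have "8 * ?g ^ k \<le> ?g * ?g ^ k" using g by (intro mult_right_mono) auto
  also have "\<dots> = ?g ^ Suc k" by simp
  also have "\<dots> \<le> ?g ^ k'" using g assms(3) by (intro power_increasing) auto
  finally show ?thesis by (simp add: freq_def)
qed

lemma freq_ge:
  assumes "0 < \<rho>" "\<rho> < 1"
  shows "real k \<le> freq \<rho> k" "1 \<le> freq \<rho> k"
proof -
  have "(8::real) \<le> 8 powr (1 / (1 - \<rho>))" using assms powr_mono[of 1 "1 / (1 - \<rho>)" 8] by (simp add: field_simps)
  then have *: "8 ^ k \<le> freq \<rho> k" unfolding freq_def by (intro power_mono) auto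
  have "real k < 2 ^ k" by (rule of_nat_less_two_power)
  also have "(2::real) ^ k \<le> 8 ^ k" by (intro power_mono) auto
  finally show "real k \<le> freq \<rho> k" using * by linarith
  show "1 \<le> freq \<rho> k" using * one_le_power[of "8::real" k] by linarith
qed

text \<open>The ranges are chosen such that each \<open>j\<close> with \<open>3 * 8 ^ k \<le> j < 4 * 8 ^ k\<close> is a sum \<open>a + b\<close> with
  \<open>8 ^ k \<le> a < 2 * 8 ^ k\<close> and \<open>8 ^ k \<le> b < 3 * 8 ^ k\<close> in exactly \<open>8 ^ k\<close> ways.\<close>

definition lattice :: "(nat \<times> ('n \<Rightarrow> nat) \<times> ('n \<Rightarrow> nat)) set" where
  "lattice = {(k, p, q). (\<forall>j. 8 ^ k \<le> p j \<and> p j < 2 * 8 ^ k) \<and> (\<forall>j. 8 ^ k \<le> q j \<and> q j < 3 * 8 ^ k)}"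

text \<open>The margin 1/8 is harmless at both ends: p - 1/8 >= 7/8 * 8^k because 8^k >= 1, and p +
  1/8 < L * 8^k because p is an integer below L * 8^k.\<close>

lemma lattice_box:
  assumes \<rho>: "\<rho> < 1" and p: "8 ^ k \<le> (p::nat)" "p < L * 8 ^ k" and x: "\<bar>x / spacing \<rho> k - real p\<bar> \<le> 1/8"
  shows "7 / 8 * freq \<rho> k \<le> x" "x < real L * freq \<rho> k"
proof -
  have s: "spacing \<rho> k > 0" by (rule spacing_pos)
  have p': "(8::real) ^ k \<le> real p" "real p + 1 \<le> real L * 8 ^ k"
    using p(1) Suc_leI[OF p(2)] of_nat_mono[of "8 ^ k" p, where 'a = real]
      of_nat_mono[of "Suc p" "L * 8 ^ k", where 'a = real] by simp_all
  have one: "1 \<le> (8::real) ^ k" by simp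
  have x': "real p - 1/8 \<le> x / spacing \<rho> k" "x / spacing \<rho> k \<le> real p + 1/8" using x by linarith+
  have "7 / 8 * 8 ^ k \<le> x / spacing \<rho> k" using x'(1) p'(1) one by linarith
  then show "7 / 8 * freq \<rho> k \<le> x" unfolding freq_spacing[OF \<rho>] using s by (simp add: field_simps)
  have "x / spacing \<rho> k < real L * 8 ^ k" using x'(2) p'(2) by linarith
  then show "x < real L * freq \<rho> k" unfolding freq_spacing[OF \<rho>] using s by (simp add: field_simps)
qed

lemma norm_vec_le: "(\<And>j. \<bar>x $ j\<bar> \<le> B) \<Longrightarrow> norm (x :: real ^ 'n) \<le> real CARD('n) * B"
proof -
  assume "\<And>j. \<bar>x $ j\<bar> \<le> B"
  then have "(\<Sum>j\<in>UNIV. \<bar>x $ j\<bar>) \<le> (\<Sum>j\<in>(UNIV :: 'n set). B)" by (intro sum_mono)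
  then show ?thesis using norm_le_l1_cart[of x] by simp
qed

lemma nat_eq_if_close:
  assumes "\<bar>x - real a\<bar> \<le> 1/8" "\<bar>x - real b\<bar> \<le> 1/8"
  shows "a = b"
proof -
  have "real a < real (b + 1)" "real b < real (a + 1)" using assms by (simp_all, linarith+)
  then have "a < b + 1" "b < a + 1" by (simp_all only: of_nat_less_iff)
  then show ?thesis by simp
qed

text \<open>The constant 2 + 5n covers both comparisons: |x| <= 2nR, |y| <= 3nR and 1 <= R in one
  direction, R <= 2|x| in the other.\<close>

lemma symbol_data_lattice:
  fixes c :: "nat \<Rightarrow> nat \<Rightarrow> nat \<Rightarrow> real"
  assumes \<rho>: "0 < \<rho>" "\<rho> < 1"
    and \<theta>: "smooth1 \<theta>" "\<And>u. 1/8 \<le> \<bar>u\<bar> \<Longrightarrow> \<theta> u = 0"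
    and c: "\<And>k a b. \<bar>c k a b\<bar> \<le> 1"
  shows "symbol_data (lattice :: (nat \<times> ('n::finite \<Rightarrow> nat) \<times> ('n \<Rightarrow> nat)) set)
    (\<lambda>(k, p, q). of_real (freq \<rho> k powr m * (\<Prod>j\<in>UNIV. c k (p j) (q j))))
    (\<lambda>(k, _). spacing \<rho> k) (\<lambda>(k, _). freq \<rho> k)
    (\<lambda>(k, p, q). \<chi> j. real (p j)) (\<lambda>(k, p, q). \<chi> j. real (q j)) \<theta> m \<rho> (2 + 5 * real CARD('n))"
proof (unfold_locales, goal_cases)
  case (3 i)
  then show ?case by (auto simp: freq_pos split: prod.split)
next
  case (4 i)
  then show ?case by (auto simp: spacing_def split: prod.split)
next
  case (5 i)
  obtain k p q where i: "i = (k, p, q)" by (cases i)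
  have "\<bar>\<Prod>j\<in>UNIV. c k (p j) (q j)\<bar> \<le> 1"
    unfolding abs_prod using c by (intro prod_le_1) auto
  then show ?case
    using freq_pos[of \<rho> k] by (simp add: i norm_mult abs_mult mult_left_le flip: of_real_mult of_real_prod)
next
  case (7 i i' x y)
  obtain k p q where i: "i = (k, p, q)" by (cases i)
  obtain k' p' q' where i': "i' = (k', p', q')" by (cases i')
  have 1: "8 ^ k \<le> p j" "p j < 2 * 8 ^ k" "8 ^ k' \<le> p' j" "p' j < 2 * 8 ^ k'" for j
    using 7 by (auto simp: lattice_def i i')
  have 2: "\<bar>x $ j / spacing \<rho> k - real (p j)\<bar> \<le> 1/8" "\<bar>y $ j / spacing \<rho> k - real (q j)\<bar> \<le> 1/8"
    "\<bar>x $ j / spacing \<rho> k' - real (p' j)\<bar> \<le> 1/8" "\<bar>y $ j / spacing \<rho> k' - real (q' j)\<bar> \<le> 1/8" for j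
    using 7(3,4) by (auto simp: i i')
  have b: "7 / 8 * freq \<rho> k \<le> x $ j" "x $ j < 2 * freq \<rho> k" "7 / 8 * freq \<rho> k' \<le> x $ j" "x $ j < 2 * freq \<rho> k'" for j
    using lattice_box[OF \<rho>(2) 1(1,2) 2(1)] lattice_box[OF \<rho>(2) 1(3,4) 2(3)] by auto
  \<comment> \<open>Each coordinate of x lies in [7/8 R, 2R) for both scales, impossible if the
    scales differ by a factor of at least 8.\<close>
  have "k = k'"
  proof (rule ccontr)
    assume "k \<noteq> k'"
    then have "8 * freq \<rho> k \<le> freq \<rho> k' \<or> 8 * freq \<rho> k' \<le> freq \<rho> k"
      using freq_ratio[OF \<rho>] by (meson linorder_neqE_nat)
    then show False using b[of undefined] freq_pos[of \<rho> k] freq_pos[of \<rho> k'] by linarith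
  qed
  moreover have "p j = p' j" for j
    using nat_eq_if_close[of "x $ j / spacing \<rho> k" "p j" "p' j"] 2[of j] \<open>k = k'\<close> by simp
  moreover have "q j = q' j" for j
    using nat_eq_if_close[of "y $ j / spacing \<rho> k" "q j" "q' j"] 2[of j] \<open>k = k'\<close> by simp
  ultimately show ?case by (auto simp: i i')
next
  case (8 i x y)
  obtain k p q where i: "i = (k, p, q)" by (cases i)
  have 1: "8 ^ k \<le> p j" "p j < 2 * 8 ^ k" "8 ^ k \<le> q j" "q j < 3 * 8 ^ k" for j
    using 8 by (auto simp: lattice_def i)
  have 2: "\<bar>x $ j / spacing \<rho> k - real (p j)\<bar> \<le> 1/8" "\<bar>y $ j / spacing \<rho> k - real (q j)\<bar> \<le> 1/8" for j
    using 8(2) by (auto simp: i)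
  have b: "7 / 8 * freq \<rho> k \<le> x $ j" "x $ j < 2 * freq \<rho> k" "7 / 8 * freq \<rho> k \<le> y $ j" "y $ j < 3 * freq \<rho> k" for j
    using lattice_box[OF \<rho>(2) 1(1,2) 2(1)] lattice_box[OF \<rho>(2) 1(3,4) 2(2)] by auto
  have R: "1 \<le> freq \<rho> k" by (rule freq_ge(2)[OF \<rho>])
  have "\<bar>x $ j\<bar> \<le> 2 * freq \<rho> k" "\<bar>y $ j\<bar> \<le> 3 * freq \<rho> k" for j using b[of j] R by linarith+
  then have "norm x \<le> CARD('n) * (2 * freq \<rho> k)" "norm y \<le> CARD('n) * (3 * freq \<rho> k)"
    by (auto intro: norm_vec_le)
  then have "1 + norm x + norm y \<le> (2 + 5 * real CARD('n)) * freq \<rho> k"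
    using R by (simp add: algebra_simps)
  moreover have "freq \<rho> k \<le> (2 + 5 * real CARD('n)) * (1 + norm x + norm y)"
  proof -
    have "7 / 8 * freq \<rho> k \<le> norm x" using b(1)[of undefined] component_le_norm_cart[of x undefined] by linarith
    then have "freq \<rho> k \<le> 2 * norm x" using norm_ge_zero[of x] R by (simp only: field_simps)
    then have "freq \<rho> k \<le> 2 * (1 + norm x + norm y)" by (smt (verit) norm_ge_zero)
    also have "\<dots> \<le> (2 + 5 * real CARD('n)) * (1 + norm x + norm y)"
      by (intro mult_right_mono) (auto intro: add_nonneg_nonneg)
    finally show ?thesis .
  qed
  ultimately show ?case by (simp add: i)
next
  case (9 M)
  define K where "K = nat \<lceil>2 * M\<rceil>"
  have fin: "finite {f :: 'n \<Rightarrow> nat. \<forall>j. f j < B}" for B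
  proof (rule finite_subset)
    show "{f :: 'n \<Rightarrow> nat. \<forall>j. f j < B} \<subseteq> PiE UNIV (\<lambda>_. {..<B})" by auto
  qed (auto intro: finite_PiE)
  have "finite (\<Union>k\<le>K. {k} \<times> {f :: 'n \<Rightarrow> nat. \<forall>j. f j < 2 * 8 ^ k} \<times> {f :: 'n \<Rightarrow> nat. \<forall>j. f j < 3 * 8 ^ k})"
    by (intro finite_UN_I finite_cartesian_product fin) auto
  then show ?case
  proof (rule finite_subset[rotated], safe, goal_cases)
    case (1 k p q x y)
    have 2: "\<bar>x $ j / spacing \<rho> k - real (p j)\<bar> \<le> 1/8" for j using 1 by auto
    have "7 / 8 * freq \<rho> k \<le> x $ undefined"
      by (rule lattice_box(1)[OF \<rho>(2) _ _ 2]) (use 1 in \<open>auto simp: lattice_def\<close>)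
    also have "\<dots> \<le> M" using component_le_norm_cart[of x undefined] 1 by linarith
    finally have "real k \<le> 2 * M" using freq_ge[OF \<rho>, of k] by linarith
    then have "k \<le> K" unfolding K_def by linarith
    then show ?case using 1 by (auto simp: lattice_def)
  qed
qed (use \<theta> in auto)

text \<open>For N <= a < 2N the window a + [N, 3N) contains [3N, 4N), so every a contributes the
  same inner sum. The unequal ranges thus avoid the triangular weights of a convolution of equal
  intervals.\<close>

lemma sum_lattice_convolution:
  fixes r :: "nat \<Rightarrow> complex"
  assumes "\<And>j. \<not> (3 * N \<le> j \<and> j < 4 * N) \<Longrightarrow> r j = 0"
  shows "(\<Sum>a=N..<2*N. \<Sum>b=N..<3*N. r (a + b)) = of_nat N * (\<Sum>j=3*N..<4*N. r j)"
proof -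
  have "(\<Sum>b=N..<3*N. r (a + b)) = (\<Sum>j=3*N..<4*N. r j)" if a: "a \<in> {N..<2*N}" for a
  proof -
    have "(\<Sum>b=N..<3*N. r (a + b)) = (\<Sum>j\<in>(+) a ` {N..<3*N}. r j)"
      by (subst sum.reindex) (auto simp: o_def)
    also have "\<dots> = (\<Sum>j=3*N..<4*N. r j)"
    proof (rule sum.mono_neutral_right)
      show "{3*N..<4*N} \<subseteq> (+) a ` {N..<3*N}"
      proof
        fix j assume "j \<in> {3*N..<4*N}"
        then have "j = a + (j - a)" "j - a \<in> {N..<3*N}" using a by auto
        then show "j \<in> (+) a ` {N..<3*N}" by blast
      qed
    qed (use assms in auto)
    finally show ?thesis .
  qed
  then have "(\<Sum>a=N..<2*N. \<Sum>b=N..<3*N. r (a + b)) = (\<Sum>a=N..<2*N. (\<Sum>j=3*N..<4*N. r j))"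
    by (rule sum.cong[OF refl])
  then show ?thesis by simp
qed

lemma sum_singleton_Times:
  "(\<Sum>(k', p, q)\<in>{k} \<times> A \<times> B. F p q) = (\<Sum>p\<in>A. \<Sum>q\<in>B. F p q)"
proof -
  have "(\<Sum>(k', p, q)\<in>{k} \<times> A \<times> B. F p q) = (\<Sum>(p, q)\<in>A \<times> B. F p q)"
    by (rule sum.reindex_bij_witness[of _ "\<lambda>pq. (k, pq)" snd]) auto
  then show ?thesis by (simp add: sum.cartesian_product)
qed

text \<open>One symbol is fixed before the scale k, as the boundedness constant may depend on it. In
  \<open>c\<close> the signs of the two inputs are repeated and cancel by squaring; what survives
  depends on a + b only, so the double sum becomes a trigonometric polynomial with coefficients
  \<open>r\<close>.\<close>

lemma lattice_symbol:
  fixes c :: "nat \<Rightarrow> nat \<Rightarrow> nat \<Rightarrow> real"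
  assumes \<rho>: "0 < \<rho>" "\<rho> < 1"
    and \<theta>: "smooth1 \<theta>" "\<And>u. 1/8 \<le> \<bar>u\<bar> \<Longrightarrow> \<theta> u = 0"
    and c: "\<And>k a b. \<bar>c k a b\<bar> \<le> 1"
  obtains \<sigma> :: "real ^ 'n \<Rightarrow> real ^ 'n \<Rightarrow> real ^ 'n \<Rightarrow> complex" where "\<sigma> \<in> BS m \<rho>"
    "\<And>k v1 v2 \<eta>1 \<eta>2 \<alpha> \<beta> r x. test_fun v1 \<Longrightarrow> test_fun v2 \<Longrightarrow>
       (\<And>u. v1 u \<noteq> 0 \<Longrightarrow> freq \<rho> k / 2 < u \<and> u < 4 * freq \<rho> k) \<Longrightarrow>
       (\<And>a u. 8 ^ k \<le> a \<Longrightarrow> a < 3 * 8 ^ k \<Longrightarrow> \<theta> (u / spacing \<rho> k - real a) * v1 u =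
          of_real (\<alpha> a) * (\<eta>1 (u / spacing \<rho> k - real a) / of_real (spacing \<rho> k))) \<Longrightarrow>
       (\<And>b u. 8 ^ k \<le> b \<Longrightarrow> b < 3 * 8 ^ k \<Longrightarrow> \<theta> (u / spacing \<rho> k - real b) * v2 u =
          of_real (\<beta> b) * (\<eta>2 (u / spacing \<rho> k - real b) / of_real (spacing \<rho> k))) \<Longrightarrow>
       (\<And>a. (\<alpha> a)\<^sup>2 = 1) \<Longrightarrow> (\<And>b. (\<beta> b)\<^sup>2 = 1) \<Longrightarrow>
       (\<And>j. \<not> (3 * 8 ^ k \<le> j \<and> j < 4 * 8 ^ k) \<Longrightarrow> r j = 0) \<Longrightarrow>
       (\<And>a b. c k a b = \<alpha> a * \<beta> b * r (a + b)) \<Longrightarrow>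
       T_op \<sigma> (tensor_ift (\<lambda>_. v1)) (tensor_ift (\<lambda>_. v2)) x =
         of_real (freq \<rho> k powr m) * (\<Prod>j\<in>UNIV. 8 ^ k * (\<Sum>l=3*8^k..<4*8^k. of_real (r l) * cis (real l * (spacing \<rho> k * x $ j))) *
           ift \<eta>1 (spacing \<rho> k * x $ j) * ift \<eta>2 (spacing \<rho> k * x $ j))"
proof -
  interpret symbol_data "lattice :: (nat \<times> ('n::finite \<Rightarrow> nat) \<times> ('n \<Rightarrow> nat)) set"
    "\<lambda>(k, p, q). of_real (freq \<rho> k powr m * (\<Prod>j\<in>UNIV. c k (p j) (q j)))"
    "\<lambda>(k, _). spacing \<rho> k" "\<lambda>(k, _). freq \<rho> k"
    "\<lambda>(k, p, q). \<chi> j. real (p j)" "\<lambda>(k, p, q). \<chi> j. real (q j)" \<theta> m \<rho> "2 + 5 * real CARD('n)"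
    by (rule symbol_data_lattice[OF \<rho> \<theta> c])
  show ?thesis
  proof (rule that[OF symbol_in_BS], goal_cases)
    case (1 k v1 v2 \<eta>1 \<eta>2 \<alpha> \<beta> r x)
    let ?s = "spacing \<rho> k" and ?R = "freq \<rho> k" and ?N = "8 ^ k :: nat"
    let ?A = "PiE (UNIV :: 'n set) (\<lambda>_. {?N..<2 * ?N})" and ?B = "PiE (UNIV :: 'n set) (\<lambda>_. {?N..<3 * ?N})"
    let ?J = "{k} \<times> ?A \<times> ?B"
    have J: "finite ?J" "?J \<subseteq> lattice" by (intro finite_cartesian_product finite_PiE) (auto simp: lattice_def PiE_iff)
    have T: "T_op symbol (tensor_ift (\<lambda>_. v1)) (tensor_ift (\<lambda>_. v2)) x = (\<Sum>i\<in>?J. (case i of (k, p, q) \<Rightarrow> of_real (freq \<rho> k powr m * (\<Prod>j\<in>UNIV. c k (p j) (q j)))) *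
       (\<Prod>j\<in>UNIV. ift (\<lambda>u. \<theta> (u / (case i of (k, _) \<Rightarrow> spacing \<rho> k) - (case i of (k, p, q) \<Rightarrow> \<chi> j. real (p j)) $ j) * v1 u) (x $ j) *
        ift (\<lambda>u. \<theta> (u / (case i of (k, _) \<Rightarrow> spacing \<rho> k) - (case i of (k, p, q) \<Rightarrow> \<chi> j. real (q j)) $ j) * v2 u) (x $ j)))"
    proof (rule T_op_symbol[OF 1(1,2) J])
      fix i and \<xi>1 \<xi>2 :: "real ^ 'n" assume i: "i \<in> lattice - ?J"
      obtain k' p q where i': "i = (k', p, q)" by (cases i)
      have k': "k' \<noteq> k" using i by (auto simp: i' lattice_def)
      show "(\<Prod>j\<in>UNIV. \<theta> (\<xi>1 $ j / (case i of (k, _) \<Rightarrow> spacing \<rho> k) - (case i of (k, p, q) \<Rightarrow> \<chi> j. real (p j)) $ j)) * (\<Prod>j\<in>UNIV. v1 (\<xi>1 $ j)) = 0"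
      proof (rule ccontr)
        assume "\<not> ?thesis"
        then have nz: "\<theta> (\<xi>1 $ undefined / spacing \<rho> k' - real (p undefined)) \<noteq> 0" "v1 (\<xi>1 $ undefined) \<noteq> 0"
          by (auto simp: i')
        have "\<bar>\<xi>1 $ undefined / spacing \<rho> k' - real (p undefined)\<bar> \<le> 1/8"
          using nz(1) \<theta>(2)[of "\<xi>1 $ undefined / spacing \<rho> k' - real (p undefined)"] by linarith
        then have "7 / 8 * freq \<rho> k' \<le> \<xi>1 $ undefined" "\<xi>1 $ undefined < 2 * freq \<rho> k'"
          using lattice_box[OF \<rho>(2), of k' "p undefined" 2 "\<xi>1 $ undefined"] i by (auto simp: i' lattice_def)
        moreover have "freq \<rho> k / 2 < \<xi>1 $ undefined" "\<xi>1 $ undefined < 4 * freq \<rho> k" using 1(3)[OF nz(2)] by auto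
        \<comment> \<open>The input lives in (R/2, 4R) and the box of scale k' in [7/8 R', 2R'); R'
          >= 8R puts the box above 7R, and R' <= R/8 puts it below R/4.\<close>
        moreover have "8 * freq \<rho> k \<le> freq \<rho> k' \<or> 8 * freq \<rho> k' \<le> freq \<rho> k"
          using freq_ratio[OF \<rho>] k' by (meson linorder_neqE_nat)
        ultimately show False using freq_pos[of \<rho> k] freq_pos[of \<rho> k'] by linarith
      qed
    qed
    let ?G = "\<lambda>j a b. of_real (r (a + b)) * cis (real (a + b) * (?s * x $ j)) * (ift \<eta>1 (?s * x $ j) * ift \<eta>2 (?s * x $ j))"
    have s: "?s > 0" by (rule spacing_pos)
    have i1: "ift (\<lambda>u. \<theta> (u / ?s - real a) * v1 u) y = of_real (\<alpha> a) * (cis (real a * (?s * y)) * ift \<eta>1 (?s * y))"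
      if "?N \<le> a" "a < 3 * ?N" for a y
      unfolding 1(4)[OF that] ift_cmult ift_shift[OF s] ..
    have i2: "ift (\<lambda>u. \<theta> (u / ?s - real a) * v2 u) y = of_real (\<beta> a) * (cis (real a * (?s * y)) * ift \<eta>2 (?s * y))"
      if "?N \<le> a" "a < 3 * ?N" for a y
      unfolding 1(5)[OF that] ift_cmult ift_shift[OF s] ..
    have G: "of_real (c k a b) * (ift (\<lambda>u. \<theta> (u / ?s - real a) * v1 u) y * ift (\<lambda>u. \<theta> (u / ?s - real b) * v2 u) y) =
        of_real (r (a + b)) * cis (real (a + b) * (?s * y)) * (ift \<eta>1 (?s * y) * ift \<eta>2 (?s * y))"
      if "?N \<le> a" "a < 2 * ?N" "?N \<le> b" "b < 3 * ?N" for a b y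
    proof -
      have a3: "a < 3 * ?N" using that by simp
      have "complex_of_real (\<alpha> a) * of_real (\<alpha> a) = 1" "complex_of_real (\<beta> b) * of_real (\<beta> b) = 1"
        using 1(6)[of a] 1(7)[of b] by (simp_all add: power2_eq_square flip: of_real_mult)
      moreover have "cis (real (a + b) * (?s * y)) = cis (real a * (?s * y)) * cis (real b * (?s * y))"
        by (simp add: cis_mult algebra_simps)
      moreover have "of_real (c k a b) * (ift (\<lambda>u. \<theta> (u / ?s - real a) * v1 u) y * ift (\<lambda>u. \<theta> (u / ?s - real b) * v2 u) y) =
        (complex_of_real (\<alpha> a) * of_real (\<alpha> a)) * (complex_of_real (\<beta> b) * of_real (\<beta> b)) * of_real (r (a + b)) *
          (cis (real a * (?s * y)) * cis (real b * (?s * y))) * (ift \<eta>1 (?s * y) * ift \<eta>2 (?s * y))"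
        unfolding 1(9) i1[OF that(1) a3] i2[OF that(3,4)] of_real_mult by (simp only: mult_ac)
      ultimately show ?thesis by (simp only: mult_1_left)
    qed
    have "T_op symbol (tensor_ift (\<lambda>_. v1)) (tensor_ift (\<lambda>_. v2)) x =
       (\<Sum>p\<in>?A. \<Sum>q\<in>?B. of_real (?R powr m) * (\<Prod>j\<in>UNIV. ?G j (p j) (q j)))"
    proof -
      have "(\<Sum>i\<in>?J. (case i of (k, p, q) \<Rightarrow> complex_of_real (freq \<rho> k powr m * (\<Prod>j\<in>UNIV. c k (p j) (q j)))) *
       (\<Prod>j\<in>UNIV. ift (\<lambda>u. \<theta> (u / (case i of (k, _) \<Rightarrow> spacing \<rho> k) - (case i of (k, p, q) \<Rightarrow> \<chi> j. real (p j)) $ j) * v1 u) (x $ j) *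
        ift (\<lambda>u. \<theta> (u / (case i of (k, _) \<Rightarrow> spacing \<rho> k) - (case i of (k, p, q) \<Rightarrow> \<chi> j. real (q j)) $ j) * v2 u) (x $ j))) =
        (\<Sum>(k', p, q)\<in>?J. of_real (?R powr m) * (\<Prod>j\<in>UNIV. ?G j (p j) (q j)))"
      proof (rule sum.cong[OF refl], safe, goal_cases)
        case (1 k' p q)
        have "?N \<le> p j" "p j < 2 * ?N" "?N \<le> q j" "q j < 3 * ?N" for j using 1 by (auto simp: PiE_iff)
        from G[OF this] show ?case
          by (simp add: mult.assoc flip: prod.distrib)
      qed
      then show ?thesis unfolding T sum_singleton_Times .
    qed
    also have "\<dots> = of_real (?R powr m) * (\<Sum>p\<in>?A. \<Sum>q\<in>?B. \<Prod>j\<in>UNIV. ?G j (p j) (q j))"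
      by (simp add: sum_distrib_left)
    \<comment> \<open>A sum over all choices of one index pair per coordinate is the product of the
      one-dimensional sums.\<close>
    also have "(\<Sum>p\<in>?A. \<Sum>q\<in>?B. \<Prod>j\<in>UNIV. ?G j (p j) (q j)) = (\<Prod>j\<in>UNIV. \<Sum>a=?N..<2*?N. \<Sum>b=?N..<3*?N. ?G j a b)"
      by (simp add: prod_sum_PiE)
    finally have T': "T_op symbol (tensor_ift (\<lambda>_. v1)) (tensor_ift (\<lambda>_. v2)) x =
      of_real (?R powr m) * (\<Prod>j\<in>UNIV. \<Sum>a=?N..<2*?N. \<Sum>b=?N..<3*?N. ?G j a b)" .
    have conv: "(\<Sum>a=?N..<2*?N. \<Sum>b=?N..<3*?N. ?G j a b) =
       8 ^ k * (\<Sum>l=3*8^k..<4*8^k. of_real (r l) * cis (real l * (?s * x $ j))) * ift \<eta>1 (?s * x $ j) * ift \<eta>2 (?s * x $ j)" for j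
      unfolding sum_distrib_right[symmetric]
      by (subst sum_lattice_convolution[of ?N "\<lambda>l. of_real (r l) * cis (real l * (?s * x $ j))"])
         (use 1(8) in \<open>auto simp: mult_ac\<close>)
    show ?case unfolding T' conv ..
  qed
qed

declare rs_coeff.simps [simp del] rs_coeff'.simps [simp del]

section \<open>Inputs of controlled Hardy norm\<close>

lemma enn2real_inverse_le_half:
  assumes "2 \<le> p" shows "enn2real (1 / p) \<le> 1 / 2"
proof (cases p)
  case (real q)
  then have "ennreal 2 \<le> ennreal q" using assms by simp
  then have "2 \<le> q" by (subst (asm) ennreal_le_iff) (use real in auto)
  moreover from this have "enn2real (1 / p) = 1 / q" using real enn2real_inverse[of q] by simp
  ultimately show ?thesis by (simp only:) (simp add: field_simps)
qed simp

lemma enn2real_inverse_ge_half: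
  assumes "\<not> 2 \<le> p" "p > 0" shows "1 / 2 \<le> enn2real (1 / p)"
proof (cases p)
  case (real q)
  then have "q < 2" "q > 0" using assms ennreal_leI[of 2 q] by (auto simp: not_le)
  moreover from this have "enn2real (1 / p) = 1 / q" using real enn2real_inverse[of q] by simp
  ultimately show ?thesis by (simp only:) (simp add: field_simps)
qed (use assms in simp)

text \<open>On the support |u| < 1/8, and |y| <= 2 pi, so |y u| <= pi/4 < pi/3 and cos (y u) >= 1/2:
  the real part cannot cancel. The range 2 pi is a full period of the trigonometric polynomials to
  be multiplied.\<close>

lemma norm_ift_lower_bound:
  fixes h :: "real \<Rightarrow> real"
  assumes tf: "test_fun (\<lambda>u. of_real (h u))"
    and h: "\<And>u. 0 \<le> h u" "\<And>u. l \<le> u \<Longrightarrow> u \<le> r \<Longrightarrow> h u = 1" "\<And>u. 1/8 \<le> \<bar>u\<bar> \<Longrightarrow> h u = 0"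
    and lr: "l \<le> r" and y: "\<bar>y\<bar> \<le> 2 * pi"
  shows "(r - l) / 2 \<le> norm (ift (\<lambda>u. of_real (h u)) y)"
proof -
  have int: "integrable lborel (\<lambda>u. cis (y * u) * complex_of_real (h u))"
    by (rule integrable_cis_mult[OF test_fun_integrable[OF tf]]) simp
  have "(r - l) / 2 = (LINT u|lborel. 1/2 * indicator {l..r} u)" using lr by simp
  also have "\<dots> \<le> (LINT u|lborel. Re (cis (y * u) * complex_of_real (h u)))"
  proof (rule integral_mono)
    show "integrable lborel (\<lambda>u. 1/2 * indicator {l..r} u :: real)"
      using lr by (intro integrable_mult_right integrable_real_indicator) auto
    show "integrable lborel (\<lambda>u. Re (cis (y * u) * complex_of_real (h u)))" using int by (rule integrable_Re)
    fix u :: real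
    show "1/2 * indicator {l..r} u \<le> Re (cis (y * u) * complex_of_real (h u))"
    proof (cases "\<bar>u\<bar> < 1/8")
      case True
      have "\<bar>y * u\<bar> \<le> 2 * pi * (1/8)" unfolding abs_mult using y True by (intro mult_mono) auto
      then have "cos (pi / 3) \<le> cos \<bar>y * u\<bar>" by (intro cos_monotone_0_pi_le) (use pi_gt_zero in auto)
      then have c: "1/2 \<le> cos (y * u)" by (simp add: cos_60 abs_if split: if_splits)
      have "1/2 * indicator {l..r} u \<le> 1/2 * h u"
        using h(1)[of u] h(2)[of u] by (auto simp: indicator_def)
      also have "\<dots> \<le> cos (y * u) * h u" using c h(1) by (intro mult_right_mono) auto
      finally show ?thesis by simp
    qed (use h(2)[of u] h(3)[of u] in \<open>auto simp: indicator_def\<close>)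
  qed
  also have "\<dots> = Re (ift (\<lambda>u. of_real (h u)) y)"
    unfolding ift_def using int by (rule integral_Re)
  also have "\<dots> \<le> norm (ift (\<lambda>u. of_real (h u)) y)" by (rule complex_Re_le_cmod)
  finally show ?thesis .
qed

locale plateau =
  fixes h :: "real \<Rightarrow> real" and \<rho> :: real
  assumes \<rho>: "0 < \<rho>" "\<rho> < 1"
    and smooth_h: "smooth1 (\<lambda>u. of_real (h u))" and h_nonneg: "\<And>u. 0 \<le> h u"
    and h_eq_1: "\<And>u. \<bar>u\<bar> \<le> 1/16 \<Longrightarrow> h u = 1" and h_eq_0: "\<And>u. 1/8 \<le> \<bar>u\<bar> \<Longrightarrow> h u = 0"
begin

abbreviation \<theta> :: "real \<Rightarrow> complex" where "\<theta> \<equiv> \<lambda>u. of_real (h u)"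

lemma test_fun_\<theta>: "test_fun \<theta>"
  unfolding test_fun_def
proof (intro conjI exI allI impI)
  show "\<theta> u = 0" if "1/8 \<le> \<bar>u\<bar>" for u using h_eq_0[OF that] by simp
qed (rule smooth_h)

lemma \<theta>_lattice_disjoint:
  assumes "a \<noteq> b"
  shows "\<theta> (x - real a) * \<theta> (x - real b) = 0"
proof -
  have "\<not> \<bar>x - real a\<bar> \<le> 1/8 \<or> \<not> \<bar>x - real b\<bar> \<le> 1/8" using nat_eq_if_close[of x a b] assms by blast
  then have "h (x - real a) = 0 \<or> h (x - real b) = 0"
    using h_eq_0[of "x - real a"] h_eq_0[of "x - real b"] by linarith
  then show ?thesis by auto
qed

text \<open>Near each lattice point the symbol sees only a sign \<alpha> and a fixed profile \<eta>,
  divided by s because a rescaled bump carries that factor. The minimum unites the two kinds of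
  input: 1/2 for flat ones, 1 - 1/p for concentrated ones. The range of \<open>a\<close> up to 3 *
  8^k covers the lattice indices of either input.\<close>

definition admissible_input where
  "admissible_input \<phi> p \<alpha> \<eta> C k v \<longleftrightarrow> test_fun v \<and>
     (\<forall>u. v u \<noteq> 0 \<longrightarrow> freq \<rho> k / 2 < u \<and> u < 4 * freq \<rho> k) \<and>
     (\<forall>a u. 8 ^ k \<le> a \<longrightarrow> a < 3 * 8 ^ k \<longrightarrow> \<theta> (u / spacing \<rho> k - real a) * v u =
          of_real (\<alpha> k a) * (\<eta> (u / spacing \<rho> k - real a) / of_real (spacing \<rho> k))) \<and>
     distr_of (tensor_ift (\<lambda>_. v)) \<in> hardy \<phi> p \<and>
     hardy_norm \<phi> p (distr_of (tensor_ift (\<lambda>_. v))) \<le>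
       ennreal (C * (8 ^ k) powr (real CARD('n) * min (1/2) (1 - enn2real (1 / p))) *
         spacing \<rho> k powr (- real CARD('n) * enn2real (1 / p)))"
  for \<phi> :: "real ^ 'n \<Rightarrow> complex" and \<alpha> :: "nat \<Rightarrow> nat \<Rightarrow> real"

lemma admissible_inputI:
  fixes \<phi> :: "real ^ 'n \<Rightarrow> complex"
  assumes "test_fun v" "\<And>u. v u \<noteq> 0 \<Longrightarrow> freq \<rho> k / 2 < u \<and> u < 4 * freq \<rho> k"
    "\<And>a u. 8 ^ k \<le> a \<Longrightarrow> a < 3 * 8 ^ k \<Longrightarrow> \<theta> (u / spacing \<rho> k - real a) * v u =
          of_real (\<alpha> k a) * (\<eta> (u / spacing \<rho> k - real a) / of_real (spacing \<rho> k))"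
    "distr_of (tensor_ift (\<lambda>_::'n. v)) \<in> hardy \<phi> p \<and>
     hardy_norm \<phi> p (distr_of (tensor_ift (\<lambda>_::'n. v))) \<le>
       ennreal (B * spacing \<rho> k powr (- real CARD('n) * enn2real (1 / p)))"
    "B = C * (8 ^ k) powr (real CARD('n) * min (1/2) (1 - enn2real (1 / p)))"
  shows "admissible_input \<phi> p \<alpha> \<eta> C k v"
  unfolding admissible_input_def assms(5)[symmetric]
  by (rule conjI[OF assms(1)], rule conjI, rule allI, rule impI, rule assms(2), assumption,
      rule conjI[OF _ assms(4)], rule allI, rule allI, rule impI, rule impI, rule assms(3), assumption, assumption)

text \<open>The 2 * 8^k = 2^(3k+1) lattice points carry a full Rudin--Shapiro polynomial of size at
  most 2 sqrt(8^k), so the input is dominated by a fixed tensor profile dilated by s. The profile is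
  the square of \<theta>: one factor from the input, one from the symbol.\<close>

lemma flat_input:
  fixes \<phi> :: "real ^ 'n \<Rightarrow> complex"
  assumes \<phi>: "\<phi> \<in> schwartz" and p: "2 \<le> p"
  shows "\<exists>C>0. \<forall>k. \<exists>v. admissible_input \<phi> p (\<lambda>k a. rs_coeff (3 * k + 1) (a - 8 ^ k)) (\<lambda>u. \<theta> u * \<theta> u) C k v"
proof -
  obtain C where C: "C > 0" "\<And>A c F. A > 0 \<Longrightarrow> c > 0 \<Longrightarrow> continuous_on UNIV F \<Longrightarrow>
      (\<And>y. norm (F y) \<le> A * norm (tensor_ift (\<lambda>_::'n. \<theta>) y)) \<Longrightarrow>
      distr_of (\<lambda>x. F (c *\<^sub>R x)) \<in> hardy \<phi> p \<and>
      hardy_norm \<phi> p (distr_of (\<lambda>x. F (c *\<^sub>R x))) \<le>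
        ennreal (C * A * c powr (- real CARD('n) * enn2real (1 / p)))"
    using hardy_norm_dominated[OF \<phi> p test_fun_\<theta>] by blast
  have "\<exists>v. admissible_input \<phi> p (\<lambda>k a. rs_coeff (3 * k + 1) (a - 8 ^ k)) (\<lambda>u. \<theta> u * \<theta> u) (C * 2 ^ CARD('n)) k v" for k
  proof -
    let ?s = "spacing \<rho> k" and ?N = "8 ^ k :: nat" and ?\<alpha> = "\<lambda>a. rs_coeff (3 * k + 1) (a - 8 ^ k)"
    have s: "?s > 0" by (rule spacing_pos)
    define v where "v u = (\<Sum>a=?N..<3*?N. of_real (?\<alpha> a) * (\<theta> (u / ?s - real a) / of_real ?s))" for u
    have tf: "test_fun (\<lambda>u. \<theta> (u / ?s - real a) / of_real ?s)" for a
      using test_fun_mult[OF smooth1_const[of "1 / of_real ?s"] test_fun_affine[OF test_fun_\<theta>, of "1 / ?s" "- real a"]] s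
      by simp
    have "test_fun v"
      unfolding v_def[abs_def] by (rule test_fun_sum[OF _ test_fun_mult[OF smooth1_const tf]]) simp
    moreover have "freq \<rho> k / 2 < u \<and> u < 4 * freq \<rho> k" if "v u \<noteq> 0" for u
    proof -
      have "\<exists>a\<in>{?N..<3*?N}. \<theta> (u / ?s - real a) \<noteq> 0"
      proof (rule ccontr)
        assume "\<not> ?thesis"
        then have "v u = 0" unfolding v_def by (intro sum.neutral) simp
        then show False using that by simp
      qed
      then obtain a where a: "a \<in> {?N..<3*?N}" "\<theta> (u / ?s - real a) \<noteq> 0" by blast
      then have "\<bar>u / ?s - real a\<bar> \<le> 1/8" using h_eq_0[of "u / ?s - real a"] by force
      from lattice_box[OF \<rho>(2) _ _ this, of 3] a(1) freq_pos[of \<rho> k] show ?thesis by auto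
    qed
    moreover have "\<theta> (u / ?s - real a) * v u = of_real (?\<alpha> a) * (\<theta> (u / ?s - real a) * \<theta> (u / ?s - real a) / of_real ?s)"
      if a: "?N \<le> a" "a < 3 * ?N" for a u
    proof -
      have "\<theta> (u / ?s - real a) * v u = (\<Sum>b=?N..<3*?N. if b = a then of_real (?\<alpha> a) * (\<theta> (u / ?s - real a) * \<theta> (u / ?s - real a) / of_real ?s) else 0)"
        unfolding v_def sum_distrib_left
      proof (rule sum.cong[OF refl])
        fix b
        show "\<theta> (u / ?s - real a) * (of_real (?\<alpha> b) * (\<theta> (u / ?s - real b) / of_real ?s)) =
          (if b = a then of_real (?\<alpha> a) * (\<theta> (u / ?s - real a) * \<theta> (u / ?s - real a) / of_real ?s) else 0)"
          using \<theta>_lattice_disjoint[of a b "u / ?s"] by (cases "b = a") auto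
      qed
      then show ?thesis using a by simp
    qed
    moreover have "distr_of (tensor_ift (\<lambda>_::'n. v)) \<in> hardy \<phi> p \<and>
      hardy_norm \<phi> p (distr_of (tensor_ift (\<lambda>_::'n. v))) \<le>
        ennreal (C * (2 * sqrt (8 ^ k)) ^ CARD('n) * ?s powr (- real CARD('n) * enn2real (1 / p)))"
    proof -
      define T where "T y = (\<Sum>a=?N..<3*?N. of_real (?\<alpha> a) * cis (real a * y))" for y
      define F where "F y = (\<Prod>j\<in>UNIV. T (y $ j) * ift \<theta> (y $ j))" for y :: "real ^ 'n"
      have "ift v x = T (?s * x) * ift \<theta> (?s * x)" for x
      proof -
        have "ift v x = (\<Sum>a=?N..<3*?N. ift (\<lambda>u. of_real (?\<alpha> a) * (\<theta> (u / ?s - real a) / of_real ?s)) x)"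
          unfolding ift_def v_def sum_distrib_left
          by (rule Bochner_Integration.integral_sum)
             (intro integrable_cis_mult integrable_mult_right test_fun_integrable[OF tf] | simp)+
        also have "\<dots> = T (?s * x) * ift \<theta> (?s * x)"
          unfolding ift_cmult ift_shift[OF s, of \<theta>] T_def sum_distrib_right by (simp add: mult.assoc)
        finally show ?thesis .
      qed
      then have eq: "tensor_ift (\<lambda>_::'n. v) = (\<lambda>x. F (?s *\<^sub>R x))"
        by (simp add: fun_eq_iff tensor_ift_def F_def)
      have T: "norm (T y) \<le> 2 * sqrt (8 ^ k)" for y
      proof -
        have "T y = (\<Sum>a<2*?N. of_real (?\<alpha> (a + ?N)) * cis (real (a + ?N) * y))"
          unfolding T_def using sum.shift_bounds_nat_ivl[of "\<lambda>a. of_real (?\<alpha> a) * cis (real a * y)" 0 ?N "2 * ?N"]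
          by (simp add: lessThan_atLeast0)
        also have "\<dots> = cis (real ?N * y) * rs_poly (3 * k + 1) y"
        proof -
          have "2 ^ (3 * k + 1) = 2 * ?N" by (simp add: power_mult)
          then show ?thesis
            unfolding rs_poly_def sum_distrib_left
            by (intro sum.cong) (auto simp: cis_mult algebra_simps)
        qed
        finally have "norm (T y) \<le> sqrt (2 * 2 ^ (3 * k + 1))"
          using norm_rs_poly_le[of "3 * k + 1" y] by (simp add: norm_mult)
        also have "2 * 2 ^ (3 * k + 1) = (4::real) * 8 ^ k" by (simp add: power_add power_mult)
        finally show ?thesis by (simp add: real_sqrt_mult)
      qed
      have cT: "continuous_on UNIV T" unfolding T_def by (intro continuous_intros)
      have c\<theta>: "continuous_on UNIV (ift \<theta>)" by (intro smooth1_continuous_on smooth1_ift test_fun_\<theta>)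
      have "continuous_on UNIV F"
        unfolding F_def
        by (intro continuous_intros continuous_on_compose2[OF cT] continuous_on_compose2[OF c\<theta>]) auto
      moreover have "norm (F y) \<le> (2 * sqrt (8 ^ k)) ^ CARD('n) * norm (tensor_ift (\<lambda>_::'n. \<theta>) y)" for y
      proof -
        have "norm (F y) \<le> (\<Prod>j\<in>(UNIV::'n set). 2 * sqrt (8 ^ k) * norm (ift \<theta> (y $ j)))"
          unfolding F_def prod_norm[symmetric] norm_mult by (intro prod_mono conjI mult_right_mono T) auto
        then show ?thesis by (simp add: prod.distrib tensor_ift_def prod_norm)
      qed
      ultimately show ?thesis
        unfolding eq using s by (intro C(2)) auto
    qed
    moreover have "C * (2 * sqrt (8 ^ k)) ^ CARD('n) =
       C * 2 ^ CARD('n) * (8 ^ k) powr (real CARD('n) * min (1/2) (1 - enn2real (1 / p)))"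
    proof -
      have "min (1/2) (1 - enn2real (1 / p)) = 1/2" using enn2real_inverse_le_half[OF p] by simp
      moreover have "sqrt (8 ^ k) ^ CARD('n) = (8 ^ k) powr (real CARD('n) * (1/2))"
      proof -
        have s2: "sqrt (8 ^ k) = (8 ^ k) powr (1/2)" by (simp add: powr_half_sqrt)
        have "sqrt (8 ^ k) ^ CARD('n) = ((8 ^ k) powr (1/2)) powr real CARD('n)"
          unfolding s2 by (rule powr_realpow[symmetric]) simp
        then show ?thesis by (simp only: powr_powr mult.commute)
      qed
      ultimately show ?thesis by (simp only: power_mult_distrib mult.assoc)
    qed
    ultimately have "admissible_input \<phi> p (\<lambda>k a. rs_coeff (3 * k + 1) (a - 8 ^ k)) (\<lambda>u. \<theta> u * \<theta> u) (C * 2 ^ CARD('n)) k v"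
      by (rule admissible_inputI)
    then show ?thesis by (rule exI[of _ v])
  qed
  then show ?thesis using C(1) by (intro exI[of _ "C * 2 ^ CARD('n)"]) simp
qed

text \<open>A single bump w(u/R), equal to 1 on [7/8, 3] and so on every lattice box, replaces a sum
  over lattice points. Its support in [1/2, 4] avoids 0, which gives its Hardy norm for all small p.
  The amplitude 8^k/R = 1/s matches the normalisation of the profile.\<close>

lemma concentrated_input:
  fixes \<phi> :: "real ^ 'n \<Rightarrow> complex"
  assumes \<phi>: "\<phi> \<in> schwartz" and p: "p > 0" "\<not> 2 \<le> p"
  shows "\<exists>C>0. \<forall>k. \<exists>v. admissible_input \<phi> p (\<lambda>_ _. 1) \<theta> C k v"
proof -
  obtain w :: "real \<Rightarrow> real" where w: "smooth1 (\<lambda>u. of_real (w u))" "\<And>u. 7/8 \<le> u \<Longrightarrow> u \<le> 3 \<Longrightarrow> w u = 1"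
    "\<And>u. u \<le> 1/2 \<or> 4 \<le> u \<Longrightarrow> w u = 0"
    by (rule plateau_exists[of "1/2" "7/8" 3 4]) auto
  have tw: "test_fun (\<lambda>u. complex_of_real (w u))"
    unfolding test_fun_def using w by (intro conjI exI[of _ 4]) (auto simp: abs_if split: if_splits)
  obtain C where C: "C > 0" "\<And>A c. A > 0 \<Longrightarrow> c > 0 \<Longrightarrow>
      distr_of (tensor_ift (\<lambda>_::'n. \<lambda>u. of_real (A / c) * of_real (w (u / c)))) \<in> hardy \<phi> p \<and>
      hardy_norm \<phi> p (distr_of (tensor_ift (\<lambda>_::'n. \<lambda>u. of_real (A / c) * of_real (w (u / c))))) \<le>
        ennreal (C * A ^ CARD('n) * c powr (- real CARD('n) * enn2real (1 / p)))"
    using hardy_norm_dilated_band_limited[OF \<phi> p(1) tw, of "1/2"] w(3) by auto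
  have "\<exists>v. admissible_input \<phi> p (\<lambda>_ _. 1) \<theta> C k v" for k
  proof -
    let ?s = "spacing \<rho> k" and ?R = "freq \<rho> k" and ?a = "enn2real (1 / p)"
    have s: "?s > 0" and R: "?R > 0" by (rule spacing_pos freq_pos)+
    have Rs: "8 ^ k / ?R = 1 / ?s" using s unfolding freq_spacing[OF \<rho>(2)] by simp
    define v where "v u = complex_of_real (8 ^ k / ?R) * of_real (w (u / ?R))" for u
    have "test_fun v"
    proof -
      have "test_fun (\<lambda>u. complex_of_real (w (u / ?R)))" using test_fun_affine[OF tw, of "1 / ?R" 0] R by simp
      then show ?thesis unfolding v_def[abs_def] by (rule test_fun_mult[OF smooth1_const])
    qed
    moreover have "?R / 2 < u \<and> u < 4 * ?R" if "v u \<noteq> 0" for u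
    proof -
      have "\<not> (u / ?R \<le> 1/2 \<or> 4 \<le> u / ?R)" using that w(3) by (auto simp: v_def)
      then show ?thesis using R by (simp add: field_simps)
    qed
    moreover have "\<theta> (u / ?s - real a) * v u = of_real 1 * (\<theta> (u / ?s - real a) / of_real ?s)"
      if a: "8 ^ k \<le> a" "a < 3 * 8 ^ k" for a u
    proof (cases "\<bar>u / ?s - real a\<bar> \<le> 1/8")
      case True
      from lattice_box[OF \<rho>(2) a True] have "7/8 \<le> u / ?R" "u / ?R \<le> 3" using R by (simp_all add: field_simps)
      then show ?thesis using w(2) by (simp add: v_def Rs)
    qed (use h_eq_0[of "u / ?s - real a"] in auto)
    moreover have "distr_of (tensor_ift (\<lambda>_::'n. v)) \<in> hardy \<phi> p \<and>
      hardy_norm \<phi> p (distr_of (tensor_ift (\<lambda>_::'n. v))) \<le>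
        ennreal (C * (8 ^ k) powr (real CARD('n) * min (1/2) (1 - ?a)) * ?s powr (- real CARD('n) * ?a))"
    proof -
      have m: "min (1/2) (1 - ?a) = 1 - ?a" using enn2real_inverse_ge_half[OF p(2,1)] by simp
      have e: "((8::real) ^ k) ^ CARD('n) = (8 ^ k) powr real CARD('n)" by (rule powr_realpow[symmetric]) simp
      have "real CARD('n) * (1 - ?a) = real CARD('n) + (- real CARD('n) * ?a)" by (simp add: algebra_simps)
      then have eq: "C * (8 ^ k) ^ CARD('n) * ?R powr (- real CARD('n) * ?a) =
          C * (8 ^ k) powr (real CARD('n) * min (1/2) (1 - ?a)) * ?s powr (- real CARD('n) * ?a)"
        unfolding m freq_spacing[OF \<rho>(2)] e by (simp only: powr_mult powr_add mult_ac)
      then show ?thesis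
        unfolding v_def[abs_def] eq[symmetric] by (intro C(2)) (use R in auto)
    qed
    moreover note refl
    ultimately have "admissible_input \<phi> p (\<lambda>_ _. 1) \<theta> C k v"
      by (rule admissible_inputI)
    then show ?thesis by (rule exI[of _ v])
  qed
  then show ?thesis using C(1) by blast
qed

lemma input_exists:
  fixes \<phi> :: "real ^ 'n \<Rightarrow> complex"
  assumes \<phi>: "\<phi> \<in> schwartz" and p: "p > 0"
  obtains C \<alpha> g where "C > 0" "\<And>k a. (\<alpha> k a)\<^sup>2 = 1" "test_fun (\<lambda>u. of_real (g u))" "\<And>u. 0 \<le> g u"
    "\<And>u. \<bar>u\<bar> \<le> 1/16 \<Longrightarrow> g u = 1" "\<And>u. 1/8 \<le> \<bar>u\<bar> \<Longrightarrow> g u = 0"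
    "\<And>k. \<exists>v. admissible_input \<phi> p \<alpha> (\<lambda>u. of_real (g u)) C k v"
proof (cases "2 \<le> p")
  case True
  obtain C where C: "C > 0" "\<And>k. \<exists>v. admissible_input \<phi> p (\<lambda>k a. rs_coeff (3 * k + 1) (a - 8 ^ k)) (\<lambda>u. \<theta> u * \<theta> u) C k v"
    using flat_input[OF \<phi> True] by blast
  show ?thesis
  proof (rule that[of C "\<lambda>k a. rs_coeff (3 * k + 1) (a - 8 ^ k)" "\<lambda>u. h u * h u"])
    show "(rs_coeff (3 * k + 1) (a - 8 ^ k))\<^sup>2 = 1" for k a
      by (simp only: abs_square_eq_1 abs_rs_coeff)
    show "test_fun (\<lambda>u. of_real (h u * h u))"
      using test_fun_mult[OF smooth_h test_fun_\<theta>] by simp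
  qed (use C h_nonneg h_eq_1 h_eq_0 in auto)
next
  case False
  obtain C where C: "C > 0" "\<And>k. \<exists>v. admissible_input \<phi> p (\<lambda>_ _. 1) \<theta> C k v"
    using concentrated_input[OF \<phi> p False] by blast
  show ?thesis
    by (rule that[of C "\<lambda>_ _. 1" h]) (use C test_fun_\<theta> h_nonneg h_eq_1 h_eq_0 in auto)
qed

end

section \<open>Lower bounds for the outputs\<close>

text \<open>A non-measurable function has norm infinity by definition, so only the measurable case
  needs the integral.\<close>

lemma Lp_norm_ge:
  assumes q: "q > 0" and B: "B \<ge> 0"
    and le: "ennreal (B powr q) \<le> (\<integral>\<^sup>+x. epowr (g x) q \<partial>lborel)"
  shows "ennreal B \<le> Lp_norm (ennreal q) g"
proof (cases "g \<in> borel_measurable lborel")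
  case True
  have "ennreal B = epowr (ennreal (B powr q)) (1 / q)"
    using q B by (simp add: epowr_ennreal powr_powr)
  also have "\<dots> \<le> epowr (\<integral>\<^sup>+x. epowr (g x) q \<partial>lborel) (1 / q)"
    by (rule epowr_mono[OF le]) (use q in simp)
  finally show ?thesis using q True by (simp add: Lp_norm_def)
qed (simp add: Lp_norm_def)

lemma Lp_norm_ge_cbox:
  fixes f :: "real ^ 'n \<Rightarrow> complex"
  assumes q: "q > 0" and d: "d > 0" and h: "h \<ge> 0"
    and f: "\<And>x. (\<And>j. 0 \<le> x $ j \<and> x $ j \<le> d) \<Longrightarrow> h \<le> norm (f x)"
  shows "ennreal (h * d powr (real CARD('n) / q)) \<le> Lp_norm (ennreal q) (\<lambda>x. ennreal (norm (f x)))"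
proof (rule Lp_norm_ge[OF q])
  let ?E = "cbox 0 (\<chi> j. d) :: (real ^ 'n) set"
  have "(h * d powr (real CARD('n) / q)) powr q = h powr q * d ^ CARD('n)"
    using q d by (simp only: powr_mult powr_powr) (simp add: powr_realpow)
  then have "ennreal ((h * d powr (real CARD('n) / q)) powr q) = ennreal (h powr q) * emeasure lborel ?E"
    using d by (simp add: emeasure_lborel_cbox_eq Basis_cart inner_axis prod.reindex[OF inj_axis_1] o_def ennreal_mult')
  also have "\<dots> = (\<integral>\<^sup>+x. ennreal (h powr q) * indicator ?E x \<partial>lborel)"
    by (subst nn_integral_cmult_indicator) simp_all
  also have "\<dots> \<le> (\<integral>\<^sup>+x. epowr (ennreal (norm (f x))) q \<partial>lborel)"
  proof (rule nn_integral_mono)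
    fix x :: "real ^ 'n"
    have "h powr q \<le> norm (f x) powr q" if "x \<in> ?E"
      using that h q by (intro powr_mono2 f) (auto simp: mem_box_cart)
    then show "ennreal (h powr q) * indicator ?E x \<le> epowr (ennreal (norm (f x))) q"
      by (auto simp: epowr_ennreal indicator_def intro!: ennreal_leI)
  qed
  finally show "ennreal ((h * d powr (real CARD('n) / q)) powr q) \<le> (\<integral>\<^sup>+x. epowr (ennreal (norm (f x))) q \<partial>lborel)" .
qed (use h in simp)

text \<open>Whatever the average c is, |c| lies on one side of 5h/8, halfway between h and h/4; so f
  stays 3h/8 away from c on all of \<open>E1\<close> or on all of \<open>E2\<close>.\<close>

lemma bmo_norm_ge:
  fixes f :: "real ^ 'n \<Rightarrow> complex"
  assumes Q: "Q \<in> cubes" and E: "E1 \<in> sets lborel" "E2 \<in> sets lborel" "E1 \<subseteq> Q" "E2 \<subseteq> Q"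
    and e: "ennreal e \<le> emeasure lborel E1" "ennreal e \<le> emeasure lborel E2"
    and h: "h \<ge> 0" and f1: "\<And>x. x \<in> E1 \<Longrightarrow> h \<le> norm (f x)" and f2: "\<And>x. x \<in> E2 \<Longrightarrow> norm (f x) \<le> h / 4"
  shows "ennreal (3 / 8 * h) * ennreal e / emeasure lborel Q \<le> bmo_norm f"
proof (cases "locally_integrable f")
  case True
  define c where "c = average Q f"
  have "\<exists>E\<in>{E1, E2}. \<forall>x\<in>E. 3 / 8 * h \<le> norm (f x - c)"
  proof (cases "norm c \<ge> 5 / 8 * h")
    case True
    have "3 / 8 * h \<le> norm (f x - c)" if "x \<in> E2" for x
      using f2[OF that] True norm_triangle_ineq2[of c "f x"] by (simp add: norm_minus_commute)
    then show ?thesis by blast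
  next
    case False
    have "3 / 8 * h \<le> norm (f x - c)" if "x \<in> E1" for x
      using f1[OF that] False norm_triangle_ineq2[of "f x" c] by simp
    then show ?thesis by blast
  qed
  then obtain E' where E': "E' \<in> {E1, E2}" "\<And>x. x \<in> E' \<Longrightarrow> 3 / 8 * h \<le> norm (f x - c)" by blast
  have "ennreal (3 / 8 * h) * ennreal e \<le> ennreal (3 / 8 * h) * emeasure lborel E'"
    using E' e by (intro mult_left_mono) auto
  also have "\<dots> = (\<integral>\<^sup>+x. ennreal (3 / 8 * h) * indicator E' x \<partial>lborel)"
    using E' E by (subst nn_integral_cmult_indicator) auto
  also have "\<dots> \<le> (\<integral>\<^sup>+x\<in>Q. ennreal (norm (f x - c)) \<partial>lborel)"
    using E' E by (intro nn_integral_mono) (auto simp: indicator_def intro!: ennreal_leI)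
  finally have "ennreal (3 / 8 * h) * ennreal e / emeasure lborel Q \<le> (\<integral>\<^sup>+x\<in>Q. ennreal (norm (f x - c)) \<partial>lborel) / emeasure lborel Q"
    by (rule divide_right_mono_ennreal)
  also have "\<dots> \<le> bmo_norm f"
    unfolding bmo_norm_def c_def using True Q by (auto intro: SUP_upper)
  finally show ?thesis .
qed (simp add: bmo_norm_def)

section \<open>Dirichlet kernels and lower bounds for Rudin--Shapiro polynomials\<close>

lemma norm_cis_diff_le: "norm (cis x - cis y) \<le> \<bar>x - y\<bar>"
proof -
  have "cis x - cis y = cis y * (cis (x - y) - 1)" by (simp add: right_diff_distrib cis_mult)
  then have "norm (cis x - cis y) = norm (cis (x - y) - 1)" by (simp add: norm_mult)
  also have "\<dots> \<le> \<bar>x - y\<bar>" using iexp_approx1[of "x - y" 0] by (simp add: cis_conv_exp)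
  finally show ?thesis .
qed

definition dirichlet :: "nat \<Rightarrow> real \<Rightarrow> complex" where
  "dirichlet N y = (\<Sum>l=3*N..<4*N. cis (real l * y))"

lemma dirichlet_lipschitz: "norm (dirichlet N x - dirichlet N y) \<le> 4 * (real N)\<^sup>2 * \<bar>x - y\<bar>"
proof -
  have "norm (dirichlet N x - dirichlet N y) \<le> (\<Sum>l=3*N..<4*N. norm (cis (real l * x) - cis (real l * y)))"
    unfolding dirichlet_def sum_subtractf[symmetric] by (rule norm_sum)
  also have "\<dots> \<le> (\<Sum>l=3*N..<4*N. 4 * real N * \<bar>x - y\<bar>)"
  proof (rule sum_mono)
    fix l assume l: "l \<in> {3*N..<4*N}"
    have "norm (cis (real l * x) - cis (real l * y)) \<le> \<bar>real l * x - real l * y\<bar>" by (rule norm_cis_diff_le)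
    also have "\<dots> = real l * \<bar>x - y\<bar>" by (simp add: abs_mult flip: right_diff_distrib)
    also have "\<dots> \<le> 4 * real N * \<bar>x - y\<bar>" using l by (intro mult_right_mono) auto
    finally show "norm (cis (real l * x) - cis (real l * y)) \<le> 4 * real N * \<bar>x - y\<bar>" .
  qed
  also have "\<dots> = 4 * (real N)\<^sup>2 * \<bar>x - y\<bar>" by (simp add: power2_eq_square)
  finally show ?thesis .
qed

lemma dirichlet_0: "dirichlet N 0 = of_nat N"
  by (simp add: dirichlet_def)

text \<open>The N consecutive powers of a nontrivial N-th root of unity sum to 0. The output is
  small near this zero, which produces oscillation in BMO.\<close>

lemma dirichlet_root:
  assumes "N \<ge> 2" shows "dirichlet N (2 * pi / N) = 0"
proof -
  define z where "z = cis (2 * pi / N)"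
  have zN: "z ^ N = 1" unfolding z_def Complex.DeMoivre using assms by simp
  have z1: "z \<noteq> 1"
  proof
    assume "z = 1"
    then have "cos (2 * pi / N) = 1" by (simp add: z_def cis.code complex_eq_iff)
    moreover have "cos (2 * pi / N) < cos 0"
      using assms by (intro cos_monotone_0_pi) (auto simp: field_simps)
    ultimately show False by simp
  qed
  have "dirichlet N (2 * pi / N) = (\<Sum>l=3*N..<4*N. z ^ l)"
    unfolding dirichlet_def z_def by (simp add: Complex.DeMoivre)
  also have "\<dots> = (\<Sum>l=0..<N. z ^ (l + 3 * N))"
    using sum.shift_bounds_nat_ivl[of "\<lambda>l. z ^ l" 0 "3 * N" N] by simp
  also have "\<dots> = z ^ (3 * N) * (\<Sum>l<N. z ^ l)"
    unfolding power_add sum_distrib_right[symmetric] by (simp add: lessThan_atLeast0 mult.commute)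
  also have "(\<Sum>l<N. z ^ l) = 0"
    using geometric_sum[OF z1, of N] zN by simp
  finally show ?thesis by simp
qed

text \<open>The kernel is N at 0 with Lipschitz constant 4 N^2, hence it loses at most N/2 up to
  distance 1/(8N).\<close>

lemma dirichlet_ge:
  assumes "\<bar>y\<bar> \<le> 1 / (8 * real N)" "N > 0" shows "real N / 2 \<le> norm (dirichlet N y)"
proof -
  have "norm (dirichlet N 0 - dirichlet N y) \<le> 4 * (real N)\<^sup>2 * \<bar>0 - y\<bar>" by (rule dirichlet_lipschitz)
  also have "\<dots> \<le> 4 * (real N)\<^sup>2 * (1 / (8 * real N))" using assms by (intro mult_left_mono) auto
  also have "\<dots> = real N / 2" using assms by (simp add: power2_eq_square)
  finally have "norm (of_nat N - dirichlet N y) \<le> real N / 2" by (simp add: dirichlet_0)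
  moreover have "norm (of_nat N :: complex) \<le> norm (of_nat N - dirichlet N y) + norm (dirichlet N y)"
    by (metis diff_add_cancel norm_triangle_ineq)
  ultimately show ?thesis by simp
qed

text \<open>Pair y in [0, pi) with y + pi: at one of the two the square is at least 2^k, so the
  integrand is large somewhere in every pair. Half-open intervals keep the two halves
  disjoint.\<close>

lemma rs_poly_Lq:
  assumes k: "k > 0" and q: "q > 0"
  shows "ennreal (pi * (2 ^ k) powr (q / 2)) \<le>
     (\<integral>\<^sup>+y. ennreal (norm (rs_poly k y) powr q) * indicator {0..2 * pi} y \<partial>lborel)"
proof -
  let ?f = "\<lambda>y. ennreal (norm (rs_poly k y) powr q)"
  have c: "continuous_on UNIV (\<lambda>y. norm (rs_poly k y) powr q)"
    unfolding rs_poly_def using q by (intro continuous_on_powr' continuous_intros) auto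
  have [measurable]: "?f \<in> borel_measurable borel"
    by (intro borel_measurable_continuous_onI continuous_on_ennreal c)
  have "ennreal (pi * (2 ^ k) powr (q / 2)) = (\<integral>\<^sup>+y. ennreal ((2 ^ k) powr (q / 2)) * indicator {0..<pi} y \<partial>lborel)"
    by (subst nn_integral_cmult_indicator) (simp_all add: ennreal_mult'' mult.commute)
  also have "\<dots> \<le> (\<integral>\<^sup>+y. ?f y * indicator {0..<pi} y + ?f (pi + 1 * y) * indicator {pi..<2 * pi} (pi + 1 * y) \<partial>lborel)"
  proof (rule nn_integral_mono)
    fix y :: real
    have "(2 ^ k) powr (q / 2) \<le> norm (rs_poly k y) powr q + norm (rs_poly k (pi + y)) powr q"
    proof -
      have sq: "(2 ^ k) powr (q / 2) \<le> a powr q" if "(2::real) ^ k \<le> a\<^sup>2" "a \<ge> 0" for a :: real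
      proof -
        have "(2 ^ k) powr (q / 2) \<le> (a\<^sup>2) powr (q / 2)" using that q by (intro powr_mono2) auto
        also have "\<dots> = a powr q"
        proof (cases "a = 0")
          case False
          then have "a\<^sup>2 = a powr 2" using that by (simp add: powr_numeral)
          then show ?thesis by (simp add: powr_powr)
        qed simp
        finally show ?thesis .
      qed
      have "2 ^ k \<le> (norm (rs_poly k y))\<^sup>2 \<or> 2 ^ k \<le> (norm (rs_poly k (pi + y)))\<^sup>2"
        using rs_poly_shift_squares[OF k, of y] by (simp add: add.commute) linarith
      then show ?thesis
        using sq[of "norm (rs_poly k y)"] sq[of "norm (rs_poly k (pi + y))"]
        by (auto intro: add_increasing add_increasing2)
    qed
    then have "ennreal ((2 ^ k) powr (q / 2)) \<le> ?f y + ?f (pi + y)"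
      by (simp flip: ennreal_plus add: ennreal_leI)
    then show "ennreal ((2 ^ k) powr (q / 2)) * indicator {0..<pi} y \<le>
       ?f y * indicator {0..<pi} y + ?f (pi + 1 * y) * indicator {pi..<2 * pi} (pi + 1 * y)"
      by (auto simp: indicator_def)
  qed
  also have "\<dots> = (\<integral>\<^sup>+y. ?f y * indicator {0..<pi} y \<partial>lborel) + (\<integral>\<^sup>+y. ?f (pi + 1 * y) * indicator {pi..<2 * pi} (pi + 1 * y) \<partial>lborel)"
    by (rule nn_integral_add) measurable
  also have "(\<integral>\<^sup>+y. ?f (pi + 1 * y) * indicator {pi..<2 * pi} (pi + 1 * y) \<partial>lborel) = (\<integral>\<^sup>+y. ?f y * indicator {pi..<2 * pi} y \<partial>lborel)"
    using nn_integral_real_affine[of "\<lambda>y. ?f y * indicator {pi..<2 * pi} y" 1 pi] by simp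
  also have "(\<integral>\<^sup>+y. ?f y * indicator {0..<pi} y \<partial>lborel) + (\<integral>\<^sup>+y. ?f y * indicator {pi..<2 * pi} y \<partial>lborel) =
     (\<integral>\<^sup>+y. ?f y * indicator {0..<pi} y + ?f y * indicator {pi..<2 * pi} y \<partial>lborel)"
    by (rule nn_integral_add[symmetric]) measurable
  also have "\<dots> \<le> (\<integral>\<^sup>+y. ?f y * indicator {0..2 * pi} y \<partial>lborel)"
    by (rule nn_integral_mono) (auto simp: indicator_def)
  finally show ?thesis .
qed

text \<open>On the cube of side 2 pi/s the minorant is a tensor product, so its integral splits into
  copies of the one-dimensional bound, each scaled by 1/s; outside the cube one of the indicator
  factors is 0.\<close>

lemma Lp_norm_ge_rs_tensor:
  fixes f :: "real ^ 'n \<Rightarrow> complex"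
  assumes k: "k > 0" and q: "q > 0" and s: "s > 0" and A: "A \<ge> 0" and B: "B \<ge> 0"
    and f: "\<And>x. (\<And>j. 0 \<le> s * x $ j \<and> s * x $ j \<le> 2 * pi) \<Longrightarrow> B * (\<Prod>j\<in>UNIV. A * norm (rs_poly k (s * x $ j))) \<le> norm (f x)"
  shows "ennreal (B * (A * sqrt (2 ^ k)) ^ CARD('n) * s powr (- real CARD('n) / q)) \<le> Lp_norm (ennreal q) (\<lambda>x. ennreal (norm (f x)))"
proof (rule Lp_norm_ge[OF q])
  let ?n = "real CARD('n)"
  let ?f = "\<lambda>y. ennreal (norm (rs_poly k y) powr q) * indicator {0..2 * pi} y"
  have c: "continuous_on UNIV (\<lambda>y. norm (rs_poly k y) powr q)"
    unfolding rs_poly_def using q by (intro continuous_on_powr' continuous_intros) auto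
  have [measurable]: "(\<lambda>y. ennreal (norm (rs_poly k y) powr q)) \<in> borel_measurable borel"
    by (intro borel_measurable_continuous_onI continuous_on_ennreal c)
  have 1: "ennreal ((2 ^ k) powr (q / 2) / s) \<le> (\<integral>\<^sup>+y. ?f (s * y) \<partial>lborel)"
  proof -
    have "ennreal s * (\<integral>\<^sup>+y. ?f (s * y) \<partial>lborel) = (\<integral>\<^sup>+y. ?f y \<partial>lborel)"
      using nn_integral_real_affine[of ?f s 0] s by simp
    also have "\<dots> \<ge> ennreal (pi * (2 ^ k) powr (q / 2))" by (rule rs_poly_Lq[OF k q])
    finally have "ennreal (1 / s) * ennreal (pi * (2 ^ k) powr (q / 2)) \<le> ennreal (1 / s) * (ennreal s * (\<integral>\<^sup>+y. ?f (s * y) \<partial>lborel))"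
      by (rule mult_left_mono) simp
    also have "\<dots> = (\<integral>\<^sup>+y. ?f (s * y) \<partial>lborel)"
      using s by (simp add: mult.assoc[symmetric] ennreal_mult'[symmetric] del: ennreal_mult')
    finally have "ennreal (1 / s) * ennreal (pi * (2 ^ k) powr (q / 2)) \<le> (\<integral>\<^sup>+y. ?f (s * y) \<partial>lborel)" .
    moreover have "ennreal ((2 ^ k) powr (q / 2) / s) \<le> ennreal (1 / s) * ennreal (pi * (2 ^ k) powr (q / 2))"
    proof -
      have "1 * (2 ^ k) powr (q / 2) \<le> pi * (2 ^ k) powr (q / 2)" using pi_ge_two by (intro mult_right_mono) auto
      then have "(2 ^ k) powr (q / 2) / s \<le> 1 / s * (pi * (2 ^ k) powr (q / 2))"
        using s by (simp add: divide_right_mono)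
      then show ?thesis using s by (simp add: ennreal_mult'[symmetric] ennreal_leI)
    qed
    ultimately show ?thesis by (rule order.trans[rotated])
  qed
  have "(B * (A * sqrt (2 ^ k)) ^ CARD('n) * s powr (- ?n / q)) powr q =
      B powr q * (A powr q * ((2 ^ k) powr (q / 2) / s)) ^ CARD('n)"
  proof -
    have e1: "(s powr (- ?n / q)) powr q = inverse s ^ CARD('n)"
    proof -
      have "(s powr (- ?n / q)) powr q = s powr (- ?n)" using q by (simp only: powr_powr) simp
      then show ?thesis by (simp only: powr_minus powr_realpow[OF s] power_inverse)
    qed
    have e2: "((A * sqrt (2 ^ k)) ^ CARD('n)) powr q = ((A * sqrt (2 ^ k)) powr q) ^ CARD('n)"
    proof -
      have "(x ^ m) powr q = (x powr q) ^ m" for x :: real and m by (induction m) (simp_all add: powr_mult)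
      then show ?thesis .
    qed
    have e3: "sqrt (2 ^ k) powr q = (2 ^ k) powr (q / 2)"
    proof -
      have "sqrt (2 ^ k) = (2 ^ k) powr (1 / 2)" by (simp add: powr_half_sqrt)
      then have "sqrt (2 ^ k) powr q = (2 ^ k) powr (1 / 2 * q)" by (simp only: powr_powr)
      then show ?thesis by simp
    qed
    show ?thesis
      unfolding powr_mult[of "B * (A * sqrt (2 ^ k)) ^ CARD('n)"] powr_mult[of B] e1 e2
      unfolding powr_mult[of A] e3 unfolding divide_inverse power_mult_distrib by (simp only: mult.assoc)
  qed
  moreover have "0 \<le> (2 ^ k) powr (q / 2) / s" using s by simp
  ultimately have "ennreal ((B * (A * sqrt (2 ^ k)) ^ CARD('n) * s powr (- ?n / q)) powr q) =
     ennreal (B powr q) * (\<Prod>j\<in>(UNIV::'n set). ennreal (A powr q) * ennreal ((2 ^ k) powr (q / 2) / s))"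
    by (simp only: prod_constant ennreal_mult[symmetric] ennreal_power powr_ge_zero mult_nonneg_nonneg zero_le_power)
  also have "\<dots> \<le> ennreal (B powr q) * (\<Prod>j\<in>(UNIV::'n set). ennreal (A powr q) * (\<integral>\<^sup>+y. ?f (s * y) \<partial>lborel))"
    by (intro mult_left_mono prod_mono_ennreal 1) auto
  also have "\<dots> = ennreal (B powr q) * (\<Prod>j\<in>(UNIV::'n set). (\<integral>\<^sup>+y. ennreal (A powr q) * ?f (s * y) \<partial>lborel))"
    by (subst nn_integral_cmult) auto
  also have "\<dots> = ennreal (B powr q) * (\<integral>\<^sup>+x. (\<Prod>j\<in>UNIV. ennreal (A powr q) * ?f (s * (x :: real ^ 'n) $ j)) \<partial>lborel)"
    by (subst nn_integral_tensor) auto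
  also have "\<dots> = (\<integral>\<^sup>+x. ennreal (B powr q) * (\<Prod>j\<in>UNIV. ennreal (A powr q) * ?f (s * (x :: real ^ 'n) $ j)) \<partial>lborel)"
    by (subst nn_integral_cmult) auto
  also have "\<dots> \<le> (\<integral>\<^sup>+x. epowr (ennreal (norm (f x))) q \<partial>lborel)"
  proof (rule nn_integral_mono)
    fix x :: "real ^ 'n"
    show "ennreal (B powr q) * (\<Prod>j\<in>UNIV. ennreal (A powr q) * ?f (s * x $ j)) \<le> epowr (ennreal (norm (f x))) q"
    proof (cases "\<forall>j. 0 \<le> s * x $ j \<and> s * x $ j \<le> 2 * pi")
      case True
      then have "ennreal (B powr q) * (\<Prod>j\<in>UNIV. ennreal (A powr q) * ?f (s * x $ j)) =
         ennreal ((B * (\<Prod>j\<in>UNIV. A * norm (rs_poly k (s * x $ j)))) powr q)"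
        by (simp add: powr_mult prod_powr_distrib prod_ennreal ennreal_mult prod_nonneg A flip: ennreal_mult)
      also have "\<dots> \<le> ennreal (norm (f x) powr q)"
        using True q A B by (intro ennreal_leI powr_mono2 f mult_nonneg_nonneg prod_nonneg) auto
      finally show ?thesis by (simp add: epowr_ennreal)
    next
      case False
      then obtain j where "\<not> (0 \<le> s * x $ j \<and> s * x $ j \<le> 2 * pi)" by blast
      then have "(\<Prod>j\<in>UNIV. ennreal (A powr q) * ?f (s * x $ j)) = 0"
        by (intro prod_zero) (auto simp: indicator_def intro!: bexI[of _ j])
      then show ?thesis by (simp only: mult_zero_right zero_le)
    qed
  qed
  finally show "ennreal ((B * (A * sqrt (2 ^ k)) ^ CARD('n) * s powr (- ?n / q)) powr q) \<le> (\<integral>\<^sup>+x. epowr (ennreal (norm (f x))) q \<partial>lborel)" .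
qed (use A B in simp)

lemma rs_sum_eq:
  "(\<Sum>l=3*8^k..<4*8^k. of_real (rs_coeff (3 * k) (l - 3 * 8 ^ k)) * cis (real l * y)) =
     cis (real (3 * 8 ^ k) * y) * rs_poly (3 * k) y"
proof -
  have N: "(2::nat) ^ (3 * k) = 8 ^ k" by (simp add: power_mult)
  have "(\<Sum>l=3*8^k..<4*8^k. of_real (rs_coeff (3 * k) (l - 3 * 8 ^ k)) * cis (real l * y)) =
      (\<Sum>l=0..<8^k. of_real (rs_coeff (3 * k) l) * cis (real (l + 3 * 8 ^ k) * y))"
    using sum.shift_bounds_nat_ivl[of "\<lambda>l. of_real (rs_coeff (3 * k) (l - 3 * 8 ^ k)) * cis (real l * y)" 0 "3 * 8 ^ k" "8 ^ k"]
    by simp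
  also have "\<dots> = cis (real (3 * 8 ^ k) * y) * rs_poly (3 * k) y"
    unfolding rs_poly_def sum_distrib_left N lessThan_atLeast0
    by (intro sum.cong) (auto simp: cis_mult algebra_simps)
  finally show ?thesis .
qed

text \<open>The prescribed coefficients of the output. Their vanishing outside [3 * 8^k, 4 * 8^k) is
  what makes all convolution multiplicities equal to 8^k.\<close>

definition kernel_sum :: "bool \<Rightarrow> nat \<Rightarrow> nat \<Rightarrow> real" where
  "kernel_sum peaked k l = (if 3 * 8 ^ k \<le> l \<and> l < 4 * 8 ^ k
     then (if peaked then 1 else rs_coeff (3 * k) (l - 3 * 8 ^ k)) else 0)"

lemma kernel_sum_eq:
  "(\<Sum>l=3*8^k..<4*8^k. of_real (kernel_sum peaked k l) * cis (real l * y)) =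
     (if peaked then dirichlet (8 ^ k) y else cis (real (3 * 8 ^ k) * y) * rs_poly (3 * k) y)"
proof -
  have "(\<Sum>l=3*8^k..<4*8^k. of_real (kernel_sum peaked k l) * cis (real l * y)) =
    (\<Sum>l=3*8^k..<4*8^k. of_real (if peaked then 1 else rs_coeff (3 * k) (l - 3 * 8 ^ k)) * cis (real l * y))"
    by (intro sum.cong) (auto simp: kernel_sum_def)
  then show ?thesis by (auto simp: dirichlet_def rs_sum_eq)
qed

section \<open>Size of the outputs in L^p and BMO\<close>

context plateau
begin

abbreviation kap :: real where "kap \<equiv> \<rho> / (1 - \<rho>)"

text \<open>The closed form of the operator on a pair of admissible inputs, with
  \<open>kernel_sum\<close> as output coefficients.\<close>

definition model_output :: "bool \<Rightarrow> real \<Rightarrow> (real \<Rightarrow> complex) \<Rightarrow> (real \<Rightarrow> complex) \<Rightarrow> nat \<Rightarrow> real ^ 'n \<Rightarrow> complex" where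
  "model_output peaked m \<eta>1 \<eta>2 k x = of_real (freq \<rho> k powr m) *
     (\<Prod>j\<in>UNIV. 8 ^ k * (\<Sum>l=3*8^k..<4*8^k. of_real (kernel_sum peaked k l) * cis (real l * (spacing \<rho> k * x $ j))) *
           ift \<eta>1 (spacing \<rho> k * x $ j) * ift \<eta>2 (spacing \<rho> k * x $ j))"

lemma norm_model_output:
  "norm (model_output peaked m \<eta>1 \<eta>2 k x) = freq \<rho> k powr m *
     (\<Prod>j\<in>UNIV. 8 ^ k * norm (if peaked then dirichlet (8 ^ k) (spacing \<rho> k * x $ j) else rs_poly (3 * k) (spacing \<rho> k * x $ j)) *
           (norm (ift \<eta>1 (spacing \<rho> k * x $ j)) * norm (ift \<eta>2 (spacing \<rho> k * x $ j))))"
  unfolding model_output_def kernel_sum_eq norm_mult norm_of_real prod_norm[symmetric] norm_power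
  by (cases peaked) (simp_all add: norm_mult mult.assoc)

context
  fixes \<eta>1 \<eta>2 :: "real \<Rightarrow> complex" and C0 :: real
  assumes \<eta>: "\<And>y. \<bar>y\<bar> \<le> 2 * pi \<Longrightarrow> 1 / 16 \<le> norm (ift \<eta>1 y)" "\<And>y. \<bar>y\<bar> \<le> 2 * pi \<Longrightarrow> 1 / 16 \<le> norm (ift \<eta>2 y)"
    and C0: "C0 \<ge> 1" "\<And>y. norm (ift \<eta>1 y) * norm (ift \<eta>2 y) \<le> C0"
begin

lemma \<eta>_prod: "\<bar>y\<bar> \<le> 2 * pi \<Longrightarrow> 1 / 256 \<le> norm (ift \<eta>1 y) * norm (ift \<eta>2 y)"
  using mult_mono[OF \<eta>(1)[of y] \<eta>(2)[of y]] by simp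

text \<open>Per coordinate: multiplicity X = 8^k, root mean square X^(1/2) of the polynomial,
  constant 1/256 from the profiles, on a cube of side 2 pi/s; all powers are then expressed through
  X.\<close>

lemma flat_output_ge:
  assumes k: "k > 0" and q: "q > 0"
  shows "ennreal ((1 / 256) ^ CARD('n) * (8 ^ k) powr (m / (1 - \<rho>) + real CARD('n) * (3 / 2 - kap / q))) \<le>
     Lp_norm (ennreal q) (\<lambda>x::real ^ 'n. ennreal (norm (model_output False m \<eta>1 \<eta>2 k x)))"
proof -
  let ?s = "spacing \<rho> k" and ?n = "real CARD('n)" and ?X = "8 ^ k :: real"
  have "ennreal (freq \<rho> k powr m * (?X / 256 * sqrt (2 ^ (3 * k))) ^ CARD('n) * ?s powr (- ?n / q)) \<le>
     Lp_norm (ennreal q) (\<lambda>x::real ^ 'n. ennreal (norm (model_output False m \<eta>1 \<eta>2 k x)))"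
  proof (rule Lp_norm_ge_rs_tensor)
    fix x :: "real ^ 'n" assume x: "\<And>j. 0 \<le> ?s * x $ j \<and> ?s * x $ j \<le> 2 * pi"
    show "freq \<rho> k powr m * (\<Prod>j\<in>UNIV. ?X / 256 * norm (rs_poly (3 * k) (?s * x $ j))) \<le> norm (model_output False m \<eta>1 \<eta>2 k x)"
      unfolding norm_model_output
    proof (intro mult_left_mono prod_mono conjI)
      fix j
      have "1 / 256 \<le> norm (ift \<eta>1 (?s * x $ j)) * norm (ift \<eta>2 (?s * x $ j))"
        by (rule \<eta>_prod) (use x[of j] in auto)
      then have "?X * norm (rs_poly (3 * k) (?s * x $ j)) * (1 / 256) \<le>
          ?X * norm (rs_poly (3 * k) (?s * x $ j)) * (norm (ift \<eta>1 (?s * x $ j)) * norm (ift \<eta>2 (?s * x $ j)))"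
        by (rule mult_left_mono) simp
      then show "?X / 256 * norm (rs_poly (3 * k) (?s * x $ j)) \<le> ?X *
          norm (if False then dirichlet (8 ^ k) (?s * x $ j) else rs_poly (3 * k) (?s * x $ j)) *
          (norm (ift \<eta>1 (?s * x $ j)) * norm (ift \<eta>2 (?s * x $ j)))" by simp
    qed auto
  qed (use k q spacing_pos in auto)
  also have "freq \<rho> k powr m * (?X / 256 * sqrt (2 ^ (3 * k))) ^ CARD('n) * ?s powr (- ?n / q) =
     (1 / 256) ^ CARD('n) * ?X powr (m / (1 - \<rho>) + ?n * (3 / 2 - kap / q))"
  proof -
    have 1: "freq \<rho> k powr m = ?X powr (m / (1 - \<rho>))" unfolding freq_eq[OF \<rho>(2)] powr_powr by simp
    have "sqrt (2 ^ (3 * k)) = ?X powr (1 / 2)" by (simp add: powr_half_sqrt power_mult)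
    then have "?X / 256 * sqrt (2 ^ (3 * k)) = (1 / 256) * (?X powr 1 * ?X powr (1 / 2))" by simp
    also have "\<dots> = (1 / 256) * ?X powr (3 / 2)" by (simp only: powr_add[symmetric]) simp
    finally have "(?X / 256 * sqrt (2 ^ (3 * k))) ^ CARD('n) = (1 / 256) ^ CARD('n) * (?X powr (3 / 2)) powr ?n"
      by (simp only: power_mult_distrib) (simp add: powr_realpow)
    then have 2: "(?X / 256 * sqrt (2 ^ (3 * k))) ^ CARD('n) = (1 / 256) ^ CARD('n) * ?X powr (3 / 2 * ?n)"
      by (simp only: powr_powr)
    have 3: "?s powr (- ?n / q) = ?X powr (kap * (- ?n / q))" unfolding spacing_eq[OF \<rho>(2)] powr_powr ..
    have 4: "m / (1 - \<rho>) + ?n * (3 / 2 - kap / q) = m / (1 - \<rho>) + 3 / 2 * ?n + kap * (- ?n / q)" by (simp add: algebra_simps)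
    show ?thesis unfolding 1 2 3 4 unfolding powr_add by (simp only: mult_ac)
  qed
  finally show ?thesis .
qed

text \<open>On this cube s x_j <= 1/(8 * 8^k), within the peak of the Dirichlet kernel. Each
  coordinate contributes X from the multiplicity, X/2 from the kernel and 1/256 from the
  profiles.\<close>

lemma peaked_ge:
  fixes x :: "real ^ 'n"
  assumes "\<And>j. 0 \<le> x $ j \<and> x $ j \<le> 1 / (8 * freq \<rho> k)"
  shows "freq \<rho> k powr m * ((8 ^ k)\<^sup>2 / 512) ^ CARD('n) \<le> norm (model_output True m \<eta>1 \<eta>2 k x)"
proof -
  let ?s = "spacing \<rho> k"
  have s: "?s > 0" by (rule spacing_pos)
  have "(\<Prod>j\<in>(UNIV :: 'n set). (8 ^ k)\<^sup>2 / 512) \<le> (\<Prod>j\<in>UNIV. 8 ^ k * norm (dirichlet (8 ^ k) (?s * x $ j)) *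
      (norm (ift \<eta>1 (?s * x $ j)) * norm (ift \<eta>2 (?s * x $ j))))"
  proof (intro prod_mono conjI)
    fix j
    have "?s * x $ j \<le> ?s * (1 / (8 * freq \<rho> k))" using s assms[of j] by (intro mult_left_mono) auto
    also have "\<dots> = 1 / (8 * 8 ^ k)" unfolding freq_spacing[OF \<rho>(2)] using s by simp
    finally have y: "\<bar>?s * x $ j\<bar> \<le> 1 / (8 * 8 ^ k)" using s assms[of j] by simp
    also have "\<dots> \<le> 2 * pi"
    proof -
      have o: "(1::real) \<le> 8 ^ k" by (rule one_le_power) simp
      have "1 / (8 * 8 ^ k) \<le> (1::real)" by (subst divide_le_eq_1_pos) (use o in linarith)+
      then show ?thesis using pi_ge_two by linarith
    qed
    finally have "1 / 256 \<le> norm (ift \<eta>1 (?s * x $ j)) * norm (ift \<eta>2 (?s * x $ j))" by (rule \<eta>_prod)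
    moreover have "8 ^ k / 2 \<le> norm (dirichlet (8 ^ k) (?s * x $ j))"
      using dirichlet_ge[of "?s * x $ j" "8 ^ k"] y by simp
    ultimately have "8 ^ k * (8 ^ k / 2) * (1 / 256) \<le> 8 ^ k * norm (dirichlet (8 ^ k) (?s * x $ j)) *
      (norm (ift \<eta>1 (?s * x $ j)) * norm (ift \<eta>2 (?s * x $ j)))"
      by (intro mult_mono mult_left_mono) auto
    then show "(8 ^ k)\<^sup>2 / 512 \<le> 8 ^ k * norm (dirichlet (8 ^ k) (?s * x $ j)) *
      (norm (ift \<eta>1 (?s * x $ j)) * norm (ift \<eta>2 (?s * x $ j)))" by (simp add: power2_eq_square)
  qed auto
  then show ?thesis unfolding norm_model_output by (simp add: mult_left_mono)
qed

lemma freq_powr: "freq \<rho> k powr t = (8 ^ k) powr (t / (1 - \<rho>))"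
  unfolding freq_eq[OF \<rho>(2)] powr_powr by simp

lemma square_power_powr: "((8 ^ k)\<^sup>2 / 512) ^ N = (1 / 512) ^ N * ((8::real) ^ k) powr (2 * real N)"
proof -
  have "((8::real) ^ k)\<^sup>2 = (8 ^ k) powr 2" by (simp add: powr_numeral)
  moreover have "((8::real) ^ k) powr (2 * real N) = ((8 ^ k) powr 2) ^ N"
  proof -
    have "((8::real) ^ k) powr (2 * real N) = ((8 ^ k) powr 2) powr real N" by (simp only: powr_powr)
    also have "\<dots> = ((8 ^ k) powr 2) ^ N" by (rule powr_realpow) simp
    finally show ?thesis .
  qed
  ultimately show ?thesis by (simp only: power_divide power_one) simp
qed

lemma peaked_output_ge:
  assumes q: "q > 0"
  shows "ennreal ((1 / 512) ^ CARD('n) * (1 / 8) powr (real CARD('n) / q) * (8 ^ k) powr (m / (1 - \<rho>) + real CARD('n) * (2 - 1 / q / (1 - \<rho>)))) \<le>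
     Lp_norm (ennreal q) (\<lambda>x::real ^ 'n. ennreal (norm (model_output True m \<eta>1 \<eta>2 k x)))"
proof -
  let ?n = "real CARD('n)" and ?X = "8 ^ k :: real"
  have "ennreal (freq \<rho> k powr m * (?X\<^sup>2 / 512) ^ CARD('n) * (1 / (8 * freq \<rho> k)) powr (?n / q)) \<le>
     Lp_norm (ennreal q) (\<lambda>x::real ^ 'n. ennreal (norm (model_output True m \<eta>1 \<eta>2 k x)))"
    by (rule Lp_norm_ge_cbox[OF q _ _ peaked_ge]) (use freq_pos in auto)
  also have "freq \<rho> k powr m * (?X\<^sup>2 / 512) ^ CARD('n) * (1 / (8 * freq \<rho> k)) powr (?n / q) =
     (1 / 512) ^ CARD('n) * (1 / 8) powr (?n / q) * ?X powr (m / (1 - \<rho>) + ?n * (2 - 1 / q / (1 - \<rho>)))"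
  proof -
    have R: "freq \<rho> k powr - 1 = inverse (freq \<rho> k)"
      using powr_minus[of "freq \<rho> k" 1] freq_pos[of \<rho> k] by simp
    have "1 / (8 * freq \<rho> k) = 1 / 8 * freq \<rho> k powr - 1"
      unfolding R by (simp only: divide_inverse inverse_mult_distrib mult_1_left)
    then have "(1 / (8 * freq \<rho> k)) powr (?n / q) = (1 / 8) powr (?n / q) * freq \<rho> k powr (- 1 * (?n / q))"
      by (simp only: powr_mult powr_powr)
    then have "(1 / (8 * freq \<rho> k)) powr (?n / q) = (1 / 8) powr (?n / q) * ?X powr (- (?n / q) / (1 - \<rho>))"
      unfolding freq_powr[of k "- 1 * (?n / q)"] by (simp only: mult_minus1)
    moreover have "m / (1 - \<rho>) + ?n * (2 - 1 / q / (1 - \<rho>)) = m / (1 - \<rho>) + 2 * ?n + - (?n / q) / (1 - \<rho>)"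
      by (simp add: algebra_simps)
    ultimately show ?thesis
      unfolding square_power_powr freq_powr[of k m] by (simp only: powr_add mult_ac)
  qed
  finally show ?thesis .
qed

text \<open>The cube of side 2 pi/R has the peak of the kernel at one corner and its first zero, in
  every coordinate, at the opposite corner. Two subcubes of side d there occupy a fraction of the
  cube that is independent of k, so the mean oscillation is comparable to the peak.\<close>

lemma peaked_output_bmo_ge:
  assumes k: "k > 0"
  shows "ennreal (3 / 8 * (1 / 512) ^ CARD('n) * (1 / (16384 * pi * C0)) ^ CARD('n) * (8 ^ k) powr (m / (1 - \<rho>) + real CARD('n) * 2)) \<le>
     bmo_norm (model_output True m \<eta>1 \<eta>2 k :: real ^ 'n \<Rightarrow> complex)"
proof -
  let ?n = "real CARD('n)" and ?X = "8 ^ k :: real" and ?s = "spacing \<rho> k" and ?R = "freq \<rho> k"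
  have s: "?s > 0" and R: "?R > 0" by (rule spacing_pos freq_pos)+
  have X: "?X \<ge> 8" using power_increasing[of 1 k "8::real"] k by simp
  \<comment> \<open>Chosen so that near the zero the kernel is at most X/(2048 C0): with
    multiplicity X and profiles bounded by C0 this is a quarter of the peak value X^2/512.\<close>
  define d where "d = 1 / (8192 * C0 * ?R)"
  define L where "L = 2 * pi / ?R"
  have d0: "d > 0" and L0: "L > 0" using R C0 by (simp_all add: d_def L_def)
  have dL: "d \<le> 1 / (8 * ?R)" using R C0 by (simp add: d_def field_simps)
  also have "\<dots> \<le> L" unfolding L_def using R pi_ge_two by (simp add: field_simps)
  finally have dL': "d \<le> L" .
  define H where "H = ?R powr m * (?X\<^sup>2 / 512) ^ CARD('n)"
  have H: "H \<ge> 0" by (simp add: H_def)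
  define Q :: "(real ^ 'n) set" where "Q = cbox 0 (\<chi> i. L)"
  define E1 :: "(real ^ 'n) set" where "E1 = cbox 0 (\<chi> i. d)"
  define E2 :: "(real ^ 'n) set" where "E2 = cbox (\<chi> i. L - d) (\<chi> i. L)"
  have em: "emeasure lborel (cbox (\<chi> i. l) (\<chi> i. u) :: (real ^ 'n) set) = ennreal ((u - l) ^ CARD('n))" if "l \<le> u" for l u
    using that by (simp add: emeasure_lborel_cbox_eq Basis_cart inner_axis prod.reindex[OF inj_axis_1] o_def)
  have z: "(0 :: real ^ 'n) = (\<chi> i. 0)" by (simp add: vec_eq_iff)
  have "ennreal (3 / 8 * H) * ennreal (d ^ CARD('n)) / emeasure lborel Q \<le> bmo_norm (model_output True m \<eta>1 \<eta>2 k :: real ^ 'n \<Rightarrow> complex)"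
  proof (rule bmo_norm_ge[of Q E1 E2])
    have "Q = cbox 0 (\<chi> i. (0 :: real ^ 'n) $ i + L)" by (simp add: Q_def)
    then show "Q \<in> cubes" unfolding cubes_def using L0 by blast
    show "E1 \<subseteq> Q"
    proof
      fix x assume "x \<in> E1"
      then have "0 \<le> x $ i" "x $ i \<le> d" for i by (auto simp: E1_def mem_box_cart)
      then show "x \<in> Q" using dL' by (auto simp: Q_def mem_box_cart intro: order.trans)
    qed
    show "E2 \<subseteq> Q"
    proof
      fix x assume "x \<in> E2"
      then have x: "L - d \<le> x $ i" "x $ i \<le> L" for i by (auto simp: E2_def mem_box_cart)
      have "0 \<le> x $ i" for i using x(1)[of i] dL' by linarith
      then show "x \<in> Q" using x by (auto simp: Q_def mem_box_cart)
    qed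
    show "ennreal (d ^ CARD('n)) \<le> emeasure lborel E1" unfolding E1_def z using em[of 0 d] d0 by simp
    show "ennreal (d ^ CARD('n)) \<le> emeasure lborel E2" unfolding E2_def using em[of "L - d" L] d0 by simp
    show "H \<le> norm (model_output True m \<eta>1 \<eta>2 k x)" if "x \<in> E1" for x :: "real ^ 'n"
      unfolding H_def
    proof (rule peaked_ge)
      fix j
      have "0 \<le> x $ j" "x $ j \<le> d" using that by (auto simp: E1_def mem_box_cart)
      then show "0 \<le> x $ j \<and> x $ j \<le> 1 / (8 * ?R)" using dL by linarith
    qed
    show "norm (model_output True m \<eta>1 \<eta>2 k x) \<le> H / 4" if x: "x \<in> E2" for x :: "real ^ 'n"
    proof -
      have "(\<Prod>j\<in>UNIV. 8 ^ k * norm (dirichlet (8 ^ k) (?s * x $ j)) *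
          (norm (ift \<eta>1 (?s * x $ j)) * norm (ift \<eta>2 (?s * x $ j)))) \<le> (\<Prod>j\<in>(UNIV :: 'n set). ?X\<^sup>2 / 512 / 4)"
      proof (intro prod_mono conjI)
        fix j
        have xj: "L - d \<le> x $ j" "x $ j \<le> L" using x by (auto simp: E2_def mem_box_cart)
        have sL: "?s * L = 2 * pi / real (8 ^ k)" unfolding L_def freq_spacing[OF \<rho>(2)] using s by simp
        have sd: "?s * d = 1 / (8192 * C0 * ?X)" unfolding d_def freq_spacing[OF \<rho>(2)] using s by simp
        have "\<bar>?s * x $ j - ?s * L\<bar> \<le> ?s * d"
          using xj s by (simp add: abs_mult flip: right_diff_distrib)
        then have "norm (dirichlet (8 ^ k) (?s * x $ j) - dirichlet (8 ^ k) (2 * pi / real (8 ^ k))) \<le> 4 * (real (8 ^ k))\<^sup>2 * (1 / (8192 * C0 * ?X))"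
          unfolding sL sd by (intro order.trans[OF dirichlet_lipschitz] mult_left_mono) auto
        moreover have "dirichlet (8 ^ k) (2 * pi / real (8 ^ k)) = 0"
        proof (rule dirichlet_root)
          show "2 \<le> (8::nat) ^ k" using power_increasing[of 1 k "8::nat"] k by simp
        qed
        ultimately have "norm (dirichlet (8 ^ k) (?s * x $ j)) \<le> ?X / (2048 * C0)"
          using X C0 by (simp add: power2_eq_square field_simps)
        then have "8 ^ k * norm (dirichlet (8 ^ k) (?s * x $ j)) * (norm (ift \<eta>1 (?s * x $ j)) * norm (ift \<eta>2 (?s * x $ j))) \<le>
            ?X * (?X / (2048 * C0)) * C0"
          using C0 by (intro mult_mono mult_left_mono C0) auto
        also have "\<dots> = ?X\<^sup>2 / 512 / 4" using C0 by (simp add: power2_eq_square)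
        finally show "8 ^ k * norm (dirichlet (8 ^ k) (?s * x $ j)) * (norm (ift \<eta>1 (?s * x $ j)) * norm (ift \<eta>2 (?s * x $ j))) \<le> ?X\<^sup>2 / 512 / 4" .
      qed auto
      also have "\<dots> = (?X\<^sup>2 / 512) ^ CARD('n) / 4 ^ CARD('n)"
        by (simp only: prod_constant power_divide)
      \<comment> \<open>The dimension is at least 1, so one factor 1/4 may be kept and the rest
        dropped.\<close>
      also have "\<dots> \<le> (?X\<^sup>2 / 512) ^ CARD('n) / 4"
      proof -
        have "(4::real) ^ 1 \<le> 4 ^ CARD('n)" by (rule power_increasing) (simp_all add: Suc_leI)
        then show ?thesis by (intro divide_left_mono) auto
      qed
      finally have "?R powr m * (\<Prod>j\<in>UNIV. 8 ^ k * norm (dirichlet (8 ^ k) (?s * x $ j)) *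
          (norm (ift \<eta>1 (?s * x $ j)) * norm (ift \<eta>2 (?s * x $ j)))) \<le> ?R powr m * ((?X\<^sup>2 / 512) ^ CARD('n) / 4)"
        by (rule mult_left_mono) simp
      then show ?thesis unfolding norm_model_output H_def if_True by (simp only: times_divide_eq_right)
    qed
  qed (use H in \<open>auto simp: E1_def E2_def\<close>)
  also have "ennreal (3 / 8 * H) * ennreal (d ^ CARD('n)) / emeasure lborel Q = ennreal (3 / 8 * H * (d / L) ^ CARD('n))"
  proof -
    have "emeasure lborel Q = ennreal (L ^ CARD('n))" unfolding Q_def z using em[of 0 L] L0 by simp
    then show ?thesis using H d0 L0 by (simp add: ennreal_mult'[symmetric] divide_ennreal power_divide)
  qed
  also have "d / L = 1 / (16384 * pi * C0)" using R C0 by (simp add: d_def L_def field_simps)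
  also have "3 / 8 * H * (1 / (16384 * pi * C0)) ^ CARD('n) =
     3 / 8 * (1 / 512) ^ CARD('n) * (1 / (16384 * pi * C0)) ^ CARD('n) * ?X powr (m / (1 - \<rho>) + ?n * 2)"
    unfolding H_def square_power_powr freq_powr[of k m] mult.commute[of ?n 2] by (simp only: powr_add mult_ac)
  finally show ?thesis .
qed

lemma output_ge:
  assumes p: "p > 0"
  shows "\<exists>c>0. \<forall>k>0. ennreal (c * (8 ^ k) powr (m / (1 - \<rho>) + real CARD('n) *
      (if 2 \<le> p then 2 - enn2real (1 / p) / (1 - \<rho>) else 3 / 2 - kap * enn2real (1 / p)))) \<le>
     (if p < \<infinity> then (\<lambda>g. Lp_norm p (\<lambda>x. ennreal (norm (g x)))) else bmo_norm) (model_output (2 \<le> p) m \<eta>1 \<eta>2 k :: real ^ 'n \<Rightarrow> complex)"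
proof (cases p)
  case (real q)
  then have q: "q > 0" using p by auto
  have fin: "p < \<top>" using real by simp
  have e: "enn2real (1 / p) = 1 / q" using enn2real_inverse[OF q] real by simp
  show ?thesis
  proof (cases "2 \<le> p")
    case True
    show ?thesis
      using peaked_output_ge[OF q, where 'n = 'n] True
      by (intro exI[of _ "(1 / 512) ^ CARD('n) * (1 / 8) powr (real CARD('n) / q)"]) (simp add: e fin real(2)[symmetric] real(1))
  next
    case False
    show ?thesis
      using flat_output_ge[OF _ q, where 'n = 'n] False
      by (intro exI[of _ "(1 / 256) ^ CARD('n)"]) (simp add: e fin real(2)[symmetric] real(1))
  qed
next
  case top
  then show ?thesis
    using peaked_output_bmo_ge[where 'n = 'n] C0(1)
    by (intro exI[of _ "3 / 8 * (1 / 512) ^ CARD('n) * (1 / (16384 * pi * C0)) ^ CARD('n)"]) simp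
qed

end

end

section \<open>The two inequalities\<close>

lemma bounded_growth:
  fixes E c B :: real
  assumes "c > 0" and "\<And>k. k > 0 \<Longrightarrow> c * (8 ^ k) powr E \<le> B"
  shows "E \<le> 0"
proof (rule ccontr)
  assume E: "\<not> E \<le> 0"
  have pw: "((8::real) ^ k) powr E = (8 powr E) ^ k" for k
  proof -
    have "((8::real) ^ k) powr E = (8 powr real k) powr E" by (simp add: powr_realpow)
    also have "\<dots> = (8 powr E) powr real k" by (simp only: powr_powr mult.commute)
    also have "\<dots> = (8 powr E) ^ k" by (rule powr_realpow) simp
    finally show ?thesis .
  qed
  have "1 < (8::real) powr E" using E by simp
  then obtain k where k: "B / c < (8 powr E) ^ k" using real_arch_pow by blast
  also have "\<dots> \<le> (8 powr E) ^ Suc k" using \<open>1 < 8 powr E\<close> by (intro power_increasing) auto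
  finally have "B < c * (8 ^ Suc k) powr E" unfolding pw using assms(1) by (simp add: field_simps)
  then show False using assms(2)[of "Suc k"] by simp
qed

lemma Lp_exponent_le:
  fixes \<phi> :: "real ^ 'n \<Rightarrow> complex"
  assumes \<rho>: "0 < \<rho>" "\<rho> < 1" and p: "0 < p1" "0 < p2" "0 < p" and \<phi>: "\<phi> \<in> schwartz"
    and bdd: "\<And>\<sigma> :: real ^ 'n \<Rightarrow> real ^ 'n \<Rightarrow> real ^ 'n \<Rightarrow> complex. \<sigma> \<in> BS m \<rho> \<Longrightarrow>
           bounded_op (T_op \<sigma>) (hardy \<phi> p1) (hardy_norm \<phi> p1) (hardy \<phi> p2) (hardy_norm \<phi> p2)
             (if p < \<infinity> then (\<lambda>g. Lp_norm p (\<lambda>x. ennreal (norm (g x)))) else bmo_norm)"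
  shows "enn2real (1 / p) \<le> enn2real (1 / p1) + enn2real (1 / p2)"
proof (cases p)
  case top
  then show ?thesis by simp
next
  case (real q)
  then have q: "q > 0" using p by auto
  have fin: "p < \<infinity>" using real by simp
  have pq: "p = ennreal q" using real by simp
  obtain h :: "real \<Rightarrow> real" where h: "smooth1 (\<lambda>u. of_real (h u))" "\<And>u. - 1/16 \<le> u \<Longrightarrow> u \<le> 1/16 \<Longrightarrow> h u = 1"
    "\<And>u. u \<le> - 1/8 \<or> 1/8 \<le> u \<Longrightarrow> h u = 0"
    by (rule plateau_exists[of "- 1/8" "- 1/16" "1/16" "1/8"]) auto
  \<comment> \<open>The support avoids 0, as the Hardy norm estimate requires, and stays below 1/16,
    where the symbol equals 1.\<close>
  obtain w :: "real \<Rightarrow> real" where w: "smooth1 (\<lambda>u. of_real (w u))" "\<And>u. 0 \<le> w u" "\<And>u. 1/40 \<le> u \<Longrightarrow> u \<le> 1/32 \<Longrightarrow> w u = 1"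
    "\<And>u. u \<le> 1/64 \<or> 1/16 \<le> u \<Longrightarrow> w u = 0"
    by (rule plateau_exists[of "1/64" "1/40" "1/32" "1/16"]) auto
  have tw: "test_fun (\<lambda>u. complex_of_real (w u))"
    unfolding test_fun_def
  proof (intro conjI exI allI impI)
    show "complex_of_real (w u) = 0" if "1/16 \<le> \<bar>u\<bar>" for u
      using w(4)[of u] that by (cases "u \<le> 0") auto
  qed (rule w(1))
  \<comment> \<open>One bump at the origin with unit scale: on its support the frequencies are
    bounded, so comparability holds and every order m is admissible.\<close>
  interpret symbol_data "{()}" "\<lambda>_. 1" "\<lambda>_. 1" "\<lambda>_. 1" "\<lambda>_. 0 :: real ^ 'n" "\<lambda>_. 0" "\<lambda>u. of_real (h u)" m \<rho> "1 + real CARD('n)"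
  proof (unfold_locales, goal_cases)
    case (2 u)
    then have "u \<le> - 1/8 \<or> 1/8 \<le> u" by (auto simp: abs_if split: if_splits)
    then show ?case using h(3) by simp
  next
    case (8 i x y)
    have xy: "\<bar>x $ j\<bar> \<le> 1/8" "\<bar>y $ j\<bar> \<le> 1/8" for j using 8(2)[of j] by auto
    have "norm x \<le> CARD('n) * (1/8)" "norm y \<le> CARD('n) * (1/8)" by (rule norm_vec_le; rule xy)+
    then have "1 + norm x + norm y \<le> 1 + real CARD('n)" by linarith
    moreover have "1 * 1 \<le> (1 + real CARD('n)) * (1 + norm x + norm y)"
      by (intro mult_mono) auto
    ultimately show ?case by simp
  qed (use h(1) in auto)
  obtain C where C: "C > 0" "\<And>f1 f2. f1 \<in> schwartz \<Longrightarrow> f2 \<in> schwartz \<Longrightarrow> distr_of f1 \<in> hardy \<phi> p1 \<Longrightarrow> distr_of f2 \<in> hardy \<phi> p2 \<Longrightarrow>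
      Lp_norm p (\<lambda>x. ennreal (norm (T_op symbol f1 f2 x))) \<le> ennreal C * hardy_norm \<phi> p1 (distr_of f1) * hardy_norm \<phi> p2 (distr_of f2)"
    using bdd[OF symbol_in_BS] fin unfolding bounded_op_def by auto
  have in1: "\<exists>C>0. \<forall>A>0. \<forall>c>0.
      distr_of (tensor_ift (\<lambda>_::'n. \<lambda>u. of_real (A / c) * of_real (w (u / c)))) \<in> hardy \<phi> p' \<and>
      hardy_norm \<phi> p' (distr_of (tensor_ift (\<lambda>_::'n. \<lambda>u. of_real (A / c) * of_real (w (u / c))))) \<le>
        ennreal (C * A ^ CARD('n) * c powr (- real CARD('n) * enn2real (1 / p')))" if "p' > 0" for p'
    by (rule hardy_norm_dilated_band_limited[OF \<phi> that tw, of "1/64"]) (use w(4) in auto)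
  obtain C1 where C1: "C1 > 0" "\<And>A c. A > 0 \<Longrightarrow> c > 0 \<Longrightarrow>
      distr_of (tensor_ift (\<lambda>_::'n. \<lambda>u. of_real (A / c) * of_real (w (u / c)))) \<in> hardy \<phi> p1 \<and>
      hardy_norm \<phi> p1 (distr_of (tensor_ift (\<lambda>_::'n. \<lambda>u. of_real (A / c) * of_real (w (u / c))))) \<le>
        ennreal (C1 * A ^ CARD('n) * c powr (- real CARD('n) * enn2real (1 / p1)))"
    using in1[OF p(1)] by blast
  obtain C2 where C2: "C2 > 0" "\<And>A c. A > 0 \<Longrightarrow> c > 0 \<Longrightarrow>
      distr_of (tensor_ift (\<lambda>_::'n. \<lambda>u. of_real (A / c) * of_real (w (u / c)))) \<in> hardy \<phi> p2 \<and>
      hardy_norm \<phi> p2 (distr_of (tensor_ift (\<lambda>_::'n. \<lambda>u. of_real (A / c) * of_real (w (u / c))))) \<le>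
        ennreal (C2 * A ^ CARD('n) * c powr (- real CARD('n) * enn2real (1 / p2)))"
    using in1[OF p(2)] by blast
  let ?n = "real CARD('n)"
  define a b c where "a = enn2real (1 / p1)" and "b = enn2real (1 / p2)" and "c = enn2real (1 / p)"
  have c: "c = 1 / q" using enn2real_inverse[OF q] pq by (simp add: c_def)
  have B0: "((1/640 :: real)\<^sup>2) ^ CARD('n) > 0" by simp
  have main: "((1/640)\<^sup>2) ^ CARD('n) * (8 ^ k) powr (?n * (c - (a + b))) \<le> C * C1 * C2" for k
  proof -
    \<comment> \<open>Spectra shrink with \<epsilon>, so the product is bounded below on a cube of
      side 1/\<epsilon>. The output norm is at least of order \<epsilon>^(-n/p), the inputs have
      norms of order at most \<epsilon>^(-n/p1) and \<epsilon>^(-n/p2).\<close>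
    define \<epsilon> where "\<epsilon> = 1 / (8::real) ^ k"
    have \<epsilon>: "\<epsilon> > 0" "\<epsilon> \<le> 1" by (simp_all add: \<epsilon>_def)
    define v where "v u = complex_of_real (1 / \<epsilon>) * of_real (w (u / \<epsilon>))" for u
    have tv: "test_fun v"
    proof -
      have "test_fun (\<lambda>u. complex_of_real (w (u / \<epsilon>)))" using test_fun_affine[OF tw, of "1 / \<epsilon>" 0] \<epsilon> by simp
      then show ?thesis unfolding v_def[abs_def] by (rule test_fun_mult[OF smooth1_const])
    qed
    have ift_v: "ift v y = ift (\<lambda>u. of_real (w u)) (\<epsilon> * y)" for y
      unfolding v_def[abs_def] ift_cmult ift_scale[OF \<epsilon>(1), of "\<lambda>u. of_real (w u)"] using \<epsilon> by simp
    have hv: "of_real (h (u / 1 - (0 :: real ^ 'n) $ j)) * v u = v u" for u j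
    proof (cases "v u = 0")
      case False
      then have "\<not> (u / \<epsilon> \<le> 1/64 \<or> 1/16 \<le> u / \<epsilon>)" using w(4)[of "u / \<epsilon>"] by (auto simp: v_def)
      \<comment> \<open>As \<epsilon> <= 1, the whole spectrum lies on the plateau of the symbol,
        which acts as the identity.\<close>
      then have "0 < u" "u < 1/16 * \<epsilon>" using \<epsilon> by (auto simp: field_simps)
      then have "h u = 1" using \<epsilon> by (intro h(2)) auto
      then show ?thesis by simp
    qed simp
    have T: "T_op symbol (tensor_ift (\<lambda>_. v)) (tensor_ift (\<lambda>_. v)) x = (\<Prod>j\<in>UNIV. (ift (\<lambda>u. of_real (w u)) (\<epsilon> * x $ j))\<^sup>2)" for x
      using T_op_symbol[OF tv tv, of "{()}" x] unfolding hv by (simp add: ift_v power2_eq_square)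
    have "ennreal (((1/640)\<^sup>2) ^ CARD('n) * (1 / \<epsilon>) powr (?n / q)) \<le>
       Lp_norm p (\<lambda>x. ennreal (norm (T_op symbol (tensor_ift (\<lambda>_. v)) (tensor_ift (\<lambda>_. v)) x)))"
      unfolding pq
    proof (rule Lp_norm_ge_cbox[OF q])
      fix x :: "real ^ 'n" assume x: "\<And>j. 0 \<le> x $ j \<and> x $ j \<le> 1 / \<epsilon>"
      have "(\<Prod>j\<in>(UNIV::'n set). (1/640)\<^sup>2) \<le> (\<Prod>j\<in>UNIV. (norm (ift (\<lambda>u. of_real (w u)) (\<epsilon> * x $ j)))\<^sup>2)"
      proof (intro prod_mono conjI power_mono)
        fix j
        have "\<epsilon> * x $ j \<le> \<epsilon> * (1 / \<epsilon>)" using x[of j] \<epsilon> by (intro mult_left_mono) auto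
        then have "\<bar>\<epsilon> * x $ j\<bar> \<le> 1" using x[of j] \<epsilon> by simp
        then have "\<bar>\<epsilon> * x $ j\<bar> \<le> 2 * pi" using pi_ge_two by linarith
        moreover have w0: "w u = 0" if "1/8 \<le> \<bar>u\<bar>" for u
          using w(4)[of u] that by (cases "u \<le> 0") auto
        \<comment> \<open>The left-hand side is 1/320, so 1/640 is a safe bound.\<close>
        ultimately have "(1/32 - 1/40) / 2 \<le> norm (ift (\<lambda>u. of_real (w u)) (\<epsilon> * x $ j))"
          by (intro norm_ift_lower_bound[OF tw w(2,3) w0]) auto
        then show "1/640 \<le> norm (ift (\<lambda>u. of_real (w u)) (\<epsilon> * x $ j))" by simp
      qed auto
      then show "((1/640)\<^sup>2) ^ CARD('n) \<le> norm (T_op symbol (tensor_ift (\<lambda>_. v)) (tensor_ift (\<lambda>_. v)) x)"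
        unfolding T prod_norm[symmetric] norm_power by simp
    qed (use \<epsilon> in auto)
    also have "\<dots> \<le> ennreal C * hardy_norm \<phi> p1 (distr_of (tensor_ift (\<lambda>_. v))) * hardy_norm \<phi> p2 (distr_of (tensor_ift (\<lambda>_. v)))"
      using C1(2)[of 1 \<epsilon>] C2(2)[of 1 \<epsilon>] \<epsilon> by (intro C(2) tensor_ift_schwartz tv) (auto simp: v_def[abs_def])
    also have "\<dots> \<le> ennreal C * ennreal (C1 * \<epsilon> powr (- ?n * a)) * ennreal (C2 * \<epsilon> powr (- ?n * b))"
      using C1(2)[of 1 \<epsilon>] C2(2)[of 1 \<epsilon>] \<epsilon> by (intro mult_mono) (auto simp: v_def[abs_def] a_def b_def)
    also have "\<dots> = ennreal (C * (C1 * \<epsilon> powr (- ?n * a)) * (C2 * \<epsilon> powr (- ?n * b)))"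
      using C(1) C1(1) C2(1) by (simp only: ennreal_mult[symmetric] mult_nonneg_nonneg powr_ge_zero less_imp_le)
    finally have le: "((1/640)\<^sup>2) ^ CARD('n) * (1 / \<epsilon>) powr (?n / q) \<le> C * (C1 * \<epsilon> powr (- ?n * a)) * (C2 * \<epsilon> powr (- ?n * b))"
      by (subst (asm) ennreal_le_iff) (use C(1) C1(1) C2(1) in auto)
    let ?X = "(8::real) ^ k"
    have \<epsilon>p: "\<epsilon> powr (- t) = ?X powr t" for t
      unfolding \<epsilon>_def by (simp add: powr_minus powr_divide)
    have le: "((1/640)\<^sup>2) ^ CARD('n) * ?X powr (?n * c) \<le> C * C1 * C2 * ?X powr (?n * (a + b))"
    proof -
      have "C * (C1 * \<epsilon> powr (- ?n * a)) * (C2 * \<epsilon> powr (- ?n * b)) = C * C1 * C2 * ?X powr (?n * (a + b))"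
        unfolding minus_mult_left[symmetric] \<epsilon>p distrib_left powr_add by (simp only: mult_ac)
      moreover have "1 / \<epsilon> = ?X" "?n * c = ?n / q" by (simp_all add: \<epsilon>_def c)
      ultimately show ?thesis using le by (simp only:)
    qed
    have "?X powr (?n * (c - (a + b))) = ?X powr (?n * c) / ?X powr (?n * (a + b))"
      by (simp only: right_diff_distrib powr_diff)
    then show ?thesis using le by (simp add: divide_le_eq)
  qed
  have "?n * (c - (a + b)) \<le> 0"
    by (rule bounded_growth[OF B0]) (use main in blast)
  then have "c \<le> a + b" by (simp add: mult_le_0_iff)
  then show ?thesis by (simp add: a_def b_def c_def)
qed

lemma Lp_exponent_ge:
  fixes \<phi> :: "real ^ 'n \<Rightarrow> complex"
  assumes \<rho>: "0 < \<rho>" "\<rho> < 1" and p: "0 < p1" "0 < p2" "0 < p" and \<phi>: "\<phi> \<in> schwartz"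
    and bdd: "\<And>\<sigma> :: real ^ 'n \<Rightarrow> real ^ 'n \<Rightarrow> real ^ 'n \<Rightarrow> complex. \<sigma> \<in> BS (m_crit CARD('n) \<rho> p1 p2) \<rho> \<Longrightarrow>
           bounded_op (T_op \<sigma>) (hardy \<phi> p1) (hardy_norm \<phi> p1) (hardy \<phi> p2) (hardy_norm \<phi> p2)
             (if p < \<infinity> then (\<lambda>g. Lp_norm p (\<lambda>x. ennreal (norm (g x)))) else bmo_norm)"
  shows "enn2real (1 / p1) + enn2real (1 / p2) \<le> enn2real (1 / p)"
proof -
  let ?n = "real CARD('n)"
  let ?N = "if p < \<infinity> then (\<lambda>g. Lp_norm p (\<lambda>x. ennreal (norm (g x)))) else (bmo_norm :: (real ^ 'n \<Rightarrow> complex) \<Rightarrow> ennreal)"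
  define a b c where "a = enn2real (1 / p1)" and "b = enn2real (1 / p2)" and "c = enn2real (1 / p)"
  define m where "m = m_crit CARD('n) \<rho> p1 p2"
  define \<kappa> where "\<kappa> = \<rho> / (1 - \<rho>)"
  define M where "M = Max {1/2, a, b, 1 - a - b, a + b - 1/2}"
  obtain h :: "real \<Rightarrow> real" where h: "smooth1 (\<lambda>u. of_real (h u))" "\<And>u. 0 \<le> h u"
    "\<And>u. - 1/16 \<le> u \<Longrightarrow> u \<le> 1/16 \<Longrightarrow> h u = 1" "\<And>u. u \<le> - 1/8 \<or> 1/8 \<le> u \<Longrightarrow> h u = 0"
    by (rule plateau_exists[of "- 1/8" "- 1/16" "1/16" "1/8"]) auto
  interpret plateau h \<rho>
  proof
    show "h u = 1" if "\<bar>u\<bar> \<le> 1/16" for u using that by (intro h(3)) (auto simp: abs_le_iff)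
    show "h u = 0" if "1/8 \<le> \<bar>u\<bar>" for u using that by (intro h(4)) (auto simp: abs_if split: if_splits)
  qed (use \<rho> h in auto)
  obtain C1 \<alpha> g1 where 1: "C1 > 0" "\<And>k a. (\<alpha> k a)\<^sup>2 = 1" "test_fun (\<lambda>u. of_real (g1 u))" "\<And>u. 0 \<le> g1 u"
    "\<And>u. \<bar>u\<bar> \<le> 1/16 \<Longrightarrow> g1 u = 1" "\<And>u. 1/8 \<le> \<bar>u\<bar> \<Longrightarrow> g1 u = 0"
    "\<And>k. \<exists>v. admissible_input \<phi> p1 \<alpha> (\<lambda>u. of_real (g1 u)) C1 k v"
    by (rule input_exists[OF \<phi> p(1)], rule that)
  obtain C2 \<beta> g2 where 2: "C2 > 0" "\<And>k a. (\<beta> k a)\<^sup>2 = 1" "test_fun (\<lambda>u. of_real (g2 u))" "\<And>u. 0 \<le> g2 u"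
    "\<And>u. \<bar>u\<bar> \<le> 1/16 \<Longrightarrow> g2 u = 1" "\<And>u. 1/8 \<le> \<bar>u\<bar> \<Longrightarrow> g2 u = 0"
    "\<And>k. \<exists>v. admissible_input \<phi> p2 \<beta> (\<lambda>u. of_real (g2 u)) C2 k v"
    by (rule input_exists[OF \<phi> p(2)], rule that)
  let ?\<eta>1 = "\<lambda>u. complex_of_real (g1 u)" and ?\<eta>2 = "\<lambda>u. complex_of_real (g2 u)"
  \<comment> \<open>The plateau [-1/16, 1/16] has length 1/8, half of which is the bound.\<close>
  have low1: "1 / 16 \<le> norm (ift ?\<eta>1 y)" if "\<bar>y\<bar> \<le> 2 * pi" for y
    using norm_ift_lower_bound[OF 1(3,4), of "-1/16" "1/16" y] 1(5,6) that by (simp add: abs_le_iff)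
  have low2: "1 / 16 \<le> norm (ift ?\<eta>2 y)" if "\<bar>y\<bar> \<le> 2 * pi" for y
    using norm_ift_lower_bound[OF 2(3,4), of "-1/16" "1/16" y] 2(5,6) that by (simp add: abs_le_iff)
  define C0 where "C0 = max 1 ((LINT u|lborel. norm (?\<eta>1 u)) * (LINT u|lborel. norm (?\<eta>2 u)))"
  have C0: "C0 \<ge> 1" "norm (ift ?\<eta>1 y) * norm (ift ?\<eta>2 y) \<le> C0" for y
  proof -
    have "norm (ift ?\<eta>1 y) * norm (ift ?\<eta>2 y) \<le> (LINT u|lborel. norm (?\<eta>1 u)) * (LINT u|lborel. norm (?\<eta>2 u))"
      by (intro mult_mono norm_ift_le test_fun_integrable 1(3) 2(3) integral_nonneg_AE) auto
    then show "norm (ift ?\<eta>1 y) * norm (ift ?\<eta>2 y) \<le> C0" by (simp add: C0_def)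
  qed (simp add: C0_def)
  define r where "r = kernel_sum (2 \<le> p)"
  have abs1: "\<bar>x\<bar> = 1" if "x\<^sup>2 = 1" for x :: real using that by (simp add: abs_square_eq_1)
  have r_le: "\<bar>r k l\<bar> \<le> 1" for k l
    unfolding r_def kernel_sum_def using abs_rs_coeff(1)[of "3 * k" "l - 3 * 8 ^ k"] by auto
  have cc: "\<bar>\<alpha> k a' * \<beta> k b' * r k (a' + b')\<bar> \<le> 1" for k a' b'
    unfolding abs_mult abs1[OF 1(2)] abs1[OF 2(2)] using r_le by simp
  obtain \<sigma> :: "real ^ 'n \<Rightarrow> real ^ 'n \<Rightarrow> real ^ 'n \<Rightarrow> complex" where \<sigma>: "\<sigma> \<in> BS m \<rho>"
    "\<And>k v1 v2 x. test_fun v1 \<Longrightarrow> test_fun v2 \<Longrightarrow>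
       (\<And>u. v1 u \<noteq> 0 \<Longrightarrow> freq \<rho> k / 2 < u \<and> u < 4 * freq \<rho> k) \<Longrightarrow>
       (\<And>a u. 8 ^ k \<le> a \<Longrightarrow> a < 3 * 8 ^ k \<Longrightarrow> \<theta> (u / spacing \<rho> k - real a) * v1 u =
          of_real (\<alpha> k a) * (?\<eta>1 (u / spacing \<rho> k - real a) / of_real (spacing \<rho> k))) \<Longrightarrow>
       (\<And>b u. 8 ^ k \<le> b \<Longrightarrow> b < 3 * 8 ^ k \<Longrightarrow> \<theta> (u / spacing \<rho> k - real b) * v2 u =
          of_real (\<beta> k b) * (?\<eta>2 (u / spacing \<rho> k - real b) / of_real (spacing \<rho> k))) \<Longrightarrow>
       T_op \<sigma> (tensor_ift (\<lambda>_. v1)) (tensor_ift (\<lambda>_. v2)) x = model_output (2 \<le> p) m ?\<eta>1 ?\<eta>2 k x"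
  proof (rule lattice_symbol[OF \<rho>, of \<theta> "\<lambda>k a' b'. \<alpha> k a' * \<beta> k b' * r k (a' + b')" m])
    fix \<sigma> :: "real ^ 'n \<Rightarrow> real ^ 'n \<Rightarrow> real ^ 'n \<Rightarrow> complex"
    assume \<sigma>: "\<sigma> \<in> BS m \<rho>" and T: "\<And>k v1 v2 \<eta>1 \<eta>2 \<alpha>' \<beta>' r' x. test_fun v1 \<Longrightarrow> test_fun v2 \<Longrightarrow>
       (\<And>u. v1 u \<noteq> 0 \<Longrightarrow> freq \<rho> k / 2 < u \<and> u < 4 * freq \<rho> k) \<Longrightarrow>
       (\<And>a u. 8 ^ k \<le> a \<Longrightarrow> a < 3 * 8 ^ k \<Longrightarrow> \<theta> (u / spacing \<rho> k - real a) * v1 u =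
          of_real (\<alpha>' a) * (\<eta>1 (u / spacing \<rho> k - real a) / of_real (spacing \<rho> k))) \<Longrightarrow>
       (\<And>b u. 8 ^ k \<le> b \<Longrightarrow> b < 3 * 8 ^ k \<Longrightarrow> \<theta> (u / spacing \<rho> k - real b) * v2 u =
          of_real (\<beta>' b) * (\<eta>2 (u / spacing \<rho> k - real b) / of_real (spacing \<rho> k))) \<Longrightarrow>
       (\<And>a. (\<alpha>' a)\<^sup>2 = 1) \<Longrightarrow> (\<And>b. (\<beta>' b)\<^sup>2 = 1) \<Longrightarrow>
       (\<And>j. \<not> (3 * 8 ^ k \<le> j \<and> j < 4 * 8 ^ k) \<Longrightarrow> r' j = 0) \<Longrightarrow>
       (\<And>a b. \<alpha> k a * \<beta> k b * r k (a + b) = \<alpha>' a * \<beta>' b * r' (a + b)) \<Longrightarrow>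
       T_op \<sigma> (tensor_ift (\<lambda>_. v1)) (tensor_ift (\<lambda>_. v2)) x =
         of_real (freq \<rho> k powr m) * (\<Prod>j\<in>UNIV. 8 ^ k * (\<Sum>l=3*8^k..<4*8^k. of_real (r' l) * cis (real l * (spacing \<rho> k * x $ j))) *
           ift \<eta>1 (spacing \<rho> k * x $ j) * ift \<eta>2 (spacing \<rho> k * x $ j))"
    show thesis
    proof (rule that[OF \<sigma>])
      fix k v1 v2 x
      assume "test_fun v1" "test_fun v2" "\<And>u. v1 u \<noteq> 0 \<Longrightarrow> freq \<rho> k / 2 < u \<and> u < 4 * freq \<rho> k"
       "\<And>a u. 8 ^ k \<le> a \<Longrightarrow> a < 3 * 8 ^ k \<Longrightarrow> \<theta> (u / spacing \<rho> k - real a) * v1 u =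
          of_real (\<alpha> k a) * (?\<eta>1 (u / spacing \<rho> k - real a) / of_real (spacing \<rho> k))"
       "\<And>b u. 8 ^ k \<le> b \<Longrightarrow> b < 3 * 8 ^ k \<Longrightarrow> \<theta> (u / spacing \<rho> k - real b) * v2 u =
          of_real (\<beta> k b) * (?\<eta>2 (u / spacing \<rho> k - real b) / of_real (spacing \<rho> k))"
      note T = T[OF this 1(2) 2(2), of "r k" x]
      show "T_op \<sigma> (tensor_ift (\<lambda>_. v1)) (tensor_ift (\<lambda>_. v2)) x = model_output (2 \<le> p) m ?\<eta>1 ?\<eta>2 k x"
        unfolding model_output_def r_def[symmetric]
        by (rule T) (assumption | simp only: r_def kernel_sum_def if_False refl)+
    qed
  qed (use smooth_h h_eq_0 cc in auto)
  obtain C where C: "C > 0" "\<And>f1 f2. f1 \<in> schwartz \<Longrightarrow> f2 \<in> schwartz \<Longrightarrow> distr_of f1 \<in> hardy \<phi> p1 \<Longrightarrow> distr_of f2 \<in> hardy \<phi> p2 \<Longrightarrow>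
      ?N (T_op \<sigma> f1 f2) \<le> ennreal C * hardy_norm \<phi> p1 (distr_of f1) * hardy_norm \<phi> p2 (distr_of f2)"
    using bdd[of \<sigma>] \<sigma>(1) unfolding bounded_op_def m_def by blast
  \<comment> \<open>Exponent of X per coordinate in the output, apart from R^m. Concentration on
    scale 1/R = 1/(s X) is better for p >= 2, spreading over scale 1/s for p < 2.\<close>
  define e where "e = (if 2 \<le> p then 2 - c / (1 - \<rho>) else 3 / 2 - \<kappa> * c)"
  obtain c0 where c0: "c0 > 0" "\<And>k. k > 0 \<Longrightarrow> ennreal (c0 * (8 ^ k) powr (m / (1 - \<rho>) + ?n * e)) \<le> ?N (model_output (2 \<le> p) m ?\<eta>1 ?\<eta>2 k)"
    using output_ge[OF low1 low2 C0 p(3), where 'n = 'n] unfolding e_def c_def \<kappa>_def by blast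
  define e1 e2 where "e1 = min (1/2) (1 - a)" and "e2 = min (1/2) (1 - b)"
  \<comment> \<open>Exponent of X in the ratio of the output norm to the product of the input norms,
    with s = X^\<kappa>.\<close>
  define E where "E = m / (1 - \<rho>) + ?n * e - (?n * (e1 + e2) - \<kappa> * ?n * (a + b))"
  have "c0 * (8 ^ k) powr E \<le> C * C1 * C2" if k: "k > 0" for k
  proof -
    let ?X = "(8::real) ^ k" and ?s = "spacing \<rho> k"
    obtain v1 where v1: "admissible_input \<phi> p1 \<alpha> ?\<eta>1 C1 k v1" using 1(7) by blast
    obtain v2 where v2: "admissible_input \<phi> p2 \<beta> ?\<eta>2 C2 k v2" using 2(7) by blast
    note v1 = v1[unfolded admissible_input_def] and v2 = v2[unfolded admissible_input_def]
    have T: "T_op \<sigma> (tensor_ift (\<lambda>_. v1)) (tensor_ift (\<lambda>_. v2)) = model_output (2 \<le> p) m ?\<eta>1 ?\<eta>2 k"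
      by (rule ext, rule \<sigma>(2)) (use v1 v2 in blast)+
    have "ennreal (c0 * ?X powr (m / (1 - \<rho>) + ?n * e)) \<le> ?N (T_op \<sigma> (tensor_ift (\<lambda>_. v1)) (tensor_ift (\<lambda>_. v2)))"
      unfolding T by (rule c0(2)[OF k])
    also have "\<dots> \<le> ennreal C * hardy_norm \<phi> p1 (distr_of (tensor_ift (\<lambda>_. v1))) * hardy_norm \<phi> p2 (distr_of (tensor_ift (\<lambda>_. v2)))"
      by (intro C(2) tensor_ift_schwartz) (use v1 v2 in blast)+
    also have "\<dots> \<le> ennreal C * ennreal (C1 * ?X powr (?n * e1) * ?s powr (- ?n * a)) * ennreal (C2 * ?X powr (?n * e2) * ?s powr (- ?n * b))"
      unfolding e1_def e2_def a_def b_def by (intro mult_mono) (use v1 v2 in \<open>auto simp del: ennreal_mult'\<close>)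
    also have "\<dots> = ennreal (C * (C1 * ?X powr (?n * e1) * ?s powr (- ?n * a)) * (C2 * ?X powr (?n * e2) * ?s powr (- ?n * b)))"
      using C(1) 1(1) 2(1) by (simp only: ennreal_mult[symmetric] mult_nonneg_nonneg powr_ge_zero less_imp_le)
    finally have "c0 * ?X powr (m / (1 - \<rho>) + ?n * e) \<le> C * (C1 * ?X powr (?n * e1) * ?s powr (- ?n * a)) * (C2 * ?X powr (?n * e2) * ?s powr (- ?n * b))"
      by (subst (asm) ennreal_le_iff) (use C(1) 1(1) 2(1) in auto)
    also have "\<dots> = C * C1 * C2 * ?X powr (?n * (e1 + e2) - \<kappa> * ?n * (a + b))"
    proof -
      have s: "?s powr t = ?X powr (\<kappa> * t)" for t unfolding spacing_eq[OF \<rho>(2)] powr_powr \<kappa>_def ..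
      have "?n * (e1 + e2) - \<kappa> * ?n * (a + b) = ?n * e1 + \<kappa> * (- ?n * a) + (?n * e2 + \<kappa> * (- ?n * b))"
        by (simp add: algebra_simps)
      then show ?thesis unfolding s by (simp only: powr_add mult_ac)
    qed
    finally have le: "c0 * ?X powr (m / (1 - \<rho>) + ?n * e) \<le> C * C1 * C2 * ?X powr (?n * (e1 + e2) - \<kappa> * ?n * (a + b))" .
    have "?X powr E = ?X powr (m / (1 - \<rho>) + ?n * e) / ?X powr (?n * (e1 + e2) - \<kappa> * ?n * (a + b))"
      unfolding E_def by (rule powr_diff)
    then show ?thesis using le by (simp add: divide_le_eq)
  qed
  from bounded_growth[OF c0(1) this] have E: "E \<le> 0" .
  have mM: "m / (1 - \<rho>) = - ?n * M"
  proof -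
    have "m = (1 - \<rho>) * (- ?n * M)"
      unfolding m_def m_crit_def Let_def M_def a_def b_def by (simp only: minus_mult_left[symmetric] minus_mult_right[symmetric] mult.assoc)
    then show ?thesis using \<rho> by simp
  qed
  have "E = ?n * (e - M - e1 - e2 + \<kappa> * (a + b))"
    unfolding E_def mM by (simp add: algebra_simps)
  then have neg: "e - M - e1 - e2 + \<kappa> * (a + b) \<le> 0" using E by (simp add: mult_le_0_iff)
  have \<kappa>: "\<kappa> > 0" "1 / (1 - \<rho>) = 1 + \<kappa>" using \<rho> by (simp_all add: \<kappa>_def field_simps)
  \<comment> \<open>Fixing the entry that M equals and the branches of the two minima makes the
    remaining contradiction linear in a, b, c and the terms with \<kappa>.\<close>
  have M_cases: "M \<in> {1/2, a, b, 1 - a - b, a + b - 1/2}" unfolding M_def by (rule Max_in) auto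
  show ?thesis
  proof (rule ccontr)
    assume "\<not> ?thesis"
    then have lt: "c < a + b" by (simp add: a_def b_def c_def)
    then have \<kappa>lt: "\<kappa> * c < \<kappa> * (a + b)" using \<kappa>(1) by simp
    show False
    proof (cases "2 \<le> p")
      case True
      then have "c \<le> 1/2" using enn2real_inverse_le_half by (simp add: c_def)
      moreover have "e = 2 - (c + \<kappa> * c)"
      proof -
        have "c / (1 - \<rho>) = c * (1 / (1 - \<rho>))" by simp
        also have "\<dots> = c + \<kappa> * c" unfolding \<kappa>(2) by (simp add: algebra_simps)
        finally show ?thesis using True by (simp add: e_def)
      qed
      ultimately show False using neg \<kappa>lt lt M_cases unfolding e1_def e2_def by (auto simp: min_def split: if_splits)
    next
      case False
      then have "1/2 \<le> c" using enn2real_inverse_ge_half p(3) by (simp add: c_def)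
      moreover have "e = 3/2 - \<kappa> * c" using False by (simp add: e_def)
      ultimately show False using neg \<kappa>lt lt M_cases unfolding e1_def e2_def by (auto simp: min_def split: if_splits)
    qed
  qed
qed

theorem theorem1p1:
  fixes \<rho> :: real and p1 p2 p :: ennreal and \<phi> :: "real ^ 'n \<Rightarrow> complex"
  assumes "0 < \<rho>" and "\<rho> < 1"
    and "0 < p1" and "0 < p2" and "0 < p"
    and "\<phi> \<in> schwartz" and "(LINT x|lborel. \<phi> x) = 1"
    and "\<And>\<sigma> :: real ^ 'n \<Rightarrow> real ^ 'n \<Rightarrow> real ^ 'n \<Rightarrow> complex.
           \<sigma> \<in> BS (m_crit CARD('n) \<rho> p1 p2) \<rho> \<Longrightarrow>
           bounded_op (T_op \<sigma>) (hardy \<phi> p1) (hardy_norm \<phi> p1) (hardy \<phi> p2) (hardy_norm \<phi> p2)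
             (if p < \<infinity> then (\<lambda>g. Lp_norm p (\<lambda>x. ennreal (norm (g x)))) else bmo_norm)"
  shows "1 / p = 1 / p1 + 1 / p2"
proof -
  \<comment> \<open>Only r = 0 makes 1/r infinite, so for positive exponents the identity of reals
    lifts to extended reals.\<close>
  have fin: "1 / r = ennreal (enn2real (1 / r))" if "r > 0" for r :: ennreal
    using that by (cases "1 / r") (auto simp: ennreal_divide_eq_top_iff)
  have "enn2real (1 / p) = enn2real (1 / p1) + enn2real (1 / p2)"
    using Lp_exponent_le[OF assms(1-6,8)] Lp_exponent_ge[OF assms(1-6,8)] by (rule antisym)
  then show ?thesis
    using fin[OF assms(3)] fin[OF assms(4)] fin[OF assms(5)] by (metis enn2real_nonneg ennreal_plus)
qed

end
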